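(* Let $P$ and $Q$ be Borel probability measures on $\mathbb{R}^d$, each having a positive density in the interior of its convex support, and each having finite moment of order $4+\delta$ for some $\delta>0$. Let $\varphi_0$ be the optimal transportation potential from $P$ to $Q$. Let $X_1,X_2,\ldots$ be i.i.d. random variables with law $P$, let $P_n$ be the empirical measure on $X_1,\ldots,X_n$, and set $$R_n=\mathcal{W}_2^2(P_n,Q)-\int_{\mathbb{R}^d}\big(\|x\|^2-2\varphi_0(x)\big)\,dP_n(x).$$ Then $n\,\mathrm{Var}(R_n)\to 0$ as $n\to\infty$.
   Context: $\mathcal{W}_2^2(P,Q)$ is the minimum of $\int\|x-y\|^2\,d\pi(x,y)$ over Borel probabilities $\pi$ on $\mathbb{R}^d\times\mathbb{R}^d$ with marginals $P$ and $Q$. The empirical measure is $P_n=\frac1n\sum_{i=1}^n\delta_{X_i}$. Convex functions on $\mathbb{R}^d$ take values in $(-\infty,+\infty]$, and $h^*(x)=\sup_{y}(x\cdot y-h(y))$ is the convex conjugate of $h$. Let $\Phi$ be the set of pairs $(\varphi,\psi)\in L_1(P)\times L_1(Q)$ with $\varphi(x)+\psi(y)\ge x\cdot y$ for all $x,y\in\mathbb{R}^d$, and $J(\varphi,\psi)=\int\varphi\,dP+\int\psi\,dQ$. An optimal transportation potential from $P$ to $Q$ is a proper, lower semicontinuous, convex function $\varphi_0$ such that $(\varphi_0,\varphi_0^* )\in\Phi$ minimizes $J$ over $\Phi$; under the present assumptions it is $P$-a.s. unique up to an additive constant (and $\mathrm{Var}(R_n)$ does not depend on the constant). "$Q$ has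 a positive density in the interior of its convex support" means that $Q$ is absolutely continuous with respect to Lebesgue measure, with a density that is strictly positive on the interior of the convex support of $Q$ (the smallest closed convex set of full $Q$-measure); likewise for $P$. *)

theory Defs
  imports "HOL-Probability.Probability"
begin

section \<open>Measures\<close>

definition empirical_measure :: "nat \<Rightarrow> (nat \<Rightarrow> 'a::euclidean_space) \<Rightarrow> 'a measure" where
  "empirical_measure n x = distr (uniform_count_measure {1..n}) borel x"

lemma emeasure_empirical_measure:
  fixes x :: "nat \<Rightarrow> 'a::euclidean_space"
  assumes "1 \<le> n" "A \<in> sets borel"
  shows "emeasure (empirical_measure n x) A = ennreal ((1 / real n) * (\<Sum>i=1..n. indicator A (x i)))"
proof -
  have meas: "x \<in> uniform_count_measure {1..n} \<rightarrow>\<^sub>M borel"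
    by (rule measurableI) (auto simp: space_uniform_count_measure sets_uniform_count_measure)
  have "(\<Sum>i=1..n. indicator A (x i) :: real) = real (card (x -` A \<inter> {1..n}))"
    by (simp add: indicator_def sum.If_cases Int_def vimage_def conj_commute)
  moreover have "emeasure (uniform_count_measure {1..n}) (x -` A \<inter> {1..n}) =
      ennreal (real (card (x -` A \<inter> {1..n})) / real n)"
    by (subst emeasure_uniform_count_measure) auto
  ultimately show ?thesis
    unfolding empirical_measure_def
    by (subst emeasure_distr[OF meas]) (use assms in \<open>simp_all add: space_uniform_count_measure\<close>)
qed

definition couplings :: "'a::euclidean_space measure \<Rightarrow> 'a measure \<Rightarrow> ('a \<times> 'a) measure set" where
  "couplings P Q = {\<pi>. prob_space \<pi> \<and> sets \<pi> = sets borel \<and>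
      distr \<pi> borel fst = P \<and> distr \<pi> borel snd = Q}"

text \<open>The squared 2-Wasserstein distance. The infimum over couplings is attained for Borel
  probability measures. It is taken in \<^typ>\<open>ennreal\<close> and is finite for measures with finite
  second moments.\<close>

definition wasserstein2_sq :: "'a::euclidean_space measure \<Rightarrow> 'a measure \<Rightarrow> real" where
  "wasserstein2_sq P Q =
     enn2real (INF \<pi>\<in>couplings P Q. \<integral>\<^sup>+ z. ennreal ((norm (fst z - snd z))\<^sup>2) \<partial>\<pi>)"

definition convex_support :: "'a::euclidean_space measure \<Rightarrow> 'a set" where
  "convex_support \<mu> = \<Inter>{C. closed C \<and> convex C \<and> emeasure \<mu> (- C) = 0}"

text \<open>The equation \<open>\<mu> = density lborel f\<close> also says that \<open>\<mu>\<close> is a Borel measure.\<close>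

definition has_positive_density :: "'a::euclidean_space measure \<Rightarrow> bool" where
  "has_positive_density \<mu> \<longleftrightarrow>
     (\<exists>f :: 'a \<Rightarrow> real. f \<in> borel_measurable borel \<and> (\<forall>x. 0 \<le> f x) \<and>
        \<mu> = density lborel (\<lambda>x. ennreal (f x)) \<and>
        (\<forall>x \<in> interior (convex_support \<mu>). 0 < f x))"

section \<open>Extended real valued convex functions\<close>

definition proper_fun :: "('a \<Rightarrow> ereal) \<Rightarrow> bool" where
  "proper_fun h \<longleftrightarrow> (\<forall>x. h x \<noteq> -\<infinity>) \<and> (\<exists>x. h x \<noteq> \<infinity>)"

definition lsc_fun :: "('a::topological_space \<Rightarrow> ereal) \<Rightarrow> bool" where
  "lsc_fun h \<longleftrightarrow> (\<forall>x. h x \<le> Liminf (at x) h)"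

text \<open>Meant for functions that avoid \<open>-\<infinity>\<close>, so that the sum below is never \<open>\<infinity> - \<infinity>\<close>.\<close>

definition convex_fun :: "('a::real_vector \<Rightarrow> ereal) \<Rightarrow> bool" where
  "convex_fun h \<longleftrightarrow> (\<forall>x y t. 0 < t \<and> t < 1 \<longrightarrow>
     h ((1 - t) *\<^sub>R x + t *\<^sub>R y) \<le> ereal (1 - t) * h x + ereal t * h y)"

definition conjugate :: "('a::real_inner \<Rightarrow> ereal) \<Rightarrow> 'a \<Rightarrow> ereal" where
  "conjugate h x = (SUP y. ereal (x \<bullet> y) - h y)"

section \<open>The dual transportation problem\<close>

definition L1_ereal :: "'a measure \<Rightarrow> ('a \<Rightarrow> ereal) set" where
  "L1_ereal \<mu> = {f. f \<in> borel_measurable \<mu> \<and> (AE x in \<mu>. \<bar>f x\<bar> \<noteq> \<infinity>) \<and>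
     integrable \<mu> (\<lambda>x. real_of_ereal (f x))}"

definition dual_pairs ::
  "'a::euclidean_space measure \<Rightarrow> 'a measure \<Rightarrow> (('a \<Rightarrow> ereal) \<times> ('a \<Rightarrow> ereal)) set" where
  "dual_pairs P Q = {(\<phi>, \<psi>). \<phi> \<in> L1_ereal P \<and> \<psi> \<in> L1_ereal Q \<and>
     (\<forall>x. \<phi> x \<noteq> -\<infinity>) \<and> (\<forall>y. \<psi> y \<noteq> -\<infinity>) \<and>
     (\<forall>x y. ereal (x \<bullet> y) \<le> \<phi> x + \<psi> y)}"

definition dual_objective ::
  "'a::euclidean_space measure \<Rightarrow> 'a measure \<Rightarrow> ('a \<Rightarrow> ereal) \<Rightarrow> ('a \<Rightarrow> ereal) \<Rightarrow> real" where
  "dual_objective P Q \<phi> \<psi> =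
     (\<integral>x. real_of_ereal (\<phi> x) \<partial>P) + (\<integral>y. real_of_ereal (\<psi> y) \<partial>Q)"

definition optimal_transport_potential ::
  "'a::euclidean_space measure \<Rightarrow> 'a measure \<Rightarrow> ('a \<Rightarrow> ereal) \<Rightarrow> bool" where
  "optimal_transport_potential P Q \<phi>0 \<longleftrightarrow>
     proper_fun \<phi>0 \<and> lsc_fun \<phi>0 \<and> convex_fun \<phi>0 \<and>
     (\<phi>0, conjugate \<phi>0) \<in> dual_pairs P Q \<and>
     (\<forall>(\<phi>, \<psi>) \<in> dual_pairs P Q.
        dual_objective P Q \<phi>0 (conjugate \<phi>0) \<le> dual_objective P Q \<phi> \<psi>)"

section \<open>The remainder\<close>

text \<open>The potential is finite \<open>P\<close>-almost everywhere, so for a sample from \<open>P\<close> the conversion to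
  real numbers only matters on a null event.\<close>

definition remainder ::
  "'a::euclidean_space measure \<Rightarrow> ('a \<Rightarrow> ereal) \<Rightarrow> nat \<Rightarrow> (nat \<Rightarrow> 'a) \<Rightarrow> real" where
  "remainder Q \<phi>0 n x =
     wasserstein2_sq (empirical_measure n x) Q -
     (\<integral>y. ((norm y)\<^sup>2 - 2 * real_of_ereal (\<phi>0 y)) \<partial>(empirical_measure n x))"

end

(* Write the transport cost of the sample as a maximal correlation: if V n x is the supremum of
   sum_j (x_j . b_j - phi0 (x_j)) over the barycenters b_j of the laws nu_j into which Q is split
   (sum_j nu_j = n Q), then R_n = m_2(Q) - (2/n) V n. By the Efron-Stein inequality n Var(R_n) is
   at most 4 times the average over i of E[((V - V^i)^+)^2], where X_i is resampled in V^i.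

   Since the pair of phi0 and its conjugate is optimal, a first variation of the conjugate
   shows that Q is the image of P under T, the almost everywhere defined gradient of phi0; hence the duality gap of the sample
   tends to 0 in probability, and for a nearly optimal splitting most b_j are approximate
   subgradients of phi0 at x_j. To replace x_i by a point y, pass the masses along a chain of
   sample points close to the segment from x_i to y, each point handing its law nu to the next.
   The loss is bounded by the increments of b along the chain, which telescope, so it is small
   when the chain is fine. The exceptional indices i are controlled by moments of order 4 + delta. *)

theory Submission
  imports Defs
begin

section \<open>The Efron-Stein inequality\<close>

text \<open>The one-sided form of Efron-Stein shapes the proof: it suffices to exhibit for the
  resampled sample one splitting that loses little, and it is built from a nearly optimal splitting
  of the original sample. The obstacle is that handing the law at \<open>x i\<close> straight to
  \<open>y\<close> loses \<open>\<phi> y - \<phi> (x i) - barycenter \<nu> i \<bullet> (y - x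
  i)\<close>, a Bregman-type quantity that does not shrink with \<open>n\<close>. With
  \<open>m\<close> equal steps in between, each step pairs only with the difference of the
  subgradients at its two ends, and the total is of order \<open>1 / m\<close>, because approximate
  subgradients near a compact part of the interior of the support are bounded. For exceptional
  positions the direct loss is kept. It is at most the square of a sum of norms, so its square is a
  fourth power, and making the average of fourth powers over few positions small calls for uniform
  integrability, hence for a moment beyond order 4. The truncation level \<open>\<kappa>\<close> is
  fixed first, then the fraction \<open>\<eta>\<close> of exceptional mass, then the compact set,
  then the mesh of the chain, and only then \<open>n\<close>.\<close>

lemma (in prob_space) variance_le_positive_part:
  fixes h :: "'a \<Rightarrow> real"
  assumes [measurable]: "h \<in> borel_measurable M" and bd: "\<And>x. \<bar>h x\<bar> \<le> C"
  shows "ennreal ((\<integral>x. (h x)\<^sup>2 \<partial>M) - (\<integral>x. h x \<partial>M)\<^sup>2)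
    \<le> (\<integral>\<^sup>+x. \<integral>\<^sup>+y. ennreal ((max 0 (h x - h y))\<^sup>2) \<partial>M \<partial>M)"
proof -
  interpret PP: pair_prob_space M M ..
  let ?p = "\<lambda>x y. (max 0 (h x - h y))\<^sup>2"
  have C: "0 \<le> C" using bd[of undefined] by linarith
  have ih: "integrable M h" by (rule integrable_const_bound[of _ C]) (use bd in auto)
  have ih2: "integrable M (\<lambda>x. (h x)\<^sup>2)"
    by (rule integrable_const_bound[of _ "C\<^sup>2"]) (use bd C in \<open>auto simp: abs_le_square_iff[symmetric]\<close>)
  have d: "\<bar>h x - h y\<bar> \<le> 2 * C" for x y using bd[of x] bd[of y] by linarith
  have pb: "?p x y \<le> (2*C)\<^sup>2" for x y
    by (rule power_mono) (use d[of x y] C in auto)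
  have ip: "integrable M (\<lambda>y. ?p x y)" "integrable M (\<lambda>y. ?p y x)" for x
    by (rule integrable_const_bound[of _ "(2*C)\<^sup>2"]; use pb in auto)+
  have iip: "integrable M (\<lambda>x. \<integral>y. ?p x y \<partial>M)" "integrable M (\<lambda>x. \<integral>y. ?p y x \<partial>M)"
    by (rule integrable_const_bound[of _ "(2*C)\<^sup>2"]; 
       (intro AE_I2; subst real_norm_def; subst abs_of_nonneg; (intro integral_nonneg_AE AE_I2 zero_le_power2 integral_le_const ip pb))?; measurable)+
  have ipair: "integrable (M \<Otimes>\<^sub>M M) (\<lambda>(x,y). ?p x y)"
    by (rule PP.integrable_const_bound[of _ "(2*C)\<^sup>2"]) (use pb in auto)
  \<comment> \<open>Both one-sided halves of the expected squared difference are equal by symmetry,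
    and together they are twice the variance.\<close>
  have sw: "(\<integral>x. \<integral>y. ?p x y \<partial>M \<partial>M) = (\<integral>x. \<integral>y. ?p y x \<partial>M \<partial>M)"
    using PP.Fubini_integral[OF ipair] by simp
  have pt: "(h x - h y)\<^sup>2 = ?p x y + ?p y x" for x y
    by (auto simp: max_def power2_commute)
  have "(\<integral>x. \<integral>y. ?p x y \<partial>M \<partial>M) + (\<integral>x. \<integral>y. ?p y x \<partial>M \<partial>M) = (\<integral>x. \<integral>y. (h x - h y)\<^sup>2 \<partial>M \<partial>M)"
    using ip iip by (simp add: pt)
  also have "\<dots> = (\<integral>x. (h x)\<^sup>2 + (\<integral>y. (h y)\<^sup>2 \<partial>M) - 2 * (h x * (\<integral>y. h y \<partial>M)) \<partial>M)"
    using ih ih2 by (simp add: power2_diff prob_space mult.assoc)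
  also have "\<dots> = 2 * ((\<integral>x. (h x)\<^sup>2 \<partial>M) - (\<integral>x. h x \<partial>M)\<^sup>2)"
    using ih ih2 by (simp add: prob_space power2_eq_square)
  finally have eq: "(\<integral>x. (h x)\<^sup>2 \<partial>M) - (\<integral>x. h x \<partial>M)\<^sup>2 = (\<integral>x. \<integral>y. ?p x y \<partial>M \<partial>M)"
    using sw by simp
  have "(\<integral>\<^sup>+x. \<integral>\<^sup>+y. ennreal (?p x y) \<partial>M \<partial>M) = (\<integral>\<^sup>+x. ennreal (\<integral>y. ?p x y \<partial>M) \<partial>M)"
    by (intro nn_integral_cong nn_integral_eq_integral ip) auto
  also have "\<dots> = ennreal (\<integral>x. \<integral>y. ?p x y \<partial>M \<partial>M)"
    by (intro nn_integral_eq_integral iip) (auto intro!: integral_nonneg_AE)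
  finally show ?thesis by (simp add: eq)
qed

text \<open>Jensen's inequality for the convex function that sends \<open>t\<close> to
  \<open>(max 0 t)\<^sup>2\<close>; it lets a resampling difference pass through an average over
  another coordinate.\<close>

lemma (in prob_space) square_positive_part_integral_le:
  fixes h :: "'a \<Rightarrow> real"
  assumes [measurable]: "h \<in> borel_measurable M" and bd: "\<And>x. \<bar>h x\<bar> \<le> C"
  shows "ennreal ((max 0 (\<integral>x. h x \<partial>M))\<^sup>2) \<le> (\<integral>\<^sup>+x. ennreal ((max 0 (h x))\<^sup>2) \<partial>M)"
proof -
  have C: "0 \<le> C" using bd[of undefined] by linarith
  have bd': "\<bar>max 0 (h x)\<bar> \<le> C" for x using bd[of x] by auto
  have ih: "integrable M h" by (rule integrable_const_bound[of _ C]) (use bd in auto)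
  have im: "integrable M (\<lambda>x. max 0 (h x))" by (rule integrable_const_bound[of _ C]) (use bd' in auto)
  have im2: "integrable M (\<lambda>x. (max 0 (h x))\<^sup>2)"
    by (rule integrable_const_bound[of _ "C\<^sup>2"]) (use bd' C in \<open>auto simp: abs_le_square_iff[symmetric]\<close>)
  have "max 0 (\<integral>x. h x \<partial>M) \<le> (\<integral>x. max 0 (h x) \<partial>M)"
    using integral_mono[OF ih im] by (auto intro!: integral_nonneg_AE)
  then have "(max 0 (\<integral>x. h x \<partial>M))\<^sup>2 \<le> (\<integral>x. max 0 (h x) \<partial>M)\<^sup>2" by (intro power_mono) auto
  also have "\<dots> \<le> (\<integral>x. (max 0 (h x))\<^sup>2 \<partial>M)"
    using variance_positive[of "\<lambda>x. max 0 (h x)"] variance_eq[OF im im2] by simp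
  finally show ?thesis
    by (subst nn_integral_eq_integral[OF im2]) (auto intro: ennreal_leI)
qed

text \<open>Induction over the coordinates by the law of total variance: averaging out coordinate
  \<open>i\<close> leaves \<open>g\<close>. The conditional variance yields the term of
  \<open>i\<close>, and by Jensen's inequality the resampling terms of \<open>g\<close> are
  dominated by those of \<open>f\<close>.\<close>

lemma (in prob_space) efron_stein_bounded:
  fixes f :: "('i \<Rightarrow> 'a) \<Rightarrow> real"
  assumes "finite I" and "f \<in> borel_measurable (PiM I (\<lambda>_. M))" and "\<And>x. \<bar>f x\<bar> \<le> C"
  shows "ennreal ((\<integral>x. (f x)\<^sup>2 \<partial>PiM I (\<lambda>_. M)) - (\<integral>x. f x \<partial>PiM I (\<lambda>_. M))\<^sup>2)
    \<le> (\<Sum>i\<in>I. \<integral>\<^sup>+x. \<integral>\<^sup>+y. ennreal ((max 0 (f x - f (x(i := y))))\<^sup>2) \<partial>M \<partial>PiM I (\<lambda>_. M))"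
  using assms
proof (induction I arbitrary: f rule: finite_induct)
  case empty
  interpret E: prob_space "PiM {} (\<lambda>_::'i. M)" by (intro prob_space_PiM) unfold_locales
  have "(\<integral>x. f x \<partial>PiM {} (\<lambda>_. M)) = f (\<lambda>x. undefined)" for f :: "('i \<Rightarrow> 'a) \<Rightarrow> real"
    by (subst Bochner_Integration.integral_cong[OF refl, of _ f "\<lambda>_. f (\<lambda>x. undefined)"])
       (auto simp: space_PiM_empty E.prob_space[unfolded space_PiM_empty] E.prob_space)
  then show ?case by simp
next
  case (insert i I)
  note [measurable] = insert.prems(1)
  note bd = insert.prems(2)
  have C: "0 \<le> C" using bd[of undefined] by linarith
  interpret PS: product_prob_space "\<lambda>_::'i. M" "UNIV" by unfold_locales
  interpret Pi: prob_space "PiM I (\<lambda>_::'i. M)" by (intro prob_space_PiM) unfold_locales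
  interpret Pi': prob_space "PiM (insert i I) (\<lambda>_::'i. M)" by (intro prob_space_PiM) unfold_locales
  interpret PP: pair_prob_space M M ..
  let ?P = "PiM I (\<lambda>_. M)" and ?P' = "PiM (insert i I) (\<lambda>_. M)"
  have upd[measurable]: "(\<lambda>(x,y). x(i := y)) \<in> ?P \<Otimes>\<^sub>M M \<rightarrow>\<^sub>M ?P'"
    using measurable_add_dim[of i I "\<lambda>_. M"] by simp
  have updj[measurable]: "(\<lambda>(x,y). x(j := y)) \<in> PiM J (\<lambda>_. M) \<Otimes>\<^sub>M M \<rightarrow>\<^sub>M PiM J (\<lambda>_. M)" if "j \<in> J" for j J
    using that measurable_fun_upd[of J J j fst "PiM J (\<lambda>_. M) \<Otimes>\<^sub>M M" "\<lambda>_. M" snd]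
    by (simp add: insert_absorb case_prod_beta')
  have f1[measurable]: "(\<lambda>(x,y). f (x(i := y))) \<in> borel_measurable (?P \<Otimes>\<^sub>M M)"
    using measurable_compose[OF upd insert.prems(1)] by (simp only: case_prod_beta')
  define g where "g x = (\<integral>y. f (x(i := y)) \<partial>M)" for x
  define g2 where "g2 x = (\<integral>y. (f (x(i := y)))\<^sup>2 \<partial>M)" for x
  have gm[measurable]: "g \<in> borel_measurable ?P" unfolding g_def by measurable
  have g2m[measurable]: "g2 \<in> borel_measurable ?P" unfolding g2_def by measurable
  have f2bd: "(f x)\<^sup>2 \<le> C\<^sup>2" for x using bd[of x] C by (auto simp: abs_le_square_iff[symmetric])
  have fx[measurable]: "(\<lambda>y. f (x(i := y))) \<in> borel_measurable M" if "x \<in> space ?P" for x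
    using measurable_compose[OF measurable_Pair1'[OF that] f1] by simp
  have ifx: "integrable M (\<lambda>y. f (x(i := y)))" "integrable M (\<lambda>y. (f (x(i := y)))\<^sup>2)" if "x \<in> space ?P" for x
    by (rule integrable_const_bound[of _ C] integrable_const_bound[of _ "C\<^sup>2"];
        use that bd f2bd in \<open>auto intro!: AE_I2\<close>)+
  \<comment> \<open>The induction hypothesis asks for the bound at every \<open>x\<close>, also
    outside the product space, where the integrand may fail to be integrable and the integral
    defaults to 0.\<close>
  have gbd: "\<bar>g x\<bar> \<le> C" for x
  proof (cases "integrable M (\<lambda>y. f (x(i := y)))")
    case True
    have "\<bar>g x\<bar> \<le> (\<integral>y. \<bar>f (x(i := y))\<bar> \<partial>M)" unfolding g_def by (rule integral_abs_bound)
    also have "\<dots> \<le> C" using True bd by (intro integral_le_const) auto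
    finally show ?thesis .
  qed (simp add: g_def not_integrable_integral_eq C)
  have g2bd: "g2 x \<le> C\<^sup>2" if "x \<in> space ?P" for x
    unfolding g2_def using that f2bd by (intro integral_le_const ifx) auto
  have gle: "(g x)\<^sup>2 \<le> g2 x" if "x \<in> space ?P" for x
    using variance_positive[of "\<lambda>y. f (x(i := y))"] variance_eq[OF ifx[OF that]] by (simp add: g_def g2_def)
  have gsq: "(g x)\<^sup>2 \<le> C\<^sup>2" for x using gbd[of x] C by (auto simp: abs_le_square_iff[symmetric])
  have ig: "integrable ?P g" "integrable ?P (\<lambda>x. (g x)\<^sup>2)"
    by (rule Pi.integrable_const_bound[of _ C] Pi.integrable_const_bound[of _ "C\<^sup>2"]; use gbd gsq in auto)+
  have ig2: "integrable ?P g2"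
    by (rule Pi.integrable_const_bound[of _ "C\<^sup>2"])
      (use g2bd order_trans[OF zero_le_power2 gle] in \<open>auto intro!: AE_I2 simp: abs_of_nonneg\<close>)
  have if': "integrable ?P' f" "integrable ?P' (\<lambda>x. (f x)\<^sup>2)"
    by (rule Pi'.integrable_const_bound[of _ C] Pi'.integrable_const_bound[of _ "C\<^sup>2"]; use bd f2bd in auto)+
  have e1: "(\<integral>x. f x \<partial>?P') = (\<integral>x. g x \<partial>?P)"
    unfolding g_def by (rule PS.product_integral_insert[OF insert.hyps if'(1)])
  have e2: "(\<integral>x. (f x)\<^sup>2 \<partial>?P') = (\<integral>x. g2 x \<partial>?P)"
    unfolding g2_def by (rule PS.product_integral_insert[OF insert.hyps if'(2)])
  have "(\<integral>x. (f x)\<^sup>2 \<partial>?P') - (\<integral>x. f x \<partial>?P')\<^sup>2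
    = (\<integral>x. g2 x - (g x)\<^sup>2 \<partial>?P) + ((\<integral>x. (g x)\<^sup>2 \<partial>?P) - (\<integral>x. g x \<partial>?P)\<^sup>2)"
    using ig ig2 by (simp add: e1 e2)
  moreover have "0 \<le> (\<integral>x. g2 x - (g x)\<^sup>2 \<partial>?P)" using gle by (intro integral_nonneg_AE AE_I2) auto
  moreover have "0 \<le> (\<integral>x. (g x)\<^sup>2 \<partial>?P) - (\<integral>x. g x \<partial>?P)\<^sup>2"
    using Pi.variance_positive[of g] Pi.variance_eq[OF ig] by simp
  ultimately have eq: "ennreal ((\<integral>x. (f x)\<^sup>2 \<partial>?P') - (\<integral>x. f x \<partial>?P')\<^sup>2)
    = ennreal (\<integral>x. g2 x - (g x)\<^sup>2 \<partial>?P) + ennreal ((\<integral>x. (g x)\<^sup>2 \<partial>?P) - (\<integral>x. g x \<partial>?P)\<^sup>2)"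
    by (simp add: ennreal_plus)
  have D[measurable]: "(\<lambda>(x,y). ennreal ((max 0 (f x - f (x(j := y))))\<^sup>2)) \<in> borel_measurable (?P' \<Otimes>\<^sub>M M)"
    if "j \<in> insert i I" for j
  proof -
    have [measurable]: "(\<lambda>(x,y). f (x(j := y))) \<in> borel_measurable (?P' \<Otimes>\<^sub>M M)"
      using measurable_compose[OF updj[OF that] insert.prems(1)] by (simp only: case_prod_beta')
    show ?thesis by measurable
  qed
  have T: "(\<integral>\<^sup>+x. \<integral>\<^sup>+y. ennreal ((max 0 (f x - f (x(j := y))))\<^sup>2) \<partial>M \<partial>?P')
    = (\<integral>\<^sup>+x. \<integral>\<^sup>+z. \<integral>\<^sup>+y. ennreal ((max 0 (f (x(i := z)) - f (x(i := z, j := y))))\<^sup>2) \<partial>M \<partial>M \<partial>?P)"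
    if "j \<in> insert i I" for j
    by (rule PS.product_nn_integral_insert[OF insert.hyps borel_measurable_nn_integral[OF D[OF that]]])
  have "ennreal (\<integral>x. g2 x - (g x)\<^sup>2 \<partial>?P) = (\<integral>\<^sup>+x. ennreal (g2 x - (g x)\<^sup>2) \<partial>?P)"
    using gle ig ig2 by (subst nn_integral_eq_integral) auto
  also have "\<dots> \<le> (\<integral>\<^sup>+x. \<integral>\<^sup>+z. \<integral>\<^sup>+y. ennreal ((max 0 (f (x(i := z)) - f (x(i := y))))\<^sup>2) \<partial>M \<partial>M \<partial>?P)"
    unfolding g2_def g_def by (intro nn_integral_mono variance_le_positive_part[where C=C] fx bd)
  also have "\<dots> = (\<integral>\<^sup>+x. \<integral>\<^sup>+y. ennreal ((max 0 (f x - f (x(i := y))))\<^sup>2) \<partial>M \<partial>?P')"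
    by (subst T) auto
  finally have s1: "ennreal (\<integral>x. g2 x - (g x)\<^sup>2 \<partial>?P) \<le> (\<integral>\<^sup>+x. \<integral>\<^sup>+y. ennreal ((max 0 (f x - f (x(i := y))))\<^sup>2) \<partial>M \<partial>?P')" .
  have s2: "(\<integral>\<^sup>+x. \<integral>\<^sup>+y. ennreal ((max 0 (g x - g (x(j := y))))\<^sup>2) \<partial>M \<partial>?P)
    \<le> (\<integral>\<^sup>+x. \<integral>\<^sup>+y. ennreal ((max 0 (f x - f (x(j := y))))\<^sup>2) \<partial>M \<partial>?P')" if j: "j \<in> I" for j
  proof -
    have ij: "i \<noteq> j" using j insert.hyps by auto
    have "(\<integral>\<^sup>+y. ennreal ((max 0 (g x - g (x(j := y))))\<^sup>2) \<partial>M)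
       \<le> (\<integral>\<^sup>+z. \<integral>\<^sup>+y. ennreal ((max 0 (f (x(i := z)) - f (x(i := z, j := y))))\<^sup>2) \<partial>M \<partial>M)" if x: "x \<in> space ?P" for x
    proof -
      have u: "x(j := y) \<in> space ?P" if "y \<in> space M" for y
        using x j that by (auto simp: space_PiM PiE_iff extensional_def)
      have "(\<integral>\<^sup>+y. ennreal ((max 0 (g x - g (x(j := y))))\<^sup>2) \<partial>M)
        = (\<integral>\<^sup>+y. ennreal ((max 0 (\<integral>z. f (x(i := z)) - f (x(j := y, i := z)) \<partial>M))\<^sup>2) \<partial>M)"
        using x u by (intro nn_integral_cong) (simp add: g_def ifx)
      also have "\<dots> \<le> (\<integral>\<^sup>+y. \<integral>\<^sup>+z. ennreal ((max 0 (f (x(i := z)) - f (x(j := y, i := z))))\<^sup>2) \<partial>M \<partial>M)"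
      proof (intro nn_integral_mono square_positive_part_integral_le[where C="2*C"])
        fix y assume "y \<in> space M"
        then show "(\<lambda>z. f (x(i := z)) - f (x(j := y, i := z))) \<in> borel_measurable M"
          using fx[OF x] fx[OF u] by measurable
        show "\<bar>f (x(i := z)) - f (x(j := y, i := z))\<bar> \<le> 2*C" for z
          using bd[of "x(i:=z)"] bd[of "x(j := y, i := z)"] by linarith
      qed
      also have "\<dots> = (\<integral>\<^sup>+z. \<integral>\<^sup>+y. ennreal ((max 0 (f (x(i := z)) - f (x(j := y, i := z))))\<^sup>2) \<partial>M \<partial>M)"
      proof (rule PP.Fubini')
        have "(\<lambda>p. x(j := snd p)) \<in> M \<Otimes>\<^sub>M M \<rightarrow>\<^sub>M ?P"
          using measurable_compose[OF _ measurable_compose[OF measurable_Pair1'[OF x] updj[OF j]], of snd "M \<Otimes>\<^sub>M M"]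
          by simp
        then have "(\<lambda>p. (x(j := snd p), fst p)) \<in> M \<Otimes>\<^sub>M M \<rightarrow>\<^sub>M ?P \<Otimes>\<^sub>M M" by measurable
        from measurable_compose[OF this f1]
        have [measurable]: "(\<lambda>p. f (x(j := snd p, i := fst p))) \<in> borel_measurable (M \<Otimes>\<^sub>M M)"
          by simp
        have [measurable]: "(\<lambda>p. f (x(i := fst p))) \<in> borel_measurable (M \<Otimes>\<^sub>M M)"
          using measurable_compose[OF measurable_fst fx[OF x], of M] by simp
        show "(\<lambda>(z, y). ennreal ((max 0 (f (x(i := z)) - f (x(j := y, i := z))))\<^sup>2)) \<in> borel_measurable (M \<Otimes>\<^sub>M M)"
          unfolding case_prod_beta' by measurable
      qed
      finally show ?thesis using ij by (simp add: fun_upd_twist)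
    qed
    then show ?thesis unfolding T[OF insertI2[OF j]] by (rule nn_integral_mono)
  qed
  show ?case
    unfolding eq sum.insert[OF insert.hyps]
    by (intro add_mono s1 order_trans[OF insert.IH[OF gm gbd]] sum_mono s2)
qed

text \<open>Limit of the bounded case along the clamped functions \<open>t N\<close>. Clamping is
  monotone and 1-Lipschitz, so every positive-part difference shrinks and the right side is already
  an upper bound for each \<open>N\<close>.\<close>

lemma (in prob_space) efron_stein:
  fixes f :: "('i \<Rightarrow> 'a) \<Rightarrow> real"
  assumes I: "finite I" and fm[measurable]: "f \<in> borel_measurable (PiM I (\<lambda>_. M))"
    and f2: "integrable (PiM I (\<lambda>_. M)) (\<lambda>x. (f x)\<^sup>2)"
  shows "ennreal ((\<integral>x. (f x)\<^sup>2 \<partial>PiM I (\<lambda>_. M)) - (\<integral>x. f x \<partial>PiM I (\<lambda>_. M))\<^sup>2)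
    \<le> (\<Sum>i\<in>I. \<integral>\<^sup>+x. \<integral>\<^sup>+y. ennreal ((max 0 (f x - f (x(i := y))))\<^sup>2) \<partial>M \<partial>PiM I (\<lambda>_. M))"
proof -
  let ?P = "PiM I (\<lambda>_. M)"
  interpret Pi: prob_space ?P by (intro prob_space_PiM) unfold_locales
  define t where "t N x = max (- real N) (min (real N) (f x))" for N x
  have [measurable]: "t N \<in> borel_measurable ?P" for N unfolding t_def by measurable
  have lim: "(\<lambda>N. t N x) \<longlonglongrightarrow> f x" for x
  proof (rule tendsto_eventually)
    obtain N0 where "\<bar>f x\<bar> \<le> real N0" using real_arch_simple by blast
    then show "\<forall>\<^sub>F N in sequentially. t N x = f x"
      by (intro eventually_mono[OF eventually_ge_at_top[of N0]]) (auto simp: t_def)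
  qed
  have tf: "\<bar>t N x\<bar> \<le> \<bar>f x\<bar>" for N x by (auto simp: t_def)
  have if1: "integrable ?P f" using Pi.square_integrable_imp_integrable[OF fm f2] .
  have l2: "(\<lambda>N. \<integral>x. (t N x)\<^sup>2 \<partial>?P) \<longlonglongrightarrow> (\<integral>x. (f x)\<^sup>2 \<partial>?P)"
    by (rule integral_dominated_convergence[OF _ _ f2])
      (use tf lim in \<open>auto intro!: AE_I2 tendsto_intros simp: abs_le_square_iff[symmetric]\<close>)
  have l1: "(\<lambda>N. \<integral>x. t N x \<partial>?P) \<longlonglongrightarrow> (\<integral>x. f x \<partial>?P)"
    by (rule integral_dominated_convergence[OF _ _ integrable_abs[OF if1]]) (use tf lim in auto)
  have "(\<lambda>N. ennreal ((\<integral>x. (t N x)\<^sup>2 \<partial>?P) - (\<integral>x. t N x \<partial>?P)\<^sup>2))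
    \<longlonglongrightarrow> ennreal ((\<integral>x. (f x)\<^sup>2 \<partial>?P) - (\<integral>x. f x \<partial>?P)\<^sup>2)"
    by (intro tendsto_ennrealI tendsto_diff tendsto_power l1 l2)
  then show ?thesis
  proof (rule LIMSEQ_le_const2, intro exI[of _ 0] allI impI)
    fix N
    have "ennreal ((\<integral>x. (t N x)\<^sup>2 \<partial>?P) - (\<integral>x. t N x \<partial>?P)\<^sup>2)
      \<le> (\<Sum>i\<in>I. \<integral>\<^sup>+x. \<integral>\<^sup>+y. ennreal ((max 0 (t N x - t N (x(i := y))))\<^sup>2) \<partial>M \<partial>?P)"
      by (rule efron_stein_bounded[OF I, where C="real N"]) (auto simp: t_def)
    also have "\<dots> \<le> (\<Sum>i\<in>I. \<integral>\<^sup>+x. \<integral>\<^sup>+y. ennreal ((max 0 (f x - f (x(i := y))))\<^sup>2) \<partial>M \<partial>?P)"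
      by (intro sum_mono nn_integral_mono ennreal_leI power_mono) (auto simp: t_def)
    finally show "ennreal ((\<integral>x. (t N x)\<^sup>2 \<partial>?P) - (\<integral>x. t N x \<partial>?P)\<^sup>2)
      \<le> (\<Sum>i\<in>I. \<integral>\<^sup>+x. \<integral>\<^sup>+y. ennreal ((max 0 (f x - f (x(i := y))))\<^sup>2) \<partial>M \<partial>?P)" .
  qed
qed

section \<open>Averages over an independent sample\<close>

lemma (in prob_space) distr_PiM_const_component:
  assumes "i \<in> I"
  shows "distr (PiM I (\<lambda>_. M)) M (\<lambda>x. x i) = M"
proof -
  interpret product_prob_space "\<lambda>_. M" I by unfold_locales
  show ?thesis using PiM_component[OF assms] .
qed

lemma (in prob_space)
  fixes h :: "'a \<Rightarrow> real"
  assumes "i \<in> I" and h: "integrable M h"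
  shows integrable_PiM_component: "integrable (PiM I (\<lambda>_. M)) (\<lambda>x. h (x i))"
    and integral_PiM_component: "(\<integral>x. h (x i) \<partial>PiM I (\<lambda>_. M)) = (\<integral>x. h x \<partial>M)"
proof -
  have m: "(\<lambda>x. x i) \<in> PiM I (\<lambda>_. M) \<rightarrow>\<^sub>M M" using assms(1) by simp
  show "integrable (PiM I (\<lambda>_. M)) (\<lambda>x. h (x i))"
    using integrable_distr[OF m, of h] h by (simp add: distr_PiM_const_component[OF assms(1)])
  show "(\<integral>x. h (x i) \<partial>PiM I (\<lambda>_. M)) = (\<integral>x. h x \<partial>M)"
    using integral_distr[OF m borel_measurable_integrable[OF h]]
    by (simp add: distr_PiM_const_component[OF assms(1)])
qed

lemma (in prob_space) AE_PiM_component: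
  assumes "i \<in> I" "AE x in M. Q x"
  shows "AE x in PiM I (\<lambda>_. M). Q (x i)"
proof (rule AE_distrD[of _ _ M])
  show "(\<lambda>x. x i) \<in> PiM I (\<lambda>_. M) \<rightarrow>\<^sub>M M" using assms(1) by simp
  show "AE x in distr (PiM I (\<lambda>_. M)) M (\<lambda>x. x i). Q x"
    by (subst distr_PiM_const_component[OF assms(1)]) (rule assms(2))
qed

text \<open>Chebyshev's inequality, with the variance of the average estimated by Efron-Stein. The
  factor 4 comes from \<open>(u - v)\<^sup>2 \<le> 2 * (u\<^sup>2 + v\<^sup>2)\<close> applied to
  the resampled difference.\<close>

lemma (in prob_space) prob_sample_mean_deviation:
  fixes h :: "'a \<Rightarrow> real" and g :: real
  assumes I: "finite I" "I \<noteq> {}" and hm[measurable]: "h \<in> borel_measurable M"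
    and h2: "integrable M (\<lambda>x. (h x)\<^sup>2)" and g: "0 < g"
  shows "measure (PiM I (\<lambda>_. M)) {x \<in> space (PiM I (\<lambda>_. M)). g \<le> \<bar>(\<Sum>i\<in>I. h (x i)) / real (card I) - (\<integral>x. h x \<partial>M)\<bar>}
    \<le> 4 * (\<integral>x. (h x)\<^sup>2 \<partial>M) / (real (card I) * g\<^sup>2)"
proof -
  let ?P = "PiM I (\<lambda>_. M)" let ?n = "real (card I)"
  interpret Pi: prob_space ?P by (intro prob_space_PiM) unfold_locales
  have n: "?n > 0" using I by (simp add: card_gt_0_iff)
  define f where "f x = (\<Sum>i\<in>I. h (x i)) / ?n" for x
  have [measurable]: "(\<lambda>x. h (x i)) \<in> borel_measurable ?P" if "i \<in> I" for i using that by measurable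
  have [measurable]: "f \<in> borel_measurable ?P" unfolding f_def by measurable
  have h1: "integrable M h" using square_integrable_imp_integrable[OF hm h2] .
  have mean: "(\<integral>x. f x \<partial>?P) = (\<integral>x. h x \<partial>M)"
    using n by (simp add: f_def integral_PiM_component[OF _ h1] integrable_PiM_component[OF _ h1])
  have "(f x)\<^sup>2 \<le> (\<Sum>i\<in>I. (h (x i))\<^sup>2) / ?n" for x
  proof -
    have "(\<Sum>i\<in>I. h (x i) * 1)\<^sup>2 \<le> (\<Sum>i\<in>I. (h (x i))\<^sup>2) * (\<Sum>i\<in>I. 1\<^sup>2)"
      by (rule Cauchy_Schwarz_ineq_sum)
    then show ?thesis using n by (simp add: f_def power_divide divide_simps power2_eq_square algebra_simps)
  qed
  note f2 = this
  have if2: "integrable ?P (\<lambda>x. (f x)\<^sup>2)"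
  proof (rule Bochner_Integration.integrable_bound)
    show "integrable ?P (\<lambda>x. (\<Sum>i\<in>I. (h (x i))\<^sup>2) / ?n)"
      by (intro integrable_divide Bochner_Integration.integrable_sum integrable_PiM_component[OF _ h2])
    show "AE x in ?P. norm ((f x)\<^sup>2) \<le> norm ((\<Sum>i\<in>I. (h (x i))\<^sup>2) / ?n)"
    proof (intro AE_I2)
      fix x show "norm ((f x)\<^sup>2) \<le> norm ((\<Sum>i\<in>I. (h (x i))\<^sup>2) / ?n)"
        using f2[of x] abs_ge_self[of "(\<Sum>i\<in>I. (h (x i))\<^sup>2) / ?n"] by (simp del: abs_divide)
    qed
  qed simp
  have if1: "integrable ?P f" using Pi.square_integrable_imp_integrable[OF _ if2] by simp
  have "ennreal ((\<integral>x. (f x)\<^sup>2 \<partial>?P) - (\<integral>x. f x \<partial>?P)\<^sup>2)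
    \<le> (\<Sum>i\<in>I. \<integral>\<^sup>+x. \<integral>\<^sup>+y. ennreal ((max 0 (f x - f (x(i := y))))\<^sup>2) \<partial>M \<partial>?P)"
    by (rule efron_stein[OF I(1) _ if2]) measurable
  also have "\<dots> \<le> (\<Sum>i\<in>I. ennreal (4 * (\<integral>x. (h x)\<^sup>2 \<partial>M) / ?n\<^sup>2))"
  proof (rule sum_mono)
    fix i assume i: "i \<in> I"
    have "(max 0 (f x - f (x(i := y))))\<^sup>2 \<le> 2 / ?n\<^sup>2 * ((h (x i))\<^sup>2 + (h y)\<^sup>2)" for x y
    proof -
      have "f x - f (x(i := y)) = (h (x i) - h y) / ?n"
        unfolding f_def sum.remove[OF I(1) i] by (simp add: diff_divide_distrib[symmetric])
      then have "(max 0 (f x - f (x(i := y))))\<^sup>2 \<le> ((h (x i) - h y) / ?n)\<^sup>2"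
        by (auto simp: max_def)
      also have "\<dots> \<le> 2 / ?n\<^sup>2 * ((h (x i))\<^sup>2 + (h y)\<^sup>2)"
        using n zero_le_power2[of "h (x i) + h y"]
        by (simp add: power_divide divide_simps power2_diff power2_sum)
      finally show ?thesis .
    qed
    then have "(\<integral>\<^sup>+x. \<integral>\<^sup>+y. ennreal ((max 0 (f x - f (x(i := y))))\<^sup>2) \<partial>M \<partial>?P)
      \<le> (\<integral>\<^sup>+x. \<integral>\<^sup>+y. ennreal (2 / ?n\<^sup>2 * ((h (x i))\<^sup>2 + (h y)\<^sup>2)) \<partial>M \<partial>?P)"
      by (intro nn_integral_mono ennreal_leI)
    also have "\<dots> = (\<integral>\<^sup>+x. ennreal (2 / ?n\<^sup>2 * ((h (x i))\<^sup>2 + (\<integral>y. (h y)\<^sup>2 \<partial>M))) \<partial>?P)"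
      using h2 by (intro nn_integral_cong, subst nn_integral_eq_integral) (auto simp: prob_space)
    also have "\<dots> = ennreal (4 * (\<integral>x. (h x)\<^sup>2 \<partial>M) / ?n\<^sup>2)"
      using h2 integrable_PiM_component[OF i h2] integral_PiM_component[OF i h2]
      by (subst nn_integral_eq_integral) (auto simp: Pi.prob_space)
    finally show "(\<integral>\<^sup>+x. \<integral>\<^sup>+y. ennreal ((max 0 (f x - f (x(i := y))))\<^sup>2) \<partial>M \<partial>?P) \<le> \<dots>" .
  qed
  also have "\<dots> = ennreal (4 * (\<integral>x. (h x)\<^sup>2 \<partial>M) / ?n)"
    using n by (simp add: ennreal_of_nat_eq_real_of_nat ennreal_mult[symmetric] power2_eq_square)
  finally have v: "(\<integral>x. (f x)\<^sup>2 \<partial>?P) - (\<integral>x. f x \<partial>?P)\<^sup>2 \<le> 4 * (\<integral>x. (h x)\<^sup>2 \<partial>M) / ?n"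
    using n by (subst (asm) ennreal_le_iff) auto
  have "measure ?P {x \<in> space ?P. g \<le> \<bar>f x - (\<integral>x. f x \<partial>?P)\<bar>} \<le> Pi.variance f / g\<^sup>2"
    by (rule Pi.Chebyshev_inequality) (use if2 g in auto)
  also have "\<dots> \<le> (4 * (\<integral>x. (h x)\<^sup>2 \<partial>M) / ?n) / g\<^sup>2"
    using v g by (intro divide_right_mono) (auto simp: Pi.variance_eq[OF if1 if2])
  finally show ?thesis by (simp only: mean) (simp add: f_def)
qed

lemma (in prob_space) weak_law_of_large_numbers:
  fixes h :: "'a \<Rightarrow> real" and g :: real
  assumes "h \<in> borel_measurable M" "integrable M (\<lambda>x. (h x)\<^sup>2)" "0 < g"
  shows "(\<lambda>n::nat. measure (PiM {1..n} (\<lambda>_. M)) {x \<in> space (PiM {1..n} (\<lambda>_. M)).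
      g \<le> \<bar>(\<Sum>i\<in>{1..n}. h (x i)) / real n - (\<integral>x. h x \<partial>M)\<bar>}) \<longlonglongrightarrow> 0"
proof (rule tendsto_sandwich[of "\<lambda>_. 0" _ _ "\<lambda>n. (4 * (\<integral>x. (h x)\<^sup>2 \<partial>M) / g\<^sup>2) / real n"])
  show "\<forall>\<^sub>F n in sequentially. measure (PiM {1..n} (\<lambda>_. M)) {x \<in> space (PiM {1..n} (\<lambda>_. M)).
      g \<le> \<bar>(\<Sum>i\<in>{1..n}. h (x i)) / real n - (\<integral>x. h x \<partial>M)\<bar>} \<le> (4 * (\<integral>x. (h x)\<^sup>2 \<partial>M) / g\<^sup>2) / real n"
    using eventually_ge_at_top[of 1]
  proof eventually_elim
    case (elim n)
    then show ?case
      using prob_sample_mean_deviation[where I="{1..n}" and h=h and g=g] assms by (simp add: mult.commute)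
  qed
  show "(\<lambda>n. (4 * (\<integral>x. (h x)\<^sup>2 \<partial>M) / g\<^sup>2) / real n) \<longlonglongrightarrow> 0" by (rule lim_const_over_n)
qed auto

section \<open>Splittings of the target measure\<close>

text \<open>Position \<open>j\<close> owns the conditional law of the target given the
  \<open>j\<close>-th sample point. Indexing by positions instead of points makes ties in the sample
  harmless, and testing with nonnegative functions expresses that the \<open>\<nu> j\<close> add up
  to \<open>n\<close> times \<open>Q\<close>.\<close>

definition plan :: "nat \<Rightarrow> 'a::euclidean_space measure \<Rightarrow> (nat \<Rightarrow> 'a measure) \<Rightarrow> bool" where
  "plan n Q \<nu> \<longleftrightarrow> (\<forall>j\<in>{1..n}. prob_space (\<nu> j) \<and> sets (\<nu> j) = sets borel) \<and>
     (\<forall>h \<in> borel_measurable borel. (\<Sum>j=1..n. \<integral>\<^sup>+y. h y \<partial>\<nu> j) = of_nat n * (\<integral>\<^sup>+y. h y \<partial>Q))"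

definition barycenter :: "(nat \<Rightarrow> 'a::euclidean_space measure) \<Rightarrow> nat \<Rightarrow> 'a" where
  "barycenter \<nu> j = (\<integral>y. y \<partial>\<nu> j)"

definition correlation :: "nat \<Rightarrow> (nat \<Rightarrow> 'a::euclidean_space) \<Rightarrow> (nat \<Rightarrow> 'a measure) \<Rightarrow> real" where
  "correlation n x \<nu> = (\<Sum>j=1..n. x j \<bullet> barycenter \<nu> j)"

definition max_correlation :: "nat \<Rightarrow> 'a::euclidean_space measure \<Rightarrow> (nat \<Rightarrow> 'a) \<Rightarrow> real" where
  "max_correlation n Q x = (SUP \<nu>\<in>Collect (plan n Q). correlation n x \<nu>)"

lemma planD:
  assumes "plan n Q \<nu>" "j \<in> {1..n}"
  shows "prob_space (\<nu> j)" "sets (\<nu> j) = sets borel" "space (\<nu> j) = UNIV"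
  using assms sets_eq_imp_space_eq[of "\<nu> j" borel] by (auto simp: plan_def)

lemma plan_nn_integral:
  "plan n Q \<nu> \<Longrightarrow> h \<in> borel_measurable borel \<Longrightarrow>
    (\<Sum>j=1..n. \<integral>\<^sup>+y. h y \<partial>\<nu> j) = of_nat n * (\<integral>\<^sup>+y. h y \<partial>Q)"
  by (auto simp: plan_def)

lemma plan_nn_integral_le:
  assumes "plan n Q \<nu>" "j \<in> {1..n}" "h \<in> borel_measurable borel"
  shows "(\<integral>\<^sup>+y. h y \<partial>\<nu> j) \<le> of_nat n * (\<integral>\<^sup>+y. h y \<partial>Q)"
  unfolding plan_nn_integral[OF assms(1,3), symmetric]
  by (rule member_le_sum[OF assms(2)]) auto

lemma plan_integrable:
  fixes f :: "'a::euclidean_space \<Rightarrow> 'b::{banach, second_countable_topology}"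
  assumes \<nu>: "plan n Q \<nu>" and j: "j \<in> {1..n}" and Q: "sets Q = sets borel" and f: "integrable Q f"
  shows "integrable (\<nu> j) f"
proof -
  have [measurable]: "f \<in> borel_measurable borel"
    using borel_measurable_integrable[OF f] Q by (simp cong: measurable_cong_sets)
  have "(\<integral>\<^sup>+y. ennreal (norm (f y)) \<partial>\<nu> j) \<le> of_nat n * (\<integral>\<^sup>+y. ennreal (norm (f y)) \<partial>Q)"
    by (rule plan_nn_integral_le[OF \<nu> j]) measurable
  also have "\<dots> < \<infinity>"
    using f by (auto simp: integrable_iff_bounded ennreal_mult_less_top of_nat_less_top)
  finally show ?thesis
    using planD(2)[OF \<nu> j] by (auto simp: integrable_iff_bounded cong: measurable_cong_sets)
qed

lemma plan_sum_integral:
  fixes f :: "'a::euclidean_space \<Rightarrow> real"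
  assumes \<nu>: "plan n Q \<nu>" and Q: "sets Q = sets borel" and f: "integrable Q f"
  shows "(\<Sum>j=1..n. \<integral>y. f y \<partial>\<nu> j) = n * (\<integral>y. f y \<partial>Q)"
proof -
  have [measurable]: "f \<in> borel_measurable borel"
    using borel_measurable_integrable[OF f] Q by (simp cong: measurable_cong_sets)
  have fin: "(\<integral>\<^sup>+y. ennreal (s * f y) \<partial>\<nu> j) < top" if "j \<in> {1..n}" "s = 1 \<or> s = -1" for j s
  proof -
    have "(\<integral>\<^sup>+y. ennreal (s * f y) \<partial>\<nu> j) \<le> (\<integral>\<^sup>+y. ennreal (norm (f y)) \<partial>\<nu> j)"
      using that(2) by (intro nn_integral_mono ennreal_leI) auto
    then show ?thesis using plan_integrable[OF \<nu> that(1) Q f] by (auto simp: integrable_iff_bounded)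
  qed
  have s: "(\<Sum>j=1..n. enn2real (\<integral>\<^sup>+y. ennreal (s * f y) \<partial>\<nu> j)) = n * enn2real (\<integral>\<^sup>+y. ennreal (s * f y) \<partial>Q)"
    if "s = 1 \<or> s = -1" for s
  proof -
    have "(\<Sum>j=1..n. enn2real (\<integral>\<^sup>+y. ennreal (s * f y) \<partial>\<nu> j)) = enn2real (\<Sum>j=1..n. (\<integral>\<^sup>+y. ennreal (s * f y) \<partial>\<nu> j))"
      using fin that by (subst enn2real_sum) (auto simp: comp_def)
    also have "\<dots> = n * enn2real (\<integral>\<^sup>+y. ennreal (s * f y) \<partial>Q)"
      by (subst plan_nn_integral[OF \<nu>]) (auto simp: enn2real_mult ennreal_of_nat_eq_real_of_nat)
    finally show ?thesis .
  qed
  have "(\<Sum>j=1..n. \<integral>y. f y \<partial>\<nu> j)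
    = (\<Sum>j=1..n. enn2real (\<integral>\<^sup>+y. ennreal (1 * f y) \<partial>\<nu> j) - enn2real (\<integral>\<^sup>+y. ennreal (-1 * f y) \<partial>\<nu> j))"
    by (intro sum.cong refl) (simp add: real_lebesgue_integral_def[OF plan_integrable[OF \<nu> _ Q f]])
  also have "\<dots> = n * (\<integral>y. f y \<partial>Q)"
    unfolding sum_subtractf s[of 1, simplified] s[of "-1", simplified]
    by (simp add: real_lebesgue_integral_def[OF f] s[of 1, simplified] s[of "-1", simplified] algebra_simps)
  finally show ?thesis .
qed

lemma plan_AE:
  assumes \<nu>: "plan n Q \<nu>" and j: "j \<in> {1..n}" and Q: "sets Q = sets borel" and R: "AE y in Q. R y"
  shows "AE y in \<nu> j. R y"
proof -
  from R obtain N where N: "{y \<in> space Q. \<not> R y} \<subseteq> N" "emeasure Q N = 0" "N \<in> sets Q"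
    by (auto elim: AE_E)
  have [measurable]: "N \<in> sets borel" using N Q by simp
  have "emeasure (\<nu> j) N = (\<integral>\<^sup>+y. indicator N y \<partial>\<nu> j)" using planD(2)[OF \<nu> j] by simp
  also have "\<dots> \<le> of_nat n * (\<integral>\<^sup>+y. indicator N y \<partial>Q)"
    by (rule plan_nn_integral_le[OF \<nu> j]) measurable
  also have "\<dots> = 0" using N by simp
  finally show ?thesis
    using N planD(2,3)[OF \<nu> j] sets_eq_imp_space_eq[OF Q] Q
    by (intro AE_I[of _ _ N]) auto
qed

lemma plan_const:
  assumes "prob_space Q" "sets Q = sets borel"
  shows "plan n Q (\<lambda>_. Q)"
  using assms by (auto simp: plan_def)

lemma plan_transpose:
  assumes \<nu>: "plan n Q \<nu>" and "i \<in> {1..n}" "j \<in> {1..n}"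
  shows "plan n Q (\<lambda>l. \<nu> (Transposition.transpose i j l))"
proof -
  have p: "Transposition.transpose i j permutes {1..n}" using assms(2,3) by (rule permutes_swap_id)
  have "(\<Sum>l=1..n. \<integral>\<^sup>+y. h y \<partial>\<nu> (Transposition.transpose i j l)) = (\<Sum>l=1..n. \<integral>\<^sup>+y. h y \<partial>\<nu> l)" for h
    using sum.permute[OF p, of "\<lambda>l. \<integral>\<^sup>+y. h y \<partial>\<nu> l"] by (simp add: comp_def)
  then show ?thesis using \<nu> permutes_in_image[OF p] by (auto simp: plan_def)
qed

lemma plan_sum_barycenter_le:
  assumes \<nu>: "plan n Q \<nu>" and Q: "sets Q = sets borel" and i: "integrable Q (\<lambda>y. norm y)"
  shows "(\<Sum>j=1..n. norm (barycenter \<nu> j)) \<le> n * (\<integral>y. norm y \<partial>Q)"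
proof -
  have "(\<Sum>j=1..n. norm (barycenter \<nu> j)) \<le> (\<Sum>j=1..n. \<integral>y. norm y \<partial>\<nu> j)"
    unfolding barycenter_def by (intro sum_mono integral_norm_bound)
  then show ?thesis using plan_sum_integral[OF \<nu> Q i] by simp
qed

lemma correlation_le:
  assumes \<nu>: "plan n Q \<nu>" and Q: "sets Q = sets borel" and i: "integrable Q (\<lambda>y. norm y)"
  shows "\<bar>correlation n x \<nu>\<bar> \<le> (\<Sum>j=1..n. norm (x j)) * (n * (\<integral>y. norm y \<partial>Q))"
proof -
  have "\<bar>correlation n x \<nu>\<bar> \<le> (\<Sum>j=1..n. norm (x j) * norm (barycenter \<nu> j))"
    unfolding correlation_def by (rule order_trans[OF sum_abs]) (intro sum_mono Cauchy_Schwarz_ineq2)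
  also have "\<dots> \<le> (\<Sum>j=1..n. norm (x j) * (n * (\<integral>y. norm y \<partial>Q)))"
    using plan_sum_barycenter_le[OF assms]
    by (intro sum_mono mult_left_mono order_trans[OF member_le_sum[where f="\<lambda>j. norm (barycenter \<nu> j)"]]) auto
  finally show ?thesis by (simp add: sum_distrib_right)
qed

lemma bdd_above_correlation:
  assumes "sets Q = sets borel" "integrable Q (\<lambda>y. norm y)"
  shows "bdd_above (correlation n x ` Collect (plan n Q))"
  using correlation_le[OF _ assms] by (intro bdd_aboveI2) (auto dest: abs_le_D1)

lemma correlation_le_max:
  assumes "sets Q = sets borel" "integrable Q (\<lambda>y. norm y)" "plan n Q \<nu>"
  shows "correlation n x \<nu> \<le> max_correlation n Q x"
  unfolding max_correlation_def using assms by (intro cSUP_upper bdd_above_correlation) auto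

lemma max_correlation_approx:
  assumes "prob_space Q" "sets Q = sets borel" "integrable Q (\<lambda>y. norm y)" "0 < e"
  obtains \<nu> where "plan n Q \<nu>" "max_correlation n Q x - e < correlation n x \<nu>"
proof -
  have "\<exists>\<nu>\<in>Collect (plan n Q). max_correlation n Q x - e < correlation n x \<nu>"
    using assms plan_const[OF assms(1,2)]
    by (subst less_cSUP_iff[symmetric]) (auto simp: max_correlation_def[symmetric] intro!: bdd_above_correlation)
  then show ?thesis using that by auto
qed

lemma abs_max_correlation_le:
  assumes "prob_space Q" "sets Q = sets borel" "integrable Q (\<lambda>y. norm y)"
  shows "\<bar>max_correlation n Q x\<bar> \<le> (\<Sum>j=1..n. norm (x j)) * (n * (\<integral>y. norm y \<partial>Q))"
  unfolding max_correlation_def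
proof (rule cSup_abs_le)
  show "correlation n x ` Collect (plan n Q) \<noteq> {}" using plan_const[OF assms(1,2), of n] by blast
qed (use correlation_le[OF _ assms(2,3)] in auto)

text \<open>The supremum is over uncountably many splittings, but each correlation is continuous in
  the product topology, so every strict superlevel set is open.\<close>

lemma borel_measurable_max_correlation:
  fixes Q :: "'a::euclidean_space measure"
  assumes "prob_space Q" "sets Q = sets borel" "integrable Q (\<lambda>y. norm y)"
  shows "max_correlation n Q \<in> borel_measurable (PiM {1..n} (\<lambda>_. borel))"
proof -
  define F where "F x = max_correlation n Q x" for x :: "nat \<Rightarrow> 'a"
  have "{x. a < F x} = (\<Union>\<nu>\<in>Collect (plan n Q). {x. a < correlation n x \<nu>})" for a
  proof -
    have "Collect (plan n Q) \<noteq> {}" using plan_const[OF assms(1,2), of n] by blast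
    from less_cSUP_iff[OF this bdd_above_correlation[OF assms(2,3)]] show ?thesis
      unfolding F_def max_correlation_def by auto
  qed
  moreover have "open {x. a < correlation n x \<nu>}" for a and \<nu> :: "nat \<Rightarrow> 'a measure"
    unfolding correlation_def by (intro open_Collect_less continuous_intros continuous_on_product_coordinates)
  ultimately have "open {x. a < F x}" for a by auto
  then have F: "F \<in> borel_measurable borel"
    by (intro borel_measurable_iff_greater[THEN iffD2]) auto
  \<comment> \<open>Openness was shown in the space of all sequences; extension by 0 outside
    \<open>{1..n}\<close> carries measurability to the finite product and changes no
    correlation.\<close>
  have "(\<lambda>x j. if j \<in> {1..n} then x j else 0) \<in> borel_measurable (PiM {1..n} (\<lambda>_. borel :: 'a measure))"
  proof (rule measurable_coordinatewise_then_product)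
    fix i :: nat show "(\<lambda>x. if i \<in> {1..n} then x i else 0) \<in> borel_measurable (PiM {1..n} (\<lambda>_. borel :: 'a measure))"
      by (cases "i \<in> {1..n}") (simp_all only: if_True if_False, measurable)
  qed
  from measurable_compose[OF this F]
  have "(\<lambda>x. F (\<lambda>j. if j \<in> {1..n} then x j else 0)) \<in> borel_measurable (PiM {1..n} (\<lambda>_. borel))" .
  moreover have "F (\<lambda>j. if j \<in> {1..n} then x j else 0) = max_correlation n Q x" for x
  proof -
    have "correlation n (\<lambda>j. if j \<in> {1..n} then x j else 0) \<nu> = correlation n x \<nu>" for \<nu> :: "nat \<Rightarrow> 'a measure"
      unfolding correlation_def by (intro sum.cong) auto
    then show ?thesis by (simp only: F_def max_correlation_def)
  qed
  ultimately show ?thesis by simp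
qed

text \<open>A discrete line integral: the mass with barycenter \<open>c\<close> goes from
  \<open>p\<close> to \<open>x j\<close>, the mass found there goes on to the next point of the
  list, and the last one ends at \<open>z\<close>. The value is the total change of the
  correlation.\<close>

fun walk :: "(nat \<Rightarrow> 'a::euclidean_space) \<Rightarrow> (nat \<Rightarrow> 'a) \<Rightarrow> 'a \<Rightarrow> 'a \<Rightarrow> nat list \<Rightarrow> 'a \<Rightarrow> real" where
  "walk x b c p [] z = c \<bullet> (z - p)"
| "walk x b c p (j # js) z = c \<bullet> (x j - p) + walk x b (b j) (x j) js z"

lemma walk_cong:
  "(\<And>j. j \<in> set js \<Longrightarrow> b j = b' j) \<Longrightarrow> walk x b c p js z = walk x b' c p js z"
  by (induction js arbitrary: c p) auto

text \<open>Each mass travels one step along the chain: the plan is rotated by a product of transpositions.\<close>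

lemma plan_rotate:
  assumes "plan n Q \<nu>" "i \<in> {1..n}" "set js \<subseteq> {1..n}" "distinct js" "i \<notin> set js"
  shows "\<exists>\<nu>'. plan n Q \<nu>' \<and> correlation n (x(i := z)) \<nu>'
    = correlation n (x(i := p)) \<nu> + walk x (barycenter \<nu>) (barycenter \<nu> i) p js z"
  using assms
proof (induction js arbitrary: \<nu> p)
  have upd: "correlation n (x(i := z)) \<nu> = correlation n (x(i := p)) \<nu> + barycenter \<nu> i \<bullet> (z - p)"
    for \<nu> :: "nat \<Rightarrow> 'a measure" and z p
    using assms(2) unfolding correlation_def
    by (simp add: sum.remove[of _ i] inner_diff_right inner_commute[of "barycenter \<nu> i"])
  {
    case Nil
    then show ?case using upd[of z \<nu> p] unfolding walk.simps by blast
  next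
    case (Cons j js)
    define \<nu>1 where "\<nu>1 l = \<nu> (Transposition.transpose i j l)" for l
    have ij: "i \<in> {1..n}" "j \<in> {1..n}" "i \<noteq> j" using Cons.prems by auto
    have p1: "plan n Q \<nu>1" unfolding \<nu>1_def using plan_transpose[OF Cons.prems(1) ij(1,2)] .
    have b1: "barycenter \<nu>1 l = barycenter \<nu> (Transposition.transpose i j l)" for l
      by (simp add: barycenter_def \<nu>1_def)
    have perm: "Transposition.transpose i j permutes {1..n}" using ij by (intro permutes_swap_id) auto
    \<comment> \<open>In \<open>x(i := x j)\<close> positions \<open>i\<close> and \<open>j\<close>
      hold the same point, so exchanging their masses leaves the correlation unchanged.\<close>
    have "correlation n (x(i := x j)) \<nu>1
      = (\<Sum>l=1..n. (x(i := x j)) (Transposition.transpose i j l) \<bullet> barycenter \<nu> (Transposition.transpose i j l))"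
      unfolding correlation_def b1 using ij
      by (intro sum.cong refl) (auto simp: Transposition.transpose_def)
    also have "\<dots> = correlation n (x(i := x j)) \<nu>"
      unfolding correlation_def using sum.permute[OF perm, of "\<lambda>l. (x(i := x j)) l \<bullet> barycenter \<nu> l"]
      by (simp add: comp_def)
    finally have c1: "correlation n (x(i := x j)) \<nu>1 = correlation n (x(i := x j)) \<nu>" .
    obtain \<nu>' where \<nu>': "plan n Q \<nu>'" "correlation n (x(i := z)) \<nu>'
      = correlation n (x(i := x j)) \<nu>1 + walk x (barycenter \<nu>1) (barycenter \<nu>1 i) (x j) js z"
      using Cons.IH[OF p1, of "x j"] Cons.prems(2-5) unfolding set_simps distinct.simps by blast
    have "walk x (barycenter \<nu>1) (barycenter \<nu>1 i) (x j) js z = walk x (barycenter \<nu>) (barycenter \<nu> j) (x j) js z"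
      using Cons.prems by (subst walk_cong[of _ _ "barycenter \<nu>"]) (auto simp: b1 Transposition.transpose_def)
    then have "correlation n (x(i := z)) \<nu>'
      = correlation n (x(i := p)) \<nu> + walk x (barycenter \<nu>) (barycenter \<nu> i) p (j # js) z"
      unfolding walk.simps using \<nu>'(2) upd[of "x j" \<nu> p] c1 by linarith
    then show ?case using \<nu>'(1) by blast
  }
qed

text \<open>The elementary bound \<open>norm y \<le> a + a powr (1 - q) * norm y powr q\<close> is
  integrated, and \<open>a\<close> is balanced against the \<open>q\<close>-th moment; the two equal
  terms produce the factor \<open>2 powr q\<close>.\<close>

lemma barycenter_powr_le:
  fixes \<nu> :: "nat \<Rightarrow> 'a::euclidean_space measure"
  assumes "prob_space (\<nu> j)" "sets (\<nu> j) = sets borel" and i1: "integrable (\<nu> j) (\<lambda>y. norm y)"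
    and iq: "integrable (\<nu> j) (\<lambda>y. norm y powr q)" and q: "1 \<le> q"
  shows "norm (barycenter \<nu> j) powr q \<le> 2 powr q * (\<integral>y. norm y powr q \<partial>\<nu> j)"
proof -
  interpret prob_space "\<nu> j" by fact
  let ?m = "\<integral>y. norm y \<partial>\<nu> j" and ?M = "\<integral>y. norm y powr q \<partial>\<nu> j"
  have m0: "0 \<le> ?m" and M0: "0 \<le> ?M" by (auto intro!: integral_nonneg_AE)
  have le: "?m \<le> a + a powr (1 - q) * ?M" if a: "0 < a" for a
  proof -
    have "norm y \<le> a + a powr (1 - q) * norm y powr q" for y :: 'a
    proof (cases "norm y \<le> a")
      case False
      then have y: "a < norm y" by simp
      have "norm y = norm y powr (1 - q) * norm y powr q" using y a by (simp add: powr_add[symmetric])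
      also have "\<dots> \<le> a powr (1 - q) * norm y powr q"
        using y a q by (intro mult_right_mono powr_mono2') auto
      finally show ?thesis using a by linarith
    qed (auto intro: add_increasing2)
    then have "?m \<le> (\<integral>y. a + a powr (1 - q) * norm y powr q \<partial>\<nu> j)"
      using i1 iq by (intro integral_mono) auto
    then show ?thesis using iq by (simp add: prob_space)
  qed
  have "?m powr q \<le> 2 powr q * ?M"
  proof (cases "?M = 0")
    case True
    \<comment> \<open>With a vanishing \<open>q\<close>-th moment and \<open>a = ?m / 2\<close> the
      bound reads \<open>?m \<le> ?m / 2\<close>.\<close>
    have "?m \<le> 0" using le[of "?m / 2"] True m0 by (cases "?m = 0") auto
    then have "?m = 0" using m0 by (rule order.antisym)
    then show ?thesis using True by simp
  next
    case False
    then have M: "0 < ?M" using M0 by linarith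
    define a where "a = ?M powr (1 / q)"
    have a: "0 < a" using M by (simp add: a_def)
    have "a powr (1 - q) * ?M = a powr (1 - q) * a powr q" using M q by (simp add: a_def powr_powr)
    also have "\<dots> = a" using a by (simp add: powr_add[symmetric])
    finally have "?m \<le> 2 * a" using le[OF a] by simp
    then have "?m powr q \<le> (2 * a) powr q" using m0 q by (intro powr_mono2) auto
    also have "\<dots> = 2 powr q * ?M" using a M q by (simp add: powr_mult a_def powr_powr)
    finally show ?thesis .
  qed
  moreover have "norm (barycenter \<nu> j) powr q \<le> ?m powr q"
    unfolding barycenter_def using q by (intro powr_mono2 integral_norm_bound) auto
  ultimately show ?thesis by simp
qed

lemma plan_sum_barycenter_powr_le:
  assumes \<nu>: "plan n Q \<nu>" and Q: "sets Q = sets borel"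
    and i1: "integrable Q (\<lambda>y. norm y)" and iq: "integrable Q (\<lambda>y. norm y powr q)" and q: "1 \<le> q"
  shows "(\<Sum>j=1..n. norm (barycenter \<nu> j) powr q) \<le> 2 powr q * (n * (\<integral>y. norm y powr q \<partial>Q))"
proof -
  have "(\<Sum>j=1..n. norm (barycenter \<nu> j) powr q) \<le> (\<Sum>j=1..n. 2 powr q * (\<integral>y. norm y powr q \<partial>\<nu> j))"
    by (intro sum_mono barycenter_powr_le planD[OF \<nu>] plan_integrable[OF \<nu> _ Q] i1 iq q)
  then show ?thesis using plan_sum_integral[OF \<nu> Q iq] by (simp add: sum_distrib_left[symmetric])
qed

text \<open>The first marginal is finitely supported, so conditioning is elementary:
  \<open>\<nu> j\<close> is the law of \<open>snd\<close> on the fibre over \<open>x j\<close>. Tied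
  positions share this law, and \<open>N\<close> counts them.\<close>

lemma plan_of_coupling:
  fixes x :: "nat \<Rightarrow> 'a::euclidean_space"
  assumes n: "1 \<le> n" and Q: "sets Q = sets borel" and \<pi>: "\<pi> \<in> couplings (empirical_measure n x) Q"
  obtains \<nu> where "plan n Q \<nu>" "\<And>h. h \<in> borel_measurable borel \<Longrightarrow>
    (\<Sum>j=1..n. \<integral>\<^sup>+y. h (x j, y) \<partial>\<nu> j) = of_nat n * (\<integral>\<^sup>+z. h z \<partial>\<pi>)"
proof -
  have s[measurable_cong]: "sets \<pi> = sets borel" and f: "distr \<pi> borel fst = empirical_measure n x"
    and g: "distr \<pi> borel snd = Q" and p: "prob_space \<pi>"
    using \<pi> by (auto simp: couplings_def)
  interpret prob_space \<pi> by fact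
  have sp: "space \<pi> = UNIV" using sets_eq_imp_space_eq[OF s] by simp
  have fm[measurable]: "fst \<in> \<pi> \<rightarrow>\<^sub>M (borel :: 'a measure)" and sm[measurable]: "snd \<in> \<pi> \<rightarrow>\<^sub>M (borel :: 'a measure)"
    by (auto simp: measurable_cong_sets[OF s refl] intro!: borel_measurable_continuous_onI continuous_intros)
  define F where "F v = fst -` {v} \<inter> space \<pi>" for v :: 'a
  have [measurable]: "F v \<in> sets \<pi>" for v unfolding F_def by measurable
  define N where "N v = card {l \<in> {1..n}. x l = v}" for v
  have em: "emeasure \<pi> (fst -` A \<inter> space \<pi>) = ennreal ((1 / real n) * (\<Sum>i=1..n. indicator A (x i)))"
    if "A \<in> sets borel" for A
    using emeasure_distr[OF fm that] emeasure_empirical_measure[OF n that, of x] by (simp add: f)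
  have Fv: "emeasure \<pi> (F v) = ennreal (N v / n)" for v
  proof -
    have "(\<Sum>i=1..n. indicator {v} (x i) :: real) = N v"
      unfolding N_def by (simp add: indicator_def sum.If_cases Int_def)
    then show ?thesis unfolding F_def by (subst em) auto
  qed
  have N: "0 < N (x j)" if "j \<in> {1..n}" for j
    unfolding N_def using that by (auto simp: card_gt_0_iff)
  define \<nu> where "\<nu> j = distr (uniform_measure \<pi> (F (x j))) borel snd" for j
  have u: "prob_space (uniform_measure \<pi> (F (x j)))" if "j \<in> {1..n}" for j
    using N[OF that] n by (intro prob_space_uniform_measure) (auto simp: Fv ennreal_eq_0_iff divide_le_0_iff)
  have main: "(\<Sum>j=1..n. \<integral>\<^sup>+y. h (x j, y) \<partial>\<nu> j) = of_nat n * (\<integral>\<^sup>+z. h z \<partial>\<pi>)"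
    if h: "h \<in> borel_measurable borel" for h :: "'a \<times> 'a \<Rightarrow> ennreal"
  proof -
    have [measurable]: "h \<in> borel_measurable \<pi>" using h by (simp cong: measurable_cong_sets add: s)
    have hp: "(\<lambda>y. h (v, y)) \<in> borel_measurable borel" for v
      using h by (intro measurable_compose[OF _ h]) (auto intro!: borel_measurable_continuous_onI continuous_intros)
    define H where "H v = (\<integral>\<^sup>+z. h z * indicator (F v) z \<partial>\<pi>)" for v
    have "(\<integral>\<^sup>+y. h (x j, y) \<partial>\<nu> j) = ennreal (n / N (x j)) * H (x j)" if j: "j \<in> {1..n}" for j
    proof -
      have m: "(\<lambda>z. h (x j, snd z)) \<in> borel_measurable \<pi>" using measurable_compose[OF sm hp] .
      have "(\<integral>\<^sup>+y. h (x j, y) \<partial>\<nu> j) = (\<integral>\<^sup>+z. h (x j, snd z) \<partial>uniform_measure \<pi> (F (x j)))"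
        unfolding \<nu>_def by (rule nn_integral_distr) (auto simp: hp)
      also have "\<dots> = (\<integral>\<^sup>+z. h (x j, snd z) * indicator (F (x j)) z \<partial>\<pi>) / emeasure \<pi> (F (x j))"
        by (rule nn_integral_uniform_measure) (use m in auto)
      also have "(\<integral>\<^sup>+z. h (x j, snd z) * indicator (F (x j)) z \<partial>\<pi>) = H (x j)"
        unfolding H_def by (intro nn_integral_cong) (auto simp: F_def indicator_def)
      also have "H (x j) / emeasure \<pi> (F (x j)) = ennreal (n / N (x j)) * H (x j)"
        using N[OF j] n by (simp add: Fv divide_ennreal_def inverse_ennreal mult.commute)
      finally show ?thesis .
    qed
    then have "(\<Sum>j=1..n. \<integral>\<^sup>+y. h (x j, y) \<partial>\<nu> j) = (\<Sum>j=1..n. ennreal (n / N (x j)) * H (x j))"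
      by (intro sum.cong) auto
    \<comment> \<open>Positions are grouped by the value of their point; the multiplicity
      \<open>N v\<close> then cancels against the normalisation by the fibre mass
      \<open>N v / n\<close>, up to the factor \<open>n\<close>.\<close>
    also have "\<dots> = (\<Sum>v\<in>x ` {1..n}. of_nat (N v) * (ennreal (n / N v) * H v))"
      using sum_fun_comp[of "{1..n}" "x ` {1..n}" x "\<lambda>v. ennreal (n / N v) * H v"] by (simp add: N_def)
    also have "\<dots> = (\<Sum>v\<in>x ` {1..n}. of_nat n * H v)"
    proof (intro sum.cong refl)
      fix v assume "v \<in> x ` {1..n}"
      then have Nv: "0 < N v" using N by auto
      then show "of_nat (N v) * (ennreal (n / N v) * H v) = of_nat n * H v"
        by (simp add: mult.assoc[symmetric] ennreal_of_nat_eq_real_of_nat ennreal_mult[symmetric])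
    qed
    also have "\<dots> = of_nat n * (\<Sum>v\<in>x ` {1..n}. H v)" by (simp add: sum_distrib_left)
    also have "(\<Sum>v\<in>x ` {1..n}. H v) = (\<integral>\<^sup>+z. (\<Sum>v\<in>x ` {1..n}. h z * indicator (F v) z) \<partial>\<pi>)"
      unfolding H_def by (rule nn_integral_sum[symmetric]) measurable
    also have "\<dots> = (\<integral>\<^sup>+z. h z \<partial>\<pi>)"
    proof (rule nn_integral_cong_AE)
      have "- (x ` {1..n}) \<in> sets borel"
        by (intro borel_open open_Compl finite_imp_closed) auto
      from em[OF this] have "emeasure \<pi> (fst -` (- (x ` {1..n})) \<inter> space \<pi>) = 0"
        by (simp add: indicator_def)
      then have "AE z in \<pi>. z \<notin> fst -` (- (x ` {1..n})) \<inter> space \<pi>"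
        using \<open>- (x ` {1..n}) \<in> sets borel\<close> by (intro AE_not_in null_setsI) auto
      then show "AE z in \<pi>. (\<Sum>v\<in>x ` {1..n}. h z * indicator (F v) z) = h z"
      proof eventually_elim
        case (elim z)
        then have z: "fst z \<in> x ` {1..n}" by (auto simp: sp)
        have "(\<Sum>v\<in>x ` {1..n}. h z * indicator (F v) z) = (\<Sum>v\<in>x ` {1..n}. if v = fst z then h z else 0)"
          by (intro sum.cong refl) (auto simp: F_def sp)
        then show ?case using z by simp
      qed
    qed
    finally show ?thesis .
  qed
  have "plan n Q \<nu>"
    unfolding plan_def
  proof safe
    fix j assume "j \<in> {1..n}"
    then show "prob_space (\<nu> j)" unfolding \<nu>_def
      by (intro prob_space.prob_space_distr u) auto
    show "A \<in> sets (\<nu> j) \<Longrightarrow> A \<in> sets borel" "A \<in> sets borel \<Longrightarrow> A \<in> sets (\<nu> j)" for A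
      by (auto simp: \<nu>_def)
  next
    fix h :: "'a \<Rightarrow> ennreal" assume h: "h \<in> borel_measurable borel"
    have "(\<lambda>z. h (snd z)) \<in> borel_measurable (borel :: ('a \<times> 'a) measure)"
      by (intro measurable_compose[OF _ h]) (auto intro!: borel_measurable_continuous_onI continuous_intros)
    from main[OF this] show "(\<Sum>j=1..n. \<integral>\<^sup>+y. h y \<partial>\<nu> j) = of_nat n * (\<integral>\<^sup>+y. h y \<partial>Q)"
      unfolding g[symmetric] by (simp add: nn_integral_distr[OF sm] h)
  qed
  then show ?thesis using main that by blast
qed

text \<open>Draw a position \<open>j\<close> uniformly, then \<open>y\<close> from
  \<open>\<nu> j\<close>, and output the pair \<open>(x j, y)\<close>.\<close>

lemma coupling_of_plan:
  fixes x :: "nat \<Rightarrow> 'a::euclidean_space"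
  assumes n: "1 \<le> n" and Q: "sets Q = sets borel" and \<nu>: "plan n Q \<nu>"
  obtains \<pi> where "\<pi> \<in> couplings (empirical_measure n x) Q" "\<And>h. h \<in> borel_measurable borel \<Longrightarrow>
    (\<Sum>j=1..n. \<integral>\<^sup>+y. h (x j, y) \<partial>\<nu> j) = of_nat n * (\<integral>\<^sup>+z. h z \<partial>\<pi>)"
proof -
  let ?U = "uniform_count_measure {1..n}"
  interpret U: prob_space ?U using n by (intro prob_space_uniform_count_measure) auto
  have spU: "space ?U = {1..n}" by (simp add: space_uniform_count_measure)
  define K where "K j = distr (\<nu> j) borel (\<lambda>y. (x j, y))" for j
  have pm: "(\<lambda>y. (v, y)) \<in> borel \<rightarrow>\<^sub>M borel" for v :: 'a
    by (auto intro!: borel_measurable_continuous_onI continuous_intros)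
  then have pm': "(\<lambda>y. (v, y)) \<in> \<nu> j \<rightarrow>\<^sub>M borel" if "j \<in> {1..n}" for v :: 'a and j
    using planD(2)[OF \<nu> that] by (simp cong: measurable_cong_sets)
  have KP: "prob_space (K j)" if "j \<in> {1..n}" for j
    unfolding K_def by (intro prob_space.prob_space_distr planD(1)[OF \<nu> that] pm' that)
  have "K \<in> count_space {1..n} \<rightarrow>\<^sub>M subprob_algebra borel"
    by (auto simp: measurable_count_space_eq1 space_subprob_algebra K_def[abs_def] 
        intro!: prob_space_imp_subprob_space KP[unfolded K_def])
  then have K: "K \<in> ?U \<rightarrow>\<^sub>M subprob_algebra borel"
    by (subst measurable_cong_sets[OF sets_uniform_count_measure_count_space refl])
  define \<pi> where "\<pi> = ?U \<bind> K"
  have s: "sets \<pi> = sets borel" unfolding \<pi>_def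
    by (rule sets_bind) (use n in \<open>auto simp: K_def spU\<close>)
  have main: "(\<Sum>j=1..n. \<integral>\<^sup>+y. h (x j, y) \<partial>\<nu> j) = of_nat n * (\<integral>\<^sup>+z. h z \<partial>\<pi>)"
    if h: "h \<in> borel_measurable borel" for h :: "'a \<times> 'a \<Rightarrow> ennreal"
  proof -
    have "(\<integral>\<^sup>+z. h z \<partial>\<pi>) = (\<integral>\<^sup>+j. \<integral>\<^sup>+z. h z \<partial>K j \<partial>?U)"
      unfolding \<pi>_def by (rule nn_integral_bind[OF h K])
    also have "\<dots> = (\<integral>\<^sup>+j. \<integral>\<^sup>+y. h (x j, y) \<partial>\<nu> j \<partial>?U)"
    proof (intro nn_integral_cong)
      fix j assume "j \<in> space ?U"
      then have j: "j \<in> {1..n}" by (simp only: spU)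
      show "(\<integral>\<^sup>+z. h z \<partial>K j) = (\<integral>\<^sup>+y. h (x j, y) \<partial>\<nu> j)"
        unfolding K_def by (rule nn_integral_distr) (use pm'[OF j] h in auto)
    qed
    also have "\<dots> = (\<Sum>j=1..n. ennreal (1 / n) * (\<integral>\<^sup>+y. h (x j, y) \<partial>\<nu> j))"
      unfolding uniform_count_measure_def by (subst nn_integral_point_measure_finite) auto
    finally show ?thesis using n
      by (simp add: sum_distrib_left[symmetric] mult.assoc[symmetric] ennreal_of_nat_eq_real_of_nat ennreal_mult[symmetric])
  qed
  have pr: "prob_space \<pi>" unfolding \<pi>_def
    by (rule U.prob_space_bind[OF _ K], rule AE_I2, rule KP, simp only: spU)
  have fm: "fst \<in> \<pi> \<rightarrow>\<^sub>M (borel :: 'a measure)" and sm: "snd \<in> \<pi> \<rightarrow>\<^sub>M (borel :: 'a measure)"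
    by (auto simp: measurable_cong_sets[OF s refl] intro!: borel_measurable_continuous_onI continuous_intros)
  have fb: "fst \<in> borel \<rightarrow>\<^sub>M (borel :: 'a measure)" "snd \<in> borel \<rightarrow>\<^sub>M (borel :: 'a measure)"
    by (auto intro!: borel_measurable_continuous_onI continuous_intros)
  have canc: "a = b" if "of_nat n * a = of_nat n * b" for a b :: ennreal
    using that n by (simp add: ennreal_mult_cancel_left of_nat_eq_0_iff)
  have "distr \<pi> borel fst = empirical_measure n x"
  proof (rule measure_eqI)
    fix A assume "A \<in> sets (distr \<pi> borel fst)"
    then have A: "A \<in> sets borel" by simp
    have "of_nat n * emeasure (distr \<pi> borel fst) A = of_nat n * (\<integral>\<^sup>+z. indicator A (fst z) \<partial>\<pi>)"
      using A by (simp add: nn_integral_distr[OF fm, symmetric])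
    also have "\<dots> = (\<Sum>j=1..n. \<integral>\<^sup>+y. indicator A (fst (x j, y)) \<partial>\<nu> j)"
      by (rule main[symmetric]) (intro measurable_compose[OF fb(1)] borel_measurable_indicator A)
    also have "\<dots> = (\<Sum>j=1..n. indicator A (x j))"
      using prob_space.emeasure_space_1[OF planD(1)[OF \<nu>]] by (intro sum.cong) auto
    also have "\<dots> = of_nat n * emeasure (empirical_measure n x) A"
      using n by (subst emeasure_empirical_measure[OF n A])
        (simp add: ennreal_of_nat_eq_real_of_nat ennreal_mult[symmetric] sum_nonneg sum_ennreal[symmetric] ennreal_indicator)
    finally show "emeasure (distr \<pi> borel fst) A = emeasure (empirical_measure n x) A" by (rule canc)
  qed (simp add: empirical_measure_def)
  moreover have "distr \<pi> borel snd = Q"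
  proof (rule measure_eqI)
    fix A assume "A \<in> sets (distr \<pi> borel snd)"
    then have A: "A \<in> sets borel" by simp
    have "of_nat n * emeasure (distr \<pi> borel snd) A = of_nat n * (\<integral>\<^sup>+z. indicator A (snd z) \<partial>\<pi>)"
      using A by (simp add: nn_integral_distr[OF sm, symmetric])
    also have "\<dots> = (\<Sum>j=1..n. \<integral>\<^sup>+y. indicator A (snd (x j, y)) \<partial>\<nu> j)"
      by (rule main[symmetric]) (intro measurable_compose[OF fb(2)] borel_measurable_indicator A)
    also have "\<dots> = of_nat n * emeasure Q A"
      using plan_nn_integral[OF \<nu>, of "indicator A"] A Q by simp
    finally show "emeasure (distr \<pi> borel snd) A = emeasure Q A" by (rule canc)
  qed (simp add: Q)
  ultimately have "\<pi> \<in> couplings (empirical_measure n x) Q" using s pr by (auto simp: couplings_def)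
  then show ?thesis using main that by blast
qed

text \<open>After expanding the square only the cross term depends on the coupling, and it enters
  through the barycenters alone; minimal cost is therefore maximal correlation.\<close>

lemma wasserstein2_sq_empirical:
  fixes x :: "nat \<Rightarrow> 'a::euclidean_space"
  assumes n: "1 \<le> n" and Qp: "prob_space Q" and Q: "sets Q = sets borel"
    and i1: "integrable Q (\<lambda>y. norm y)" and i2: "integrable Q (\<lambda>y. (norm y)\<^sup>2)"
  shows "wasserstein2_sq (empirical_measure n x) Q
    = (\<Sum>j=1..n. (norm (x j))\<^sup>2) / n + (\<integral>y. (norm y)\<^sup>2 \<partial>Q) - 2 / n * max_correlation n Q x"
proof -
  let ?cost = "\<lambda>\<pi>. \<integral>\<^sup>+ z. ennreal ((norm (fst z - snd z))\<^sup>2) \<partial>\<pi>"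
  define A where "A = (\<Sum>j=1..n. (norm (x j))\<^sup>2) / n + (\<integral>y. (norm y)\<^sup>2 \<partial>Q)"
  let ?c = "\<lambda>\<nu>. A - 2 / n * correlation n x \<nu>"
  let ?s = "max_correlation n Q x"
  have iid: "integrable Q (\<lambda>y. y)"
    using i1 Q by (subst (asm) integrable_norm_iff) (simp_all cong: measurable_cong_sets)
  have hm: "(\<lambda>z. ennreal ((norm (fst z - snd z))\<^sup>2)) \<in> borel_measurable (borel :: ('a \<times> 'a) measure)"
    by (intro measurable_compose[OF _ measurable_ennreal] borel_measurable_continuous_onI continuous_intros)
  have cost: "(\<Sum>j=1..n. \<integral>\<^sup>+y. ennreal ((norm (x j - y))\<^sup>2) \<partial>\<nu> j) = ennreal (n * ?c \<nu>) \<and> 0 \<le> ?c \<nu>"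
    if \<nu>: "plan n Q \<nu>" for \<nu>
  proof -
    have e: "(norm (v - y))\<^sup>2 = (norm v)\<^sup>2 - 2 * (v \<bullet> y) + (norm y)\<^sup>2" for v y :: 'a
      by (simp add: power2_norm_eq_inner inner_diff inner_commute algebra_simps)
    have I: "integrable (\<nu> j) (\<lambda>y. (norm (x j - y))\<^sup>2)"
      "(\<integral>y. (norm (x j - y))\<^sup>2 \<partial>\<nu> j) = (norm (x j))\<^sup>2 - 2 * (x j \<bullet> barycenter \<nu> j) + (\<integral>y. (norm y)\<^sup>2 \<partial>\<nu> j)"
      if j: "j \<in> {1..n}" for j
    proof -
      interpret prob_space "\<nu> j" by (rule planD(1)[OF \<nu> j])
      note k = plan_integrable[OF \<nu> j Q i2] plan_integrable[OF \<nu> j Q iid]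
      show "integrable (\<nu> j) (\<lambda>y. (norm (x j - y))\<^sup>2)" unfolding e using k by simp
      show "(\<integral>y. (norm (x j - y))\<^sup>2 \<partial>\<nu> j) = (norm (x j))\<^sup>2 - 2 * (x j \<bullet> barycenter \<nu> j) + (\<integral>y. (norm y)\<^sup>2 \<partial>\<nu> j)"
        unfolding e barycenter_def using k by (simp add: prob_space)
    qed
    have "(\<Sum>j=1..n. \<integral>\<^sup>+y. ennreal ((norm (x j - y))\<^sup>2) \<partial>\<nu> j) = (\<Sum>j=1..n. ennreal (\<integral>y. (norm (x j - y))\<^sup>2 \<partial>\<nu> j))"
      by (intro sum.cong refl nn_integral_eq_integral I) auto
    also have "\<dots> = ennreal (\<Sum>j=1..n. \<integral>y. (norm (x j - y))\<^sup>2 \<partial>\<nu> j)"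
      by (rule sum_ennreal) (auto intro!: integral_nonneg_AE)
    finally have 1: "(\<Sum>j=1..n. \<integral>\<^sup>+y. ennreal ((norm (x j - y))\<^sup>2) \<partial>\<nu> j) = ennreal (\<Sum>j=1..n. \<integral>y. (norm (x j - y))\<^sup>2 \<partial>\<nu> j)" .
    have 2: "(\<Sum>j=1..n. \<integral>y. (norm (x j - y))\<^sup>2 \<partial>\<nu> j) = n * ?c \<nu>"
      using n plan_sum_integral[OF \<nu> Q i2]
      by (simp add: I sum.distrib sum_subtractf A_def correlation_def sum_distrib_left[symmetric] field_simps)
    have "0 \<le> (\<Sum>j=1..n. \<integral>y. (norm (x j - y))\<^sup>2 \<partial>\<nu> j)" by (auto intro!: sum_nonneg integral_nonneg_AE)
    then have "0 \<le> ?c \<nu>" using n unfolding 2 by (simp add: zero_le_mult_iff)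
    then show ?thesis using 1 2 by simp
  qed
  have canc: "a = b" if "of_nat n * a = of_nat n * b" for a b :: ennreal
    using that n by (simp add: ennreal_mult_cancel_left of_nat_eq_0_iff)
  have cv: "?cost \<pi> = ennreal (?c \<nu>)" if \<nu>: "plan n Q \<nu>"
    and h: "\<And>h :: 'a \<times> 'a \<Rightarrow> ennreal. h \<in> borel_measurable borel \<Longrightarrow>
      (\<Sum>j=1..n. \<integral>\<^sup>+y. h (x j, y) \<partial>\<nu> j) = of_nat n * (\<integral>\<^sup>+z. h z \<partial>\<pi>)" for \<nu> \<pi>
  proof (rule canc)
    show "of_nat n * ?cost \<pi> = of_nat n * ennreal (?c \<nu>)"
      using h[OF hm] cost[OF \<nu>] by (simp add: ennreal_of_nat_eq_real_of_nat ennreal_mult)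
  qed
  \<comment> \<open>The infimum is taken in \<open>ennreal\<close>, where a negative real would be
    truncated to 0, so the claimed value must first be known to be nonnegative.\<close>
  have s0: "0 \<le> A - 2 / n * ?s"
  proof -
    have "?s \<le> A * n / 2" unfolding max_correlation_def
      using plan_const[OF Qp Q, of n] cost n by (intro cSUP_least) (auto simp: field_simps)
    then show ?thesis using n by (simp add: field_simps)
  qed
  have "(INF \<pi>\<in>couplings (empirical_measure n x) Q. ?cost \<pi>) = ennreal (A - 2 / n * ?s)"
  proof (rule antisym)
    show "(INF \<pi>\<in>couplings (empirical_measure n x) Q. ?cost \<pi>) \<le> ennreal (A - 2 / n * ?s)"
    proof (rule ennreal_le_epsilon)
      fix e :: real assume e: "0 < e"
      then have "0 < e * n / 2" using n by simp
      from max_correlation_approx[OF Qp Q i1 this] obtain \<nu> where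
        \<nu>: "plan n Q \<nu>" "?s - e * n / 2 < correlation n x \<nu>" by blast
      obtain \<pi> where \<pi>: "\<pi> \<in> couplings (empirical_measure n x) Q" "\<And>h. h \<in> borel_measurable borel \<Longrightarrow>
        (\<Sum>j=1..n. \<integral>\<^sup>+y. h (x j, y) \<partial>\<nu> j) = of_nat n * (\<integral>\<^sup>+z. h z \<partial>\<pi>)"
        using coupling_of_plan[OF n Q \<nu>(1)] by blast
      have "(INF \<pi>\<in>couplings (empirical_measure n x) Q. ?cost \<pi>) \<le> ennreal (?c \<nu>)"
        using \<pi>(1) by (intro INF_lower2[of \<pi>]) (simp_all add: cv[OF \<nu>(1) \<pi>(2)])
      also have "\<dots> \<le> ennreal ((A - 2 / n * ?s) + e)"
      proof (rule ennreal_leI)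
        have "2 / n * (?s - e * n / 2) \<le> 2 / n * correlation n x \<nu>"
          using \<nu>(2) by (intro mult_left_mono) auto
        then show "?c \<nu> \<le> (A - 2 / n * ?s) + e" using n by (simp add: right_diff_distrib)
      qed
      finally show "(INF \<pi>\<in>couplings (empirical_measure n x) Q. ?cost \<pi>) \<le> ennreal (A - 2 / n * ?s) + ennreal e"
        using s0 e by (simp add: ennreal_plus)
    qed
  next
    show "ennreal (A - 2 / n * ?s) \<le> (INF \<pi>\<in>couplings (empirical_measure n x) Q. ?cost \<pi>)"
    proof (rule INF_greatest)
      fix \<pi> assume "\<pi> \<in> couplings (empirical_measure n x) Q"
      from plan_of_coupling[OF n Q this] obtain \<nu> where \<nu>: "plan n Q \<nu>" "\<And>h. h \<in> borel_measurable borel \<Longrightarrow>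
        (\<Sum>j=1..n. \<integral>\<^sup>+y. h (x j, y) \<partial>\<nu> j) = of_nat n * (\<integral>\<^sup>+z. h z \<partial>\<pi>)" by blast
      show "ennreal (A - 2 / n * ?s) \<le> ?cost \<pi>"
      proof -
        have c: "?cost \<pi> = ennreal (?c \<nu>)" using \<nu> by (rule cv)
        show ?thesis
          unfolding c using correlation_le_max[OF Q i1 \<nu>(1), of x] n
          by (intro ennreal_leI) (simp add: divide_right_mono)
      qed
    qed
  qed
  then show ?thesis unfolding wasserstein2_sq_def using s0 by (simp add: A_def)
qed

section \<open>Convex functions and absolutely continuous measures\<close>

lemma convex_convex_support: "convex (convex_support \<mu>)"
  unfolding convex_support_def by (intro convex_Inter) auto

text \<open>The complement of the support is an uncountable union of open null sets; by the Lindelof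
  property countably many of them already cover it.\<close>

lemma AE_convex_support:
  assumes [measurable_cong]: "sets \<mu> = sets borel"
  shows "AE x in \<mu>. x \<in> convex_support \<mu>"
proof -
  define F where "F = {- C | C. closed C \<and> convex C \<and> emeasure \<mu> (- C) = 0}"
  have op: "\<And>S. S \<in> F \<Longrightarrow> open S" by (auto simp: F_def)
  obtain F' where F': "F' \<subseteq> F" "countable F'" "\<Union>F' = \<Union>F" using Lindelof[OF op] by blast
  have "AE x in \<mu>. \<forall>S\<in>F'. x \<notin> S"
  proof (subst AE_ball_countable[OF F'(2)], intro ballI)
    fix S assume "S \<in> F'"
    then have "S \<in> null_sets \<mu>" using F'(1) op assms by (auto simp: F_def intro!: null_setsI)
    then show "AE x in \<mu>. x \<notin> S" by (rule AE_not_in)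
  qed
  then show ?thesis
  proof eventually_elim
    case (elim x)
    then have "x \<notin> \<Union>F" using F'(3) by auto
    then show ?case by (auto simp: F_def convex_support_def)
  qed
qed

lemma has_positive_density_AE:
  assumes "has_positive_density \<mu>" "AE x in lborel. R x"
  shows "AE x in \<mu>. R x"
proof -
  obtain f where f: "f \<in> borel_measurable borel" "\<mu> = density lborel (\<lambda>x. ennreal (f x))"
    using assms(1) unfolding has_positive_density_def by blast
  show ?thesis unfolding f(2) using f(1) assms(2) by (subst AE_density) auto
qed

text \<open>A convex set has a Lebesgue-null frontier.\<close>

lemma AE_interior_convex_support:
  assumes "has_positive_density \<mu>" "sets \<mu> = sets borel"
  shows "AE x in \<mu>. x \<in> interior (convex_support \<mu>)"
proof -
  have "frontier (convex_support \<mu>) \<in> null_sets lborel"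
    using negligible_convex_frontier[OF convex_convex_support, of \<mu>]
    by (auto simp: negligible_iff_null_sets null_sets_completion_iff)
  then have "AE x in \<mu>. x \<notin> frontier (convex_support \<mu>)"
    by (intro has_positive_density_AE[OF assms(1)] AE_not_in)
  with AE_convex_support[OF assms(2)] show ?thesis
    by eventually_elim (use closure_subset in \<open>auto simp: frontier_def\<close>)
qed

text \<open>Together with the law of large numbers this supplies many sample points near each centre
  of a finite net.\<close>

lemma measure_ball_pos:
  assumes "prob_space \<mu>" "sets \<mu> = sets borel" "has_positive_density \<mu>"
    and a: "a \<in> interior (convex_support \<mu>)" and r: "0 < r"
  shows "0 < measure \<mu> (ball a r)"
proof -
  interpret prob_space \<mu> by fact
  let ?U = "interior (convex_support \<mu>)"
  obtain f where f[measurable]: "f \<in> borel_measurable borel" and \<mu>: "\<mu> = density lborel (\<lambda>x. ennreal (f x))"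
    and pos: "\<And>x. x \<in> ?U \<Longrightarrow> 0 < f x"
    using assms(3) unfolding has_positive_density_def by blast
  obtain s where s: "0 < s" "ball a s \<subseteq> ?U" using a open_contains_ball[of ?U] by auto
  have [measurable]: "ball a r \<in> sets borel" by simp
  have "emeasure \<mu> (ball a r) \<noteq> 0"
  proof
    assume "emeasure \<mu> (ball a r) = 0"
    then have "(\<integral>\<^sup>+x. ennreal (f x) * indicator (ball a r) x \<partial>lborel) = 0"
      unfolding \<mu> by (subst (asm) emeasure_density) auto
    then have "AE x in lborel. ennreal (f x) * indicator (ball a r) x = 0"
      by (subst (asm) nn_integral_0_iff_AE) measurable
    then have "AE x in lborel. x \<notin> ball a (min r s)"
    proof eventually_elim
      case (elim x)
      show ?case
      proof
        assume x: "x \<in> ball a (min r s)"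
        then have "0 < f x" using s pos by auto
        then show False using elim x by auto
      qed
    qed
    then have "emeasure lborel (ball a (min r s)) = 0"
      by (subst (asm) AE_iff_measurable[of "ball a (min r s)"]) auto
    then have "negligible (ball a (min r s))"
      by (auto simp: negligible_iff_null_sets intro!: null_sets_completionI)
    then show False using r s open_not_negligible[of "ball a (min r s)"] by auto
  qed
  then show ?thesis by (simp add: emeasure_eq_measure zero_less_measure_iff)
qed

text \<open>The effective domain \<open>D\<close> is convex and its closure has full measure, so the
  closure contains the convex support; and the interior of the closure of a convex set lies in the
  set itself.\<close>

lemma convex_fun_finite_on_interior:
  fixes \<phi>0 :: "'a::euclidean_space \<Rightarrow> ereal"
  assumes "sets P = sets borel" and cv: "convex_fun \<phi>0" and nm: "\<And>x. \<phi>0 x \<noteq> -\<infinity>"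
    and fin: "AE x in P. \<bar>\<phi>0 x\<bar> \<noteq> \<infinity>" and x: "x \<in> interior (convex_support P)"
  shows "\<phi>0 x \<noteq> \<infinity>"
proof -
  define D where "D = {x. \<phi>0 x < \<infinity>}"
  have "convex D"
  proof (rule convexI)
    fix x y u v assume xy: "x \<in> D" "y \<in> D" and uv: "0 \<le> (u::real)" "0 \<le> v" "u + v = 1"
    show "u *\<^sub>R x + v *\<^sub>R y \<in> D"
    proof (cases "0 < v \<and> v < 1")
      case True
      have "u = 1 - v" using uv by simp
      then have "\<phi>0 (u *\<^sub>R x + v *\<^sub>R y) \<le> ereal u * \<phi>0 x + ereal v * \<phi>0 y"
        using cv True unfolding convex_fun_def by blast
      also have "\<dots> < \<infinity>"
        using xy nm[of x] nm[of y] by (cases "\<phi>0 x"; cases "\<phi>0 y") (auto simp: D_def)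
      finally show ?thesis by (simp add: D_def)
    next
      case False
      then have "v = 0 \<or> v = 1" using uv by auto
      then show ?thesis using xy uv by auto
    qed
  qed
  have "emeasure P (- closure D) = 0"
  proof -
    have "AE x in P. x \<notin> - closure D"
      using fin by eventually_elim (use closure_subset[of D] in \<open>auto simp: D_def less_le\<close>)
    moreover have "- closure D \<in> sets P" using assms(1) by auto
    ultimately show ?thesis using AE_iff_measurable[of "- closure D" P "\<lambda>x. x \<notin> - closure D"]
      sets_eq_imp_space_eq[OF assms(1)] by auto
  qed
  then have "convex_support P \<subseteq> closure D"
    unfolding convex_support_def using \<open>convex D\<close> by (intro Inter_lower) (auto simp: convex_closure)
  then have "x \<in> interior (closure D)" using x interior_mono by blast
  then have "x \<in> D" using convex_interior_closure[OF \<open>convex D\<close>] interior_subset by blast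
  then show ?thesis by (simp add: D_def less_le)
qed

lemma convex_on_real_of_ereal:
  fixes h :: "'a::real_vector \<Rightarrow> ereal"
  assumes "convex_fun h" "convex U" "\<And>x. x \<in> U \<Longrightarrow> \<bar>h x\<bar> \<noteq> \<infinity>"
  shows "convex_on U (\<lambda>x. real_of_ereal (h x))"
proof (rule convex_onI)
  fix t :: real and x y assume t: "0 < t" "t < 1" and xy: "x \<in> U" "y \<in> U"
  have "(1 - t) *\<^sub>R x + t *\<^sub>R y \<in> U" using convexD[OF assms(2) xy, of "1 - t" t] t by simp
  then show "real_of_ereal (h ((1 - t) *\<^sub>R x + t *\<^sub>R y)) \<le> (1 - t) * real_of_ereal (h x) + t * real_of_ereal (h y)"
    using assms(1)[unfolded convex_fun_def, rule_format, of t x y] t assms(3)[of x] assms(3)[of y]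
      assms(3)[of "(1 - t) *\<^sub>R x + t *\<^sub>R y"] xy
    by (cases "h x"; cases "h y"; cases "h ((1 - t) *\<^sub>R x + t *\<^sub>R y)") auto
qed fact

text \<open>Second-order Taylor bound for \<open>(max 0 u)\<^sup>2\<close>, whose derivative
  \<open>2 * max 0 u\<close> is 2-Lipschitz; it controls the second differences of the bump
  \<open>\<theta>\<close> below.\<close>

lemma square_positive_part_le:
  fixes u v :: real
  shows "(max 0 (u + v))\<^sup>2 \<le> (max 0 u)\<^sup>2 + 2 * max 0 u * v + v\<^sup>2"
proof -
  have "max 0 (u + v) \<le> \<bar>max 0 u + v\<bar>" by (auto simp: max_def)
  then have "(max 0 (u + v))\<^sup>2 \<le> \<bar>max 0 u + v\<bar>\<^sup>2" by (intro power_mono) auto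
  then show ?thesis by (simp add: power2_sum)
qed

text \<open>Testing the second difference against \<open>\<theta>\<close> moves the difference to \<open>\<theta>\<close>, whose own second
  difference is of order \<open>k\<^sup>-\<^sup>2\<close>.\<close>

lemma AE_second_difference_ball:
  fixes \<phi> :: "'a::euclidean_space \<Rightarrow> real"
  assumes cv: "convex_on (cball a (2 * r)) \<phi>" and ct: "continuous_on (cball a (2 * r)) \<phi>"
    and r: "0 < r" and e: "norm e = 1"
  shows "AE x in lborel. x \<in> ball a r \<longrightarrow> (\<forall>\<eta>>0. \<exists>\<^sub>F k in sequentially.
    real k * (\<phi> (x + (1 / real k) *\<^sub>R e) + \<phi> (x - (1 / real k) *\<^sub>R e) - 2 * \<phi> x) < \<eta>)"
proof -
  let ?B = "cball a (2 * r)"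
  obtain M where M: "\<And>x. x \<in> ?B \<Longrightarrow> \<bar>\<phi> x\<bar> \<le> M"
    using compact_imp_bounded[OF compact_continuous_image[OF ct compact_cball]]
    unfolding bounded_iff by (metis imageI real_norm_def)
  \<comment> \<open>The shift by \<open>M\<close> makes \<open>w\<close> nonnegative, so upper
    bounds for second differences of \<open>\<theta>\<close> may be multiplied by it; inside the
    ball the shift cancels from second differences of \<open>\<phi>\<close>.\<close>
  define w where "w x = indicator ?B x *\<^sub>R (\<phi> x + M)" for x
  define q where "q x = r\<^sup>2 - (norm (x - a))\<^sup>2" for x
  define \<theta> where "\<theta> x = (max 0 (q x))\<^sup>2" for x
  define \<Delta> where "\<Delta> k x = real k * (w (x + (1 / real k) *\<^sub>R e) + w (x - (1 / real k) *\<^sub>R e) - 2 * w x)" for k x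
  have M0: "0 \<le> M" using M[of a] r by auto
  have w0: "0 \<le> w x" "w x \<le> 2 * M" for x using M[of x] M0 by (auto simp: w_def indicator_def)
  have [measurable]: "w \<in> borel_measurable borel" unfolding w_def
    by (intro borel_measurable_continuous_on_indicator) (auto intro!: continuous_intros ct)
  have [measurable]: "\<theta> \<in> borel_measurable borel" unfolding \<theta>_def q_def by measurable
  have \<theta>0: "0 \<le> \<theta> x" for x by (simp add: \<theta>_def)
  have \<theta>b: "\<theta> x \<le> r^4" for x
  proof -
    have "max 0 (q x) \<le> r\<^sup>2" by (auto simp: q_def)
    then have "\<theta> x \<le> (r\<^sup>2)\<^sup>2" unfolding \<theta>_def by (intro power_mono) auto
    then show ?thesis by (simp flip: power_mult)
  qed
  have \<theta>out: "\<theta> x = 0" if "r \<le> norm (x - a)" for x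
    using that r power_mono[of r "norm (x - a)" 2] by (simp add: \<theta>_def q_def)
  have iB: "integrable lborel (\<lambda>x. indicator ?B x * (2 * M))"
    using emeasure_lborel_cball_finite[of a "2 * r"]
    by (intro integrable_mult_left integrable_real_indicator) auto
  have iw: "integrable lborel w"
  proof (rule Bochner_Integration.integrable_bound[OF iB])
    show "AE x in lborel. norm (w x) \<le> norm (indicator ?B x * (2 * M))"
    proof (rule AE_I2)
      fix x show "norm (w x) \<le> norm (indicator ?B x * (2 * M))"
        using w0[of x] M0 by (cases "x \<in> ?B") (simp_all add: w_def)
    qed
  qed measurable
  have iw': "integrable lborel (\<lambda>x. w (x + v))" for v
  proof -
    have "integrable lborel (\<lambda>x. w (v + x))"
      by (rule integrable_distr[of "(+) v" lborel borel]) (simp_all add: iw lborel_distr_plus)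
    then show ?thesis by (simp only: add.commute)
  qed
  have tr: "(\<integral>x. \<theta> x * w (x + v) \<partial>lborel) = (\<integral>x. w x * \<theta> (x - v) \<partial>lborel)" for v
  proof -
    have "(\<integral>x. w x * \<theta> (x - v) \<partial>lborel) = (\<integral>x. w x * \<theta> (x - v) \<partial>distr lborel borel (\<lambda>x. v + x))"
      by (simp add: lborel_distr_plus)
    also have "\<dots> = (\<integral>x. w (v + x) * \<theta> (v + x - v) \<partial>lborel)" by (rule integral_distr) auto
    finally show ?thesis by (simp add: mult.commute add.commute)
  qed
  have ib: "integrable lborel (\<lambda>x. g x * w (x + v))" if [measurable]: "g \<in> borel_measurable borel"
    and "\<And>x. 0 \<le> g x" "\<And>x. g x \<le> r^4" for v and g :: "'a \<Rightarrow> real"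
    by (rule Bochner_Integration.integrable_bound[OF integrable_mult_right[OF iw', of "r^4" v]])
      (use w0 that in \<open>auto intro!: AE_I2 mult_right_mono simp: abs_mult\<close>)
  \<comment> \<open>On the doubled ball a step of length \<open>s \<le> r\<close> changes
    \<open>q\<close> by at most \<open>4 * r * s + s\<^sup>2 \<le> 5 * r * s\<close>. The
    first-order terms of the two directions cancel up to something nonpositive, and two squares of
    \<open>5 * r * s\<close> give the constant 50.\<close>
  have sd: "w x * (\<theta> (x - v) + \<theta> (x + v) - 2 * \<theta> x) \<le> 50 * r\<^sup>2 * s\<^sup>2 * w x"
    if v: "v = s *\<^sub>R e" and s: "0 \<le> s" "s \<le> r" for x v s
  proof (cases "x \<in> ?B")
    case True
    then have xa: "norm (x - a) \<le> 2 * r" by (simp add: dist_norm norm_minus_commute)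
    have nv: "norm v = s" using v e s by simp
    define m where "m = 2 * ((x - a) \<bullet> v)"
    have qv: "q (x + v) = q x + (- m - s\<^sup>2)" "q (x - v) = q x + (m - s\<^sup>2)"
      using nv dot_square_norm[of v]
      by (simp_all add: q_def m_def power2_norm_eq_inner inner_diff inner_add inner_commute algebra_simps)
    have "\<bar>m\<bar> \<le> 4 * r * s"
    proof -
      have "\<bar>(x - a) \<bullet> v\<bar> \<le> norm (x - a) * norm v" by (rule Cauchy_Schwarz_ineq2)
      also have "\<dots> \<le> 2 * r * s" using xa nv s by (auto intro: mult_right_mono)
      finally show ?thesis by (simp add: m_def)
    qed
    moreover have "s\<^sup>2 \<le> r * s" using s by (simp add: power2_eq_square mult_right_mono)
    ultimately have "\<bar>- m - s\<^sup>2\<bar> \<le> 5 * r * s" "\<bar>m - s\<^sup>2\<bar> \<le> 5 * r * s" using zero_le_power2[of s] by linarith+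
    then have b: "(- m - s\<^sup>2)\<^sup>2 \<le> (5 * r * s)\<^sup>2" "(m - s\<^sup>2)\<^sup>2 \<le> (5 * r * s)\<^sup>2"
      by (metis abs_ge_zero power2_abs power_mono)+
    have "\<theta> (x - v) + \<theta> (x + v) - 2 * \<theta> x \<le> - 4 * max 0 (q x) * s\<^sup>2 + (m - s\<^sup>2)\<^sup>2 + (- m - s\<^sup>2)\<^sup>2"
      using square_positive_part_le[of "q x" "m - s\<^sup>2"] square_positive_part_le[of "q x" "- m - s\<^sup>2"]
      unfolding \<theta>_def qv by (simp add: algebra_simps)
    also have "\<dots> \<le> 0 + (5 * r * s)\<^sup>2 + (5 * r * s)\<^sup>2"
      using b by (intro add_mono) auto
    also have "\<dots> = 50 * r\<^sup>2 * s\<^sup>2" by (simp add: power_mult_distrib)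
    finally show ?thesis using w0[of x] by (simp add: mult_left_mono mult.commute)
  qed (simp add: w_def)
  define C where "C = 50 * r\<^sup>2 * (\<integral>x. w x \<partial>lborel)"
  have dec: "\<theta> x * \<Delta> k x = real k * (\<theta> x * w (x + (1 / real k) *\<^sub>R e)
      + \<theta> x * w (x + - ((1 / real k) *\<^sub>R e)) - 2 * (\<theta> x * w (x + 0)))" for x k
    by (simp add: \<Delta>_def algebra_simps)
  have I: "integrable lborel (\<lambda>x. \<theta> x * \<Delta> k x)" for k
    unfolding dec
    by (intro integrable_mult_right Bochner_Integration.integrable_diff Bochner_Integration.integrable_add ib \<theta>0 \<theta>b)
      measurable
  have Ile: "(\<integral>x. \<theta> x * \<Delta> k x \<partial>lborel) \<le> C / k" if k: "1 / r \<le> real k" for k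
  proof -
    let ?s = "1 / real k"
    have k0: "0 < real k" using k r by (smt (verit) divide_pos_pos)
    have s: "0 \<le> ?s" "?s \<le> r" using k k0 r by (auto simp: field_simps)
    have j: "integrable lborel (\<lambda>x. w x * \<theta> (x + v))" for v
      using ib[of "\<lambda>x. \<theta> (x + v)" 0] \<theta>0 \<theta>b by (simp add: mult.commute)
    have spl: "w x * (\<theta> (x - ?s *\<^sub>R e) + \<theta> (x + ?s *\<^sub>R e) - 2 * \<theta> x)
      = w x * \<theta> (x + - (?s *\<^sub>R e)) + w x * \<theta> (x + ?s *\<^sub>R e) - 2 * (w x * \<theta> (x + 0))" for x
      by (simp add: algebra_simps)
    have "(\<integral>x. \<theta> x * \<Delta> k x \<partial>lborel) = real k * ((\<integral>x. \<theta> x * w (x + ?s *\<^sub>R e) \<partial>lborel)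
        + (\<integral>x. \<theta> x * w (x + - (?s *\<^sub>R e)) \<partial>lborel) - 2 * (\<integral>x. \<theta> x * w (x + 0) \<partial>lborel))"
      unfolding dec using ib[of \<theta> "?s *\<^sub>R e"] ib[of \<theta> "- (?s *\<^sub>R e)"] ib[of \<theta> 0] \<theta>0 \<theta>b by simp
    also have "\<dots> = real k * (\<integral>x. w x * (\<theta> (x - ?s *\<^sub>R e) + \<theta> (x + ?s *\<^sub>R e) - 2 * \<theta> x) \<partial>lborel)"
      unfolding tr spl using j[of "- (?s *\<^sub>R e)"] j[of "?s *\<^sub>R e"] j[of 0] by simp
    also have "\<dots> \<le> real k * (\<integral>x. 50 * r\<^sup>2 * ?s\<^sup>2 * w x \<partial>lborel)"
    proof (intro mult_left_mono integral_mono)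
      show "integrable lborel (\<lambda>x. w x * (\<theta> (x - ?s *\<^sub>R e) + \<theta> (x + ?s *\<^sub>R e) - 2 * \<theta> x))"
        unfolding spl by (intro Bochner_Integration.integrable_diff Bochner_Integration.integrable_add integrable_mult_right j)
    qed (use iw sd[OF refl s] in auto)
    also have "\<dots> = C / k" using k0 by (simp add: C_def power2_eq_square)
    finally show ?thesis .
  qed
  have \<Delta>eq: "\<Delta> k x = real k * (\<phi> (x + (1 / real k) *\<^sub>R e) + \<phi> (x - (1 / real k) *\<^sub>R e) - 2 * \<phi> x)"
    and \<Delta>0: "0 \<le> \<Delta> k x" if k: "1 / r \<le> real k" and x: "x \<in> cball a r" for k x
  proof -
    let ?s = "1 / real k"
    have k0: "0 < real k" using k r by (smt (verit) divide_pos_pos)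
    have s: "0 \<le> ?s" "?s \<le> r" using k k0 r by (auto simp: field_simps)
    have d: "dist a (x + ?s *\<^sub>R e) \<le> 2 * r" "dist a (x - ?s *\<^sub>R e) \<le> 2 * r"
      using x s e norm_triangle_ineq[of "x - a" "?s *\<^sub>R e"] norm_triangle_ineq4[of "x - a" "?s *\<^sub>R e"]
      by (auto simp: dist_norm norm_minus_commute algebra_simps)
    have inB: "x + ?s *\<^sub>R e \<in> ?B" "x - ?s *\<^sub>R e \<in> ?B" "x \<in> ?B" using d x r by auto
    then show eq: "\<Delta> k x = real k * (\<phi> (x + ?s *\<^sub>R e) + \<phi> (x - ?s *\<^sub>R e) - 2 * \<phi> x)"
      by (simp add: \<Delta>_def w_def)
    have mid: "(1 - 1/2) *\<^sub>R (x + ?s *\<^sub>R e) + (1/2) *\<^sub>R (x - ?s *\<^sub>R e) = x"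
      using scaleR_half_double[of x] by (simp add: algebra_simps)
    have "\<phi> x \<le> (1 - 1/2) * \<phi> (x + ?s *\<^sub>R e) + 1/2 * \<phi> (x - ?s *\<^sub>R e)"
      using convex_onD[OF cv, of "1/2" "x + ?s *\<^sub>R e" "x - ?s *\<^sub>R e"] inB by (simp only: mid)
    then show "0 \<le> \<Delta> k x" unfolding eq by (intro mult_nonneg_nonneg) auto
  qed
  have \<theta>\<Delta>: "0 \<le> \<theta> x * \<Delta> k x" if "1 / r \<le> real k" for k x
    using \<Delta>0[OF that, of x] \<theta>0[of x] \<theta>out[of x] 
    by (cases "norm (x - a) \<le> r") (auto simp: dist_norm norm_minus_commute)
  obtain k0 where k0: "1 / r \<le> real k0" using real_arch_simple by blast
  \<comment> \<open>Fatou's lemma makes the lower limit vanish almost everywhere, which yields small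
    second differences for infinitely many \<open>k\<close>; this explains the frequency quantifier
    in the statement.\<close>
  have "(\<integral>\<^sup>+x. liminf (\<lambda>k. ennreal (\<theta> x * \<Delta> k x)) \<partial>lborel) \<le> liminf (\<lambda>k. \<integral>\<^sup>+x. ennreal (\<theta> x * \<Delta> k x) \<partial>lborel)"
    by (rule nn_integral_liminf) (simp add: \<Delta>_def)
  also have "\<dots> \<le> liminf (\<lambda>k. ennreal (C / real k))"
  proof (rule Liminf_mono)
    show "\<forall>\<^sub>F k in sequentially. (\<integral>\<^sup>+x. ennreal (\<theta> x * \<Delta> k x) \<partial>lborel) \<le> ennreal (C / real k)"
      using eventually_ge_at_top[of k0]
    proof eventually_elim
      case (elim k)
      then have k: "1 / r \<le> real k" using k0 by linarith
      then show ?case using I[of k] \<theta>\<Delta>[OF k] Ile[OF k] by (subst nn_integral_eq_integral) (auto intro: ennreal_leI)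
    qed
  qed
  also have "\<dots> = 0"
  proof (rule lim_imp_Liminf)
    show "(\<lambda>k. ennreal (C / real k)) \<longlonglongrightarrow> 0"
      using tendsto_ennrealI[OF lim_const_over_n[of C]] by simp
  qed simp
  finally have "AE x in lborel. liminf (\<lambda>k. ennreal (\<theta> x * \<Delta> k x)) = 0"
    by (subst (asm) le_zero_eq, subst (asm) nn_integral_0_iff_AE) (auto simp: \<Delta>_def)
  then show ?thesis
  proof eventually_elim
    case (elim x)
    show ?case
    proof (intro impI allI)
      fix \<eta> :: real assume x: "x \<in> ball a r" and \<eta>: "0 < \<eta>"
      have "norm (x - a) < r" using x by (simp add: dist_norm norm_minus_commute)
      then have "0 < q x" using power_strict_mono[of "norm (x - a)" r 2] by (simp add: q_def)
      then have c: "0 < \<theta> x" by (simp add: \<theta>_def)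
      have "\<exists>\<^sub>F k in sequentially. ennreal (\<theta> x * \<Delta> k x) < ennreal (\<theta> x * \<eta>)"
      proof (rule ccontr)
        assume "\<not> ?thesis"
        then have "\<forall>\<^sub>F k in sequentially. ennreal (\<theta> x * \<eta>) \<le> ennreal (\<theta> x * \<Delta> k x)"
          by (simp add: not_frequently not_less)
        from Liminf_bounded[OF this] have "ennreal (\<theta> x * \<eta>) \<le> 0" unfolding elim .
        then have "\<theta> x * \<eta> \<le> 0" by (simp add: ennreal_eq_0_iff)
        then show False using mult_pos_pos[OF c \<eta>] by linarith
      qed
      then have "\<exists>\<^sub>F k in sequentially. k0 \<le> k \<and> ennreal (\<theta> x * \<Delta> k x) < ennreal (\<theta> x * \<eta>)"
        using eventually_ge_at_top[of k0] by (rule frequently_eventually_conj)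
      then show "\<exists>\<^sub>F k in sequentially. real k * (\<phi> (x + (1 / real k) *\<^sub>R e) + \<phi> (x - (1 / real k) *\<^sub>R e) - 2 * \<phi> x) < \<eta>"
      proof (rule frequently_elim1)
        fix k assume h: "k0 \<le> k \<and> ennreal (\<theta> x * \<Delta> k x) < ennreal (\<theta> x * \<eta>)"
        then have k: "1 / r \<le> real k" using k0 by linarith
        have xc: "x \<in> cball a r" using x by simp
        have "\<theta> x * \<Delta> k x < \<theta> x * \<eta>" using h ennreal_less_iff[OF \<theta>\<Delta>[OF k]] by blast
        then have lt: "\<Delta> k x < \<eta>" using c by (rule mult_less_cancel_left_pos[THEN iffD1, rotated])
        show "real k * (\<phi> (x + (1 / real k) *\<^sub>R e) + \<phi> (x - (1 / real k) *\<^sub>R e) - 2 * \<phi> x) < \<eta>"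
          using lt by (simp only: \<Delta>eq[OF k xc])
      qed
    qed
  qed
qed

text \<open>Countably many balls whose doubles stay in \<open>U\<close> cover \<open>U\<close>, by
  the Lindelof property.\<close>

lemma AE_second_difference:
  fixes \<phi> :: "'a::euclidean_space \<Rightarrow> real"
  assumes U: "open U" and cv: "convex_on U \<phi>" and e: "norm e = 1"
  shows "AE x in lborel. x \<in> U \<longrightarrow> (\<forall>\<eta>>0. \<exists>\<^sub>F k in sequentially.
    real k * (\<phi> (x + (1 / real k) *\<^sub>R e) + \<phi> (x - (1 / real k) *\<^sub>R e) - 2 * \<phi> x) < \<eta>)"
    (is "AE x in lborel. x \<in> U \<longrightarrow> ?R x")
proof -
  have ct: "continuous_on U \<phi>" using convex_on_continuous[OF U cv] .
  define F where "F = {ball a r | a r. 0 < r \<and> cball a (2 * r) \<subseteq> U}"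
  have op: "\<And>S. S \<in> F \<Longrightarrow> open S" by (auto simp: F_def)
  obtain F' where F': "F' \<subseteq> F" "countable F'" "\<Union>F' = \<Union>F" using Lindelof[OF op] by blast
  have "U \<subseteq> \<Union>F"
  proof
    fix x assume "x \<in> U"
    then obtain s where "0 < s" "cball x s \<subseteq> U" using U by (auto simp: open_contains_cball)
    then have "ball x (s / 2) \<in> F" unfolding F_def by (intro CollectI exI[of _ x] exI[of _ "s / 2"]) auto
    then show "x \<in> \<Union>F" using \<open>0 < s\<close> by (intro UnionI[of "ball x (s / 2)"]) auto
  qed
  have "AE x in lborel. \<forall>S\<in>F'. x \<in> S \<longrightarrow> ?R x"
  proof (subst AE_ball_countable[OF F'(2)], intro ballI)
    fix S assume "S \<in> F'"
    then obtain a r where S: "S = ball a r" "0 < r" "cball a (2 * r) \<subseteq> U" using F'(1) by (auto simp: F_def)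
    show "AE x in lborel. x \<in> S \<longrightarrow> ?R x"
      unfolding S(1)
      by (rule AE_second_difference_ball[OF convex_on_subset[OF cv S(3)] continuous_on_subset[OF ct S(3)] S(2) e])
        (rule convex_cball)
  qed
  then show ?thesis
  proof eventually_elim
    case (elim x)
    show ?case
    proof
      assume "x \<in> U"
      from subsetD[OF \<open>U \<subseteq> \<Union>F\<close> this] have "x \<in> \<Union>F'" by (simp only: F'(3))
      then obtain S where "S \<in> F'" "x \<in> S" by (rule UnionE)
      then show "?R x" using elim by blast
    qed
  qed
qed

section \<open>The transport map of an optimal potential\<close>

locale dual_optimal =
  fixes P Q :: "'a::euclidean_space measure" and \<phi>0 :: "'a \<Rightarrow> ereal"
  assumes P: "prob_space P" and sP: "sets P = sets borel"
    and Q: "prob_space Q" and sQ: "sets Q = sets borel"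
    and dens: "has_positive_density P"
    and nP: "integrable P (\<lambda>x. norm x)"
    and opt: "optimal_transport_potential P Q \<phi>0"
begin

abbreviation \<psi>0 :: "'a \<Rightarrow> ereal" where "\<psi>0 \<equiv> conjugate \<phi>0"

definition \<phi> :: "'a \<Rightarrow> real" where "\<phi> x = real_of_ereal (\<phi>0 x)"

definition \<psi> :: "'a \<Rightarrow> real" where "\<psi> y = real_of_ereal (\<psi>0 y)"

definition U :: "'a set" where "U = interior (convex_support P)"

definition D :: "'a set" where "D = {y. \<psi>0 y \<noteq> \<infinity>}"

lemmas [measurable_cong] = sP sQ

sublocale P: prob_space P by (rule P)
sublocale Q: prob_space Q by (rule Q)

lemma spaceP: "space P = UNIV" and spaceQ: "space Q = UNIV"
  using sets_eq_imp_space_eq[OF sP] sets_eq_imp_space_eq[OF sQ] by auto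

lemma
  shows \<phi>0_not_MInf: "\<phi>0 x \<noteq> -\<infinity>" and \<psi>0_not_MInf: "\<psi>0 y \<noteq> -\<infinity>"
    and young: "ereal (x \<bullet> y) \<le> \<phi>0 x + \<psi>0 y"
    and \<psi>0_meas: "\<psi>0 \<in> borel_measurable Q"
    and \<phi>0_AE: "AE x in P. \<bar>\<phi>0 x\<bar> \<noteq> \<infinity>" and \<psi>0_AE: "AE y in Q. \<bar>\<psi>0 y\<bar> \<noteq> \<infinity>"
    and \<phi>_int: "integrable P \<phi>" and \<psi>_int: "integrable Q \<psi>"
    and conv: "convex_fun \<phi>0"
  using opt by (auto simp: optimal_transport_potential_def dual_pairs_def L1_ereal_def \<phi>_def[abs_def] \<psi>_def[abs_def])

lemma minimal: "(f, g) \<in> dual_pairs P Q \<Longrightarrow> dual_objective P Q \<phi>0 \<psi>0 \<le> dual_objective P Q f g"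
  using opt by (auto simp: optimal_transport_potential_def)

lemma \<phi>_meas[measurable]: "\<phi> \<in> borel_measurable borel"
  using borel_measurable_integrable[OF \<phi>_int] by (simp cong: measurable_cong_sets add: sP)

lemma AE_D: "AE y in Q. y \<in> D"
  using \<psi>0_AE by eventually_elim (auto simp: D_def)

lemma D_nonempty: "D \<noteq> {}"
  using AE_D Q.AE_False by (cases "D = {}") auto

lemma \<psi>0_eq: "y \<in> D \<Longrightarrow> \<psi>0 y = ereal (\<psi> y)"
  using \<psi>0_not_MInf[of y] by (cases "\<psi>0 y") (auto simp: D_def \<psi>_def)

lemma open_U: "open U" and convex_U: "convex U"
  unfolding U_def using convex_convex_support by (auto intro: convex_interior)

lemma AE_U: "AE x in P. x \<in> U"
  unfolding U_def by (rule AE_interior_convex_support[OF dens sP])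

lemma \<phi>0_eq: "x \<in> U \<Longrightarrow> \<phi>0 x = ereal (\<phi> x)"
  using convex_fun_finite_on_interior[OF sP conv \<phi>0_not_MInf \<phi>0_AE, of x] \<phi>0_not_MInf[of x]
  by (cases "\<phi>0 x") (auto simp: U_def \<phi>_def)

lemma convex_on_\<phi>: "convex_on U \<phi>"
  unfolding \<phi>_def using \<phi>0_eq by (intro convex_on_real_of_ereal conv convex_U) auto

lemma continuous_on_\<phi>: "continuous_on U \<phi>"
  by (rule convex_on_continuous[OF open_U convex_on_\<phi>])

lemma young_real: "x \<in> U \<Longrightarrow> y \<in> D \<Longrightarrow> x \<bullet> y \<le> \<phi> x + \<psi> y"
  using young[of x y] by (simp add: \<phi>0_eq \<psi>0_eq)

section \<open>First variation of the dual problem\<close>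

context
  fixes h :: "'a \<Rightarrow> real" and B :: real
  assumes h: "continuous_on UNIV h" and hB: "\<And>y. \<bar>h y\<bar> \<le> B"
begin

text \<open>The least partner of \<open>\<psi>0 + h\<close>: the two form an admissible competitor,
  so the minimality of the optimal pair can be tested in the direction of any bounded continuous
  \<open>h\<close>.\<close>

definition \<Phi> :: "'a \<Rightarrow> ereal" where "\<Phi> = conjugate (\<lambda>y. \<psi>0 y + ereal (h y))"

lemma \<Phi>_lower: "y \<in> D \<Longrightarrow> ereal (x \<bullet> y - \<psi> y - h y) \<le> \<Phi> x"
  unfolding \<Phi>_def conjugate_def[of "\<lambda>y. \<psi>0 y + ereal (h y)"]
  by (rule SUP_upper2[of y]) (auto simp: \<psi>0_eq)

lemma \<Phi>_less: "a < \<Phi> x \<longleftrightarrow> (\<exists>y\<in>D. a < ereal (x \<bullet> y - \<psi> y - h y))"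
proof -
  have "a < ereal (x \<bullet> y) - (\<psi>0 y + ereal (h y)) \<longleftrightarrow> y \<in> D \<and> a < ereal (x \<bullet> y - \<psi> y - h y)" for y
  proof (cases "y \<in> D")
    case True
    then show ?thesis by (simp add: \<psi>0_eq algebra_simps)
  qed (auto simp: D_def)
  then show ?thesis unfolding \<Phi>_def conjugate_def[of "\<lambda>y. \<psi>0 y + ereal (h y)"] less_SUP_iff by auto
qed

lemma \<Phi>_meas[measurable]: "\<Phi> \<in> borel_measurable borel"
proof (rule borel_measurableI_greater)
  fix a :: ereal
  have "{x \<in> space borel. a < \<Phi> x} = (\<Union>y\<in>D. {x. a < ereal (x \<bullet> y - \<psi> y - h y)})"
    unfolding \<Phi>_less by auto
  also have "\<dots> \<in> sets borel"
    by (intro borel_open open_UN ballI open_Collect_less continuous_intros)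
  finally show "{x \<in> space borel. a < \<Phi> x} \<in> sets borel" .
qed

lemma \<Phi>_not_MInf: "\<Phi> x \<noteq> -\<infinity>"
  using D_nonempty \<Phi>_lower[of _ x] by (auto simp: ex_in_conv[symmetric])

lemma \<Phi>_upper: assumes "x \<in> U" shows "\<Phi> x \<le> ereal (\<phi> x + B)"
proof (rule ccontr)
  assume "\<not> ?thesis"
  then obtain y where "y \<in> D" "\<phi> x + B < x \<bullet> y - \<psi> y - h y" by (auto simp: not_le \<Phi>_less)
  then show False using young_real[OF assms, of y] hB[of y] by linarith
qed

lemma \<Phi>_eq: "x \<in> U \<Longrightarrow> \<Phi> x = ereal (real_of_ereal (\<Phi> x))"
  using \<Phi>_upper[of x] \<Phi>_not_MInf[of x] by (cases "\<Phi> x") auto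

lemma \<Phi>_integrable: "integrable P (\<lambda>x. real_of_ereal (\<Phi> x))"
proof -
  obtain y0 where y0: "y0 \<in> D" using D_nonempty by auto
  show ?thesis
  proof (rule Bochner_Integration.integrable_bound)
    show "integrable P (\<lambda>x. \<bar>\<phi> x\<bar> + B + norm x * norm y0 + \<bar>\<psi> y0\<bar>)"
      using \<phi>_int nP by (intro Bochner_Integration.integrable_add integrable_mult_left integrable_abs) auto
    show "AE x in P. norm (real_of_ereal (\<Phi> x)) \<le> norm (\<bar>\<phi> x\<bar> + B + norm x * norm y0 + \<bar>\<psi> y0\<bar>)"
      using AE_U
    proof eventually_elim
      case (elim x)
      have "real_of_ereal (\<Phi> x) \<le> \<phi> x + B" using \<Phi>_upper[OF elim] \<Phi>_eq[OF elim] by (metis ereal_less_eq(3))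
      moreover have "x \<bullet> y0 - \<psi> y0 - h y0 \<le> real_of_ereal (\<Phi> x)"
        using \<Phi>_lower[OF y0, of x] \<Phi>_eq[OF elim] by (metis ereal_less_eq(3))
      moreover have "\<bar>x \<bullet> y0\<bar> \<le> norm x * norm y0" by (rule Cauchy_Schwarz_ineq2)
      ultimately show ?case unfolding real_norm_def using hB[of y0] by linarith
    qed
  qed measurable
qed

text \<open>Minimality against the competitor built from \<open>h\<close>, after the common integral
  of \<open>\<psi>\<close> has been cancelled.\<close>

lemma variation: "(\<integral>x. \<phi> x \<partial>P) \<le> (\<integral>x. real_of_ereal (\<Phi> x) \<partial>P) + (\<integral>y. h y \<partial>Q)"
proof -
  let ?g = "\<lambda>y. \<psi>0 y + ereal (h y)"
  have hm[measurable]: "h \<in> borel_measurable borel" using h by (rule borel_measurable_continuous_onI)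
  have ih: "integrable Q h" by (rule Q.integrable_const_bound[of _ B]) (use hB in auto)
  have [measurable]: "\<psi>0 \<in> borel_measurable Q" by (rule \<psi>0_meas)
  have ge: "AE y in Q. real_of_ereal (?g y) = \<psi> y + h y"
    using \<psi>0_AE by eventually_elim (auto simp: \<psi>_def)
  have ig: "integrable Q (\<lambda>y. real_of_ereal (?g y))" 
    by (subst integrable_cong_AE[OF _ _ ge]) (use \<psi>_int ih in auto)
  have Ig: "(\<integral>y. real_of_ereal (?g y) \<partial>Q) = (\<integral>y. \<psi> y \<partial>Q) + (\<integral>y. h y \<partial>Q)"
    using \<psi>_int ih by (subst integral_cong_AE[OF _ _ ge]) auto
  have "(\<Phi>, ?g) \<in> dual_pairs P Q"
    unfolding dual_pairs_def mem_Collect_eq prod.case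
  proof (intro conjI allI)
    show "\<Phi> \<in> L1_ereal P" unfolding L1_ereal_def
    proof safe
      show "AE x in P. \<bar>\<Phi> x\<bar> \<noteq> \<infinity>" using AE_U
      proof eventually_elim
        case (elim x)
        then have "\<bar>ereal (real_of_ereal (\<Phi> x))\<bar> \<noteq> \<infinity>" by simp
        then show ?case using \<Phi>_eq[OF elim] by metis
      qed
    qed (auto simp: \<Phi>_integrable)
    show "?g \<in> L1_ereal Q" unfolding L1_ereal_def
    proof safe
      show "AE x in Q. \<bar>?g x\<bar> \<noteq> \<infinity>" using \<psi>0_AE by eventually_elim auto
    qed (use ig in auto)
    show "\<Phi> x \<noteq> -\<infinity>" for x by (rule \<Phi>_not_MInf)
    show "?g y \<noteq> -\<infinity>" for y using \<psi>0_not_MInf[of y] by (cases "\<psi>0 y") auto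
    show "ereal (x \<bullet> y) \<le> \<Phi> x + ?g y" for x y
    proof (cases "y \<in> D")
      case True
      then show ?thesis using \<Phi>_lower[OF True, of x] by (cases "\<Phi> x") (auto simp: \<psi>0_eq)
    next
      case False
      then show ?thesis using \<Phi>_not_MInf[of x] by (cases "\<Phi> x") (auto simp: D_def)
    qed
  qed
  from minimal[OF this] show ?thesis
    by (simp add: dual_objective_def Ig \<phi>_def[symmetric] \<psi>_def[symmetric])
qed

end

text \<open>Points \<open>y\<close> that are \<open>c\<close>-subgradients of \<open>\<phi>\<close>
  at \<open>x\<close>, measured by the gap in Young's inequality. The tolerance \<open>c\<close>
  admits near-maximisers of a conjugate, for which equality in Young's inequality is not yet
  known.\<close>

definition contact :: "real \<Rightarrow> 'a \<Rightarrow> 'a \<Rightarrow> bool" where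
  "contact c x y \<longleftrightarrow> y \<in> D \<and> \<phi> x + \<psi> y - x \<bullet> y \<le> c"

lemma contact_mono: "contact c x y \<Longrightarrow> c \<le> c' \<Longrightarrow> contact c' x y"
  by (auto simp: contact_def)

text \<open>For \<open>h = 0\<close> the function \<open>\<Phi>\<close> is the biconjugate, which
  lies below \<open>\<phi>\<close> on \<open>U\<close>. Minimality makes the integrals equal, hence
  the functions agree almost everywhere, and near-maximisers in the biconjugate are
  near-contacts.\<close>

lemma AE_contact: "AE x in P. \<forall>c>0. \<exists>y. contact c x y"
proof -
  let ?F = "\<Phi> (\<lambda>_. 0)"
  have le: "real_of_ereal (?F x) \<le> \<phi> x" if "x \<in> U" for x
    using \<Phi>_upper[of "\<lambda>_. 0" 0 x] \<Phi>_eq[of "\<lambda>_. 0" 0 x] that by (simp, metis ereal_less_eq(3))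
  have i: "integrable P (\<lambda>x. real_of_ereal (?F x))" by (rule \<Phi>_integrable[where B=0]) auto
  have nn: "AE x in P. 0 \<le> \<phi> x - real_of_ereal (?F x)"
    using AE_U by eventually_elim (use le in auto)
  have "(\<integral>x. \<phi> x - real_of_ereal (?F x) \<partial>P) \<le> 0"
    using variation[of "\<lambda>_. 0" 0] i \<phi>_int by simp
  moreover have "0 \<le> (\<integral>x. \<phi> x - real_of_ereal (?F x) \<partial>P)" using nn by (rule integral_nonneg_AE)
  ultimately have "(\<integral>x. \<phi> x - real_of_ereal (?F x) \<partial>P) = 0" by simp
  then have "AE x in P. \<phi> x - real_of_ereal (?F x) = 0"
    using integral_nonneg_eq_0_iff_AE[OF _ nn] i \<phi>_int by simp
  with AE_U show ?thesis
  proof eventually_elim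
    case (elim x)
    have "?F x = ereal (\<phi> x)" using elim \<Phi>_eq[of "\<lambda>_. 0" 0 x] by simp
    show ?case
    proof (intro allI impI)
      fix c :: real assume "0 < c"
      then have "ereal (\<phi> x - c) < ?F x" using \<open>?F x = ereal (\<phi> x)\<close> by simp
      then obtain y where "y \<in> D" "\<phi> x - c < x \<bullet> y - \<psi> y"
        using \<Phi>_less[of "\<lambda>_. 0" 0] by auto
      then show "\<exists>y. contact c x y" by (intro exI[of _ y]) (auto simp: contact_def)
    qed
  qed
qed

section \<open>Points with a unique subgradient\<close>

definition second_difference :: "'a \<Rightarrow> nat \<Rightarrow> 'a \<Rightarrow> real" where
  "second_difference e k x = real k * (\<phi> (x + (1 / real k) *\<^sub>R e) + \<phi> (x - (1 / real k) *\<^sub>R e) - 2 * \<phi> x)"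

text \<open>A stand-in for differentiability of \<open>\<phi>\<close> at \<open>x\<close>: along
  each coordinate direction the forward and backward difference quotients come arbitrarily close for
  some arbitrarily small steps, which pins every subgradient down.\<close>

definition good :: "'a \<Rightarrow> bool" where
  "good x \<longleftrightarrow> x \<in> U \<and> (\<forall>c>0. \<exists>y. contact c x y) \<and>
    (\<forall>e\<in>Basis. \<forall>\<eta>>0. \<exists>\<^sub>F k in sequentially. second_difference e k x < \<eta>)"

lemma AE_good: "AE x in P. good x"
proof -
  have "AE x in P. \<forall>e\<in>Basis. x \<in> U \<longrightarrow> (\<forall>\<eta>>0. \<exists>\<^sub>F k in sequentially. second_difference e k x < \<eta>)"
    unfolding second_difference_def
    by (intro AE_finite_allI finite_Basis has_positive_density_AE[OF dens]
        AE_second_difference[OF open_U convex_on_\<phi>] norm_Basis)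
  with AE_contact AE_U show ?thesis by eventually_elim (auto simp: good_def)
qed

lemma eventually_in_U:
  assumes "x \<in> U"
  shows "\<forall>\<^sub>F k in sequentially. 0 < k \<and> x + (1 / real k) *\<^sub>R e \<in> U \<and> x - (1 / real k) *\<^sub>R e \<in> U"
proof -
  have l: "(\<lambda>k. 1 / real k) \<longlonglongrightarrow> 0" by (rule lim_1_over_n)
  have "(\<lambda>k. x + (1 / real k) *\<^sub>R e) \<longlonglongrightarrow> x + 0 *\<^sub>R e" "(\<lambda>k. x - (1 / real k) *\<^sub>R e) \<longlonglongrightarrow> x - 0 *\<^sub>R e"
    by (intro tendsto_intros l)+
  then have "\<forall>\<^sub>F k in sequentially. x + (1 / real k) *\<^sub>R e \<in> U" "\<forall>\<^sub>F k in sequentially. x - (1 / real k) *\<^sub>R e \<in> U"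
    using topological_tendstoD[OF _ open_U] assms by auto
  with eventually_gt_at_top[of 0] show ?thesis by eventually_elim auto
qed

lemma contact_quotients:
  assumes c: "contact c x y" and k: "0 < k"
  shows "x + (1 / real k) *\<^sub>R e \<in> U \<Longrightarrow> y \<bullet> e \<le> real k * (\<phi> (x + (1 / real k) *\<^sub>R e) - \<phi> x) + real k * c"
    and "x - (1 / real k) *\<^sub>R e \<in> U \<Longrightarrow> real k * (\<phi> x - \<phi> (x - (1 / real k) *\<^sub>R e)) - real k * c \<le> y \<bullet> e"
proof -
  have y: "y \<in> D" "\<phi> x + \<psi> y - x \<bullet> y \<le> c" using c by (auto simp: contact_def)
  {
    assume "x + (1 / real k) *\<^sub>R e \<in> U"
    from young_real[OF this y(1)] y(2) have "(y \<bullet> e) / k \<le> \<phi> (x + (1 / real k) *\<^sub>R e) - \<phi> x + c"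
      by (simp add: inner_add_left inner_commute[of y e])
    then show "y \<bullet> e \<le> real k * (\<phi> (x + (1 / real k) *\<^sub>R e) - \<phi> x) + real k * c"
      using k by (simp add: field_simps)
  next
    assume "x - (1 / real k) *\<^sub>R e \<in> U"
    from young_real[OF this y(1)] y(2) have "\<phi> x - \<phi> (x - (1 / real k) *\<^sub>R e) - c \<le> (y \<bullet> e) / k"
      by (simp add: inner_diff_left inner_commute[of y e])
    then show "real k * (\<phi> x - \<phi> (x - (1 / real k) *\<^sub>R e)) - real k * c \<le> y \<bullet> e"
      using k by (simp add: field_simps)
  }
qed

text \<open>Along a coordinate, one contact lies below the forward quotient and the other above the
  backward quotient, each up to \<open>real k * c\<close>. The two quotients differ by the second
  difference, so one good \<open>k\<close> is chosen first and \<open>c\<close> is made small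
  relative to it.\<close>

lemma contact_close:
  assumes g: "good x" and \<eta>: "0 < \<eta>"
  shows "\<exists>c>0. \<forall>y y'. contact c x y \<longrightarrow> contact c x y' \<longrightarrow> norm (y - y') \<le> \<eta>"
proof -
  have xU: "x \<in> U" using g by (simp add: good_def)
  define \<eta>' where "\<eta>' = \<eta> / real (DIM('a))"
  have \<eta>': "0 < \<eta>'" using \<eta> by (simp add: \<eta>'_def)
  have "\<forall>e\<in>Basis. \<exists>c>0. \<forall>y y'. contact c x y \<longrightarrow> contact c x y' \<longrightarrow> (y - y') \<bullet> e \<le> \<eta>'"
  proof
    fix e :: 'a assume e: "e \<in> Basis"
    have "\<exists>\<^sub>F k in sequentially. second_difference e k x < \<eta>' / 2" using g e half_gt_zero[OF \<eta>'] unfolding good_def by blast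
    from frequently_eventually_frequently[OF this eventually_in_U[OF xU, of e]]
    obtain k where k: "second_difference e k x < \<eta>' / 2" "0 < k"
      "x + (1 / real k) *\<^sub>R e \<in> U" "x - (1 / real k) *\<^sub>R e \<in> U"
      by (auto dest: frequently_ex)
    \<comment> \<open>The two contact errors cost \<open>2 * real k * c = \<eta>' / 2\<close>, and
      the second difference costs the other half of \<open>\<eta>'\<close>.\<close>
    define c where "c = \<eta>' / (4 * real k)"
    have "(y - y') \<bullet> e \<le> \<eta>'" if "contact c x y" "contact c x y'" for y y'
    proof -
      have "real k * c = \<eta>' / 4" using k(2) by (simp add: c_def)
      then show ?thesis
        using contact_quotients(1)[OF that(1) k(2,3)] contact_quotients(2)[OF that(2) k(2,4)] k(1)
        by (simp add: second_difference_def inner_diff_left algebra_simps)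
    qed
    then show "\<exists>c>0. \<forall>y y'. contact c x y \<longrightarrow> contact c x y' \<longrightarrow> (y - y') \<bullet> e \<le> \<eta>'"
      using \<eta>' k(2) by (intro exI[of _ c]) (auto simp: c_def)
  qed
  then obtain C where C: "\<And>e. e \<in> Basis \<Longrightarrow> 0 < C e"
    "\<And>e y y'. e \<in> Basis \<Longrightarrow> contact (C e) x y \<Longrightarrow> contact (C e) x y' \<Longrightarrow> (y - y') \<bullet> e \<le> \<eta>'"
    by (subst (asm) bchoice_iff) blast
  define c where "c = Min (C ` Basis)"
  have c: "0 < c" "\<And>e. e \<in> Basis \<Longrightarrow> c \<le> C e" using C(1) by (auto simp: c_def)
  have "norm (y - y') \<le> \<eta>" if "contact c x y" "contact c x y'" for y y'
  proof -
    have "norm (y - y') \<le> (\<Sum>e\<in>Basis. \<bar>(y - y') \<bullet> e\<bar>)" by (rule norm_le_l1)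
    also have "\<dots> \<le> (\<Sum>e\<in>(Basis :: 'a set). \<eta>')"
    proof (rule sum_mono)
      fix e :: 'a assume e: "e \<in> Basis"
      have "contact (C e) x y" "contact (C e) x y'" using that c(2)[OF e] contact_mono by blast+
      from C(2)[OF e this] C(2)[OF e this(2,1)] show "\<bar>(y - y') \<bullet> e\<bar> \<le> \<eta>'"
        by (simp add: abs_le_iff inner_diff_left)
    qed
    also have "\<dots> = \<eta>" by (simp add: \<eta>'_def)
    finally show ?thesis .
  qed
  then show ?thesis using c(1) by blast
qed

text \<open>Contacts with shrinking tolerance form a Cauchy sequence by
  \<open>contact_close\<close>. The limit is an exact contact because the conjugate is a supremum of
  affine functions, each of which passes to the limit.\<close>

lemma contact_exists:
  assumes g: "good x"
  shows "\<exists>y. contact 0 x y"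
proof -
  have xU: "x \<in> U" using g by (simp add: good_def)
  have "\<forall>m. \<exists>y. contact (1 / real (Suc m)) x y" using g by (simp add: good_def)
  then obtain y where y: "\<And>m. contact (1 / real (Suc m)) x (y m)" by metis
  have "Cauchy y"
  proof (rule metric_CauchyI)
    fix \<eta> :: real assume "0 < \<eta>"
    then obtain c where c: "0 < c" "\<And>z z'. contact c x z \<Longrightarrow> contact c x z' \<Longrightarrow> norm (z - z') \<le> \<eta> / 2"
      using contact_close[OF g, of "\<eta> / 2"] by auto
    obtain N where N: "1 / real (Suc N) < c" using reals_Archimedean[OF c(1)] by (auto simp: inverse_eq_divide)
    have "contact c x (y m)" if "N \<le> m" for m
    proof (rule contact_mono[OF y])
      have "1 / real (Suc m) \<le> 1 / real (Suc N)" using that by (intro divide_left_mono) auto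
      then show "1 / real (Suc m) \<le> c" using N by linarith
    qed
    then have "dist (y m) (y n) < \<eta>" if "N \<le> m" "N \<le> n" for m n
      using c(2)[of "y m" "y n"] that \<open>0 < \<eta>\<close> by (force simp: dist_norm)
    then show "\<exists>M. \<forall>m\<ge>M. \<forall>n\<ge>M. dist (y m) (y n) < \<eta>" by blast
  qed
  then obtain t where t: "y \<longlonglongrightarrow> t" using Cauchy_convergent_iff convergent_def by blast
  have l0: "(\<lambda>m. 1 / real (Suc m)) \<longlonglongrightarrow> 0" by (rule LIMSEQ_Suc[OF lim_1_over_n])
  have "\<psi>0 t \<le> ereal (x \<bullet> t - \<phi> x)"
    unfolding conjugate_def
  proof (rule SUP_least)
    fix z
    show "ereal (t \<bullet> z) - \<phi>0 z \<le> ereal (x \<bullet> t - \<phi> x)"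
    proof (cases "\<phi>0 z")
      case (real r)
      have "t \<bullet> z - r \<le> x \<bullet> t - \<phi> x + 0"
      proof (rule LIMSEQ_le)
        show "(\<lambda>m. y m \<bullet> z - r) \<longlonglongrightarrow> t \<bullet> z - r" by (intro tendsto_intros t)
        show "(\<lambda>m. x \<bullet> y m - \<phi> x + 1 / real (Suc m)) \<longlonglongrightarrow> x \<bullet> t - \<phi> x + 0" by (intro tendsto_intros t l0)
        have "y m \<bullet> z - r \<le> x \<bullet> y m - \<phi> x + 1 / real (Suc m)" for m
        proof -
          have "z \<bullet> y m \<le> r + \<psi> (y m)"
            using young[of z "y m"] y[of m] real by (auto simp: contact_def \<psi>0_eq)
          then show ?thesis using y[of m] by (auto simp: contact_def inner_commute)
        qed
        then show "\<exists>N. \<forall>n\<ge>N. y n \<bullet> z - r \<le> x \<bullet> y n - \<phi> x + 1 / real (Suc n)" by blast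
      qed
      then show ?thesis using real by simp
    qed (use \<phi>0_not_MInf[of z] in auto)
  qed
  then have "t \<in> D" "\<psi> t \<le> x \<bullet> t - \<phi> x"
    using \<psi>0_not_MInf[of t] by (cases "\<psi>0 t"; auto simp: D_def \<psi>_def)+
  then show ?thesis by (intro exI[of _ t]) (auto simp: contact_def)
qed

text \<open>Partial derivatives taken as lower limits along steps \<open>1 / real k\<close>, which
  makes \<open>T\<close> a total Borel function; at good points it is the unique exact
  contact.\<close>

definition T :: "'a \<Rightarrow> 'a" where
  "T x = (\<Sum>e\<in>Basis. real_of_ereal (liminf (\<lambda>k. ereal (real k * (\<phi> (x + (1 / real k) *\<^sub>R e) - \<phi> x)))) *\<^sub>R e)"

lemma T_meas[measurable]: "T \<in> borel_measurable borel"
  unfolding T_def by measurable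

text \<open>Forward quotients never fall below \<open>y \<bullet> e\<close>. Were their lower limit
  larger, they would eventually exceed it by a fixed amount, while the backward quotients stay below
  \<open>y \<bullet> e\<close>; this contradicts the frequently small second differences.\<close>

lemma T_eq:
  assumes g: "good x" and y: "contact 0 x y"
  shows "T x = y"
proof -
  have xU: "x \<in> U" using g by (simp add: good_def)
  have "liminf (\<lambda>k. ereal (real k * (\<phi> (x + (1 / real k) *\<^sub>R e) - \<phi> x))) = ereal (y \<bullet> e)" (is "liminf ?q = _")
    if e: "e \<in> Basis" for e
  proof (rule antisym)
    show "ereal (y \<bullet> e) \<le> liminf ?q"
      by (rule Liminf_bounded, rule eventually_mono[OF eventually_in_U[OF xU, of e]])
        (use contact_quotients(1)[OF y, of _ e] in auto)
    show "liminf ?q \<le> ereal (y \<bullet> e)"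
    proof (rule ccontr)
      assume "\<not> ?thesis"
      then obtain s where s: "ereal (y \<bullet> e) < ereal s" "ereal s < liminf ?q"
        using ereal_dense2[of "ereal (y \<bullet> e)" "liminf ?q"] by (auto simp: not_le)
      have "\<forall>\<^sub>F k in sequentially. ereal s < ?q k" using less_LiminfD[OF s(2)] .
      from eventually_conj[OF this eventually_in_U[OF xU, of e]]
      have ev: "\<forall>\<^sub>F k in sequentially. ereal s < ?q k \<and> 0 < k \<and> x - (1 / real k) *\<^sub>R e \<in> U"
        by (rule eventually_mono) auto
      have "\<exists>\<^sub>F k in sequentially. second_difference e k x < s - y \<bullet> e" using g e s(1) by (simp add: good_def)
      from frequently_eventually_frequently[OF this ev]
      obtain k where k: "second_difference e k x < s - y \<bullet> e" "s < real k * (\<phi> (x + (1 / real k) *\<^sub>R e) - \<phi> x)"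
        "0 < k" "x - (1 / real k) *\<^sub>R e \<in> U"
        by (auto dest: frequently_ex)
      show False using contact_quotients(2)[OF y k(3,4)] k(1,2)
        by (simp add: second_difference_def algebra_simps)
    qed
  qed
  then have "T x = (\<Sum>e\<in>Basis. (y \<bullet> e) *\<^sub>R e)" unfolding T_def by (intro sum.cong) auto
  then show ?thesis by (simp add: euclidean_representation)
qed

lemma contact_T: "good x \<Longrightarrow> contact 0 x (T x)"
  using contact_exists T_eq by metis

text \<open>The optimal pair is perturbed by \<open>h / real (Suc m)\<close>. The scaled change
  \<open>d m x\<close> of the first potential is at most \<open>h (T x)\<close>, since
  \<open>T x\<close> competes in the supremum, and converges to it, since near-maximisers are
  contacts close to \<open>T x\<close>. Dominated convergence in \<open>variation\<close> finishes
  the proof.\<close>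

lemma integral_pushforward_le:
  fixes h :: "'a \<Rightarrow> real"
  assumes h: "continuous_on UNIV h" and hB: "\<And>y. \<bar>h y\<bar> \<le> B"
  shows "(\<integral>x. h (T x) \<partial>P) \<le> (\<integral>y. h y \<partial>Q)"
proof -
  have B0: "0 \<le> B" using hB[of 0] by linarith
  have [measurable]: "h \<in> borel_measurable borel" using h by (rule borel_measurable_continuous_onI)
  define hm where "hm m y = h y / real (Suc m)" for m y
  have hmc: "continuous_on UNIV (hm m)" for m
    unfolding hm_def by (intro continuous_intros h) auto
  have hmB: "\<bar>hm m y\<bar> \<le> B / real (Suc m)" for m y
    using hB[of y] by (simp add: hm_def divide_right_mono)
  define d where "d m x = real (Suc m) * (\<phi> x - real_of_ereal (\<Phi> (hm m) x))" for m x
  note [measurable] = \<Phi>_meas[OF hmc hmB]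
  note \<Phi>i = \<Phi>_integrable[OF hmc hmB]
  have up: "d m x \<le> h (T x)" if g: "good x" for m x
  proof -
    have "x \<in> U" using g by (simp add: good_def)
    have c: "T x \<in> D" "\<phi> x + \<psi> (T x) - x \<bullet> T x \<le> 0" using contact_T[OF g] by (auto simp: contact_def)
    have "x \<bullet> T x - \<psi> (T x) - hm m (T x) \<le> real_of_ereal (\<Phi> (hm m) x)"
      using \<Phi>_lower[OF hmc[of m] hmB[of m] c(1), of x] \<Phi>_eq[OF hmc hmB \<open>x \<in> U\<close>, of m] by (metis ereal_less_eq(3))
    then have "\<phi> x - real_of_ereal (\<Phi> (hm m) x) \<le> h (T x) / real (Suc m)" using c(2) by (simp add: hm_def)
    then show ?thesis by (simp add: d_def field_simps)
  qed
  have lo: "- B \<le> d m x" if "x \<in> U" for m x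
  proof -
    have "real_of_ereal (\<Phi> (hm m) x) \<le> \<phi> x + B / real (Suc m)"
      using \<Phi>_upper[OF hmc hmB that, of m] \<Phi>_eq[OF hmc hmB that, of m] by (metis ereal_less_eq(3))
    then have "- (B / real (Suc m)) \<le> \<phi> x - real_of_ereal (\<Phi> (hm m) x)" by simp
    then show ?thesis by (simp add: d_def field_simps)
  qed
  have lim: "(\<lambda>m. d m x) \<longlonglongrightarrow> h (T x)" if g: "good x" for x
  proof (rule LIMSEQ_I)
    fix \<eta> :: real assume \<eta>: "0 < \<eta>"
    have xU: "x \<in> U" using g by (simp add: good_def)
    obtain \<delta> where \<delta>: "0 < \<delta>" "\<And>y. dist y (T x) < \<delta> \<Longrightarrow> dist (h y) (h (T x)) < \<eta> / 2"
      using h \<eta> unfolding continuous_on_iff by (metis UNIV_I half_gt_zero)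
    obtain c where c: "0 < c" "\<And>y y'. contact c x y \<Longrightarrow> contact c x y' \<Longrightarrow> norm (y - y') \<le> \<delta> / 2"
      using contact_close[OF g, of "\<delta> / 2"] \<delta>(1) by auto
    \<comment> \<open>The second entry of the minimum keeps the contact gap
      \<open>(2 * B + 1) / ?k\<close> of a near-maximiser below \<open>c\<close>.\<close>
    define \<epsilon> where "\<epsilon> = min (\<eta> / 2) (c / (2 * B + 1))"
    have "0 < \<epsilon>" using \<eta> c(1) B0 by (auto simp: \<epsilon>_def)
    then obtain N where N: "1 / real (Suc N) < \<epsilon>" using reals_Archimedean by (auto simp: inverse_eq_divide)
    have "norm (d m x - h (T x)) < \<eta>" if m: "N \<le> m" for m
    proof -
      let ?k = "real (Suc m)"
      have k: "0 < ?k" "1 \<le> ?k" by auto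
      have "1 / ?k \<le> 1 / real (Suc N)" using m by (intro divide_left_mono) auto
      then have k2: "1 / ?k < \<epsilon>" using N by linarith
      then have k3: "1 / ?k < \<eta> / 2" "(2 * B + 1) / ?k \<le> c"
        using B0 k by (auto simp: \<epsilon>_def field_simps)
      \<comment> \<open>The maximiser is approximated up to \<open>1 / ?k\<^sup>2\<close>, because
        the error is later multiplied by \<open>?k\<close>.\<close>
      have "ereal (real_of_ereal (\<Phi> (hm m) x) - 1 / ?k\<^sup>2) < \<Phi> (hm m) x"
        using \<Phi>_eq[OF hmc hmB xU, of m] k(1) by (metis diff_less_eq ereal_less(2) less_ereal.simps(1) less_add_same_cancel1 zero_less_divide_1_iff zero_less_power)
      then obtain y where y: "y \<in> D" "real_of_ereal (\<Phi> (hm m) x) - 1 / ?k\<^sup>2 < x \<bullet> y - \<psi> y - hm m y"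
        unfolding \<Phi>_less[OF hmc hmB] by auto
      have sq: "1 / ?k\<^sup>2 \<le> 1 / ?k" using k by (intro divide_left_mono) (auto simp: power2_eq_square)
      have dx: "\<phi> x - real_of_ereal (\<Phi> (hm m) x) = d m x / ?k" by (simp add: d_def)
      have "d m x / ?k \<le> B / ?k" using up[OF g, of m] hB[of "T x"] k by (intro divide_right_mono) linarith+
      moreover have "- hm m y \<le> B / ?k" using hmB[of m y] by linarith
      ultimately have "\<phi> x + \<psi> y - x \<bullet> y \<le> B / ?k + 1 / ?k + B / ?k" using y(2) dx sq by linarith
      also have "\<dots> = (2 * B + 1) / ?k" by (simp add: add_divide_distrib)
      finally have "contact c x y" using y(1) k3(2) by (auto simp: contact_def)
      then have "norm (y - T x) \<le> \<delta> / 2" using c(2) contact_mono[OF contact_T[OF g], of c] c(1) by simp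
      then have hy: "\<bar>h y - h (T x)\<bar> < \<eta> / 2" using \<delta>(2)[of y] \<delta>(1) by (auto simp: dist_norm)
      have "hm m y - 1 / ?k\<^sup>2 \<le> d m x / ?k" using y young_real[OF xU y(1)] dx by linarith
      then have "?k * (hm m y - 1 / ?k\<^sup>2) \<le> ?k * (d m x / ?k)" using k by (intro mult_left_mono) auto
      moreover have "?k * (hm m y - 1 / ?k\<^sup>2) = h y - 1 / ?k"
        using k by (simp add: hm_def right_diff_distrib power2_eq_square)
      moreover have "?k * (d m x / ?k) = d m x" using k by simp
      ultimately have "h y - 1 / ?k \<le> d m x" by linarith
      then show ?thesis using up[OF g, of m] hy k3(1) unfolding real_norm_def by linarith
    qed
    then show "\<exists>no. \<forall>n\<ge>no. norm (d n x - h (T x)) < \<eta>" by blast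
  qed
  have "(\<lambda>m. \<integral>x. d m x \<partial>P) \<longlonglongrightarrow> (\<integral>x. h (T x) \<partial>P)"
  proof (rule integral_dominated_convergence[where w="\<lambda>_. B"])
    show "AE x in P. (\<lambda>m. d m x) \<longlonglongrightarrow> h (T x)" using AE_good by eventually_elim (rule lim)
    show "AE x in P. norm (d m x) \<le> B" for m
      using AE_good
    proof eventually_elim
      case (elim x)
      then have "x \<in> U" by (simp add: good_def)
      show ?case using up[OF elim, of m] lo[OF \<open>x \<in> U\<close>, of m] hB[of "T x"] by (simp add: abs_le_iff)
    qed
  qed (auto simp: d_def)
  moreover have "(\<integral>x. d m x \<partial>P) \<le> (\<integral>y. h y \<partial>Q)" for m
  proof -
    have "(\<integral>x. \<phi> x \<partial>P) \<le> (\<integral>x. real_of_ereal (\<Phi> (hm m) x) \<partial>P) + (\<integral>y. h y \<partial>Q) / real (Suc m)"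
    proof -
      have "(\<integral>y. hm m y \<partial>Q) = (\<integral>y. h y \<partial>Q) / real (Suc m)" by (simp add: hm_def)
      then show ?thesis using variation[OF hmc hmB, of m] by simp
    qed
    then have "(\<integral>x. \<phi> x \<partial>P) - (\<integral>x. real_of_ereal (\<Phi> (hm m) x) \<partial>P) \<le> (\<integral>y. h y \<partial>Q) / real (Suc m)" by simp
    then have "real (Suc m) * ((\<integral>x. \<phi> x \<partial>P) - (\<integral>x. real_of_ereal (\<Phi> (hm m) x) \<partial>P)) \<le> (\<integral>y. h y \<partial>Q)"
      by (simp add: field_simps)
    then show ?thesis unfolding d_def using \<phi>_int \<Phi>i[of m] by simp
  qed
  ultimately show ?thesis by (intro LIMSEQ_le_const2) auto
qed

text \<open>Applying the inequality to \<open>h\<close> and to \<open>- h\<close> gives equal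
  integrals of bounded continuous functions. Indicators of closed sets are limits of such functions
  of the distance, and the closed sets are a generator stable under intersection.\<close>

lemma distr_T: "distr P borel T = Q"
proof -
  have fin: "emeasure (distr P borel T) UNIV \<noteq> \<infinity>"
    using prob_space.emeasure_space_1[OF P.prob_space_distr[of T borel]] by simp
  have sb: "sets (borel :: 'a measure) = sigma_sets UNIV (Collect closed)" by (simp add: borel_eq_closed)
  show ?thesis
  proof (rule measure_eqI_generator_eq[where E="Collect closed" and \<Omega>=UNIV and A="\<lambda>_. UNIV"])
    have eq: "(\<integral>x. h (T x) \<partial>P) = (\<integral>y. h y \<partial>Q)"
      if h: "continuous_on UNIV h" and hB: "\<And>y. \<bar>h y\<bar> \<le> B" for h :: "'a \<Rightarrow> real" and B
    proof (rule antisym)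
      show "(\<integral>x. h (T x) \<partial>P) \<le> (\<integral>y. h y \<partial>Q)" by (rule integral_pushforward_le[OF h hB])
      have "(\<integral>x. - h (T x) \<partial>P) \<le> (\<integral>y. - h y \<partial>Q)"
        by (rule integral_pushforward_le[where B=B]) (use h hB in \<open>auto intro!: continuous_intros\<close>)
      then show "(\<integral>y. h y \<partial>Q) \<le> (\<integral>x. h (T x) \<partial>P)" by simp
    qed
    fix A :: "'a set" assume "A \<in> Collect closed"
    then have A: "closed A" by simp
    show "emeasure (distr P borel T) A = emeasure Q A"
    proof (cases "A = {}")
      case False
      define h where "h m y = max 0 (1 - real m * infdist y A)" for m y
      have hc: "continuous_on UNIV (h m)" for m unfolding h_def by (intro continuous_intros)
      have h1: "0 \<le> h m y" "h m y \<le> 1" for m y using infdist_nonneg[of y A] by (auto simp: h_def)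
      have hb: "\<bar>h m y\<bar> \<le> 1" for m y using h1[of m y] by simp
      have lim: "(\<lambda>m. h m y) \<longlonglongrightarrow> indicator A y" for y
      proof (cases "y \<in> A")
        case True
        then show ?thesis by (simp add: h_def)
      next
        case y: False
        have i: "0 < infdist y A" using infdist_pos_not_in_closed[OF A False y] .
        obtain m0 where m0: "1 / infdist y A \<le> real m0" using real_arch_simple by blast
        have "h m y = indicator A y" if "m0 \<le> m" for m
        proof -
          have "1 / infdist y A \<le> real m" using m0 that by linarith
          then have "1 \<le> real m * infdist y A" using i by (simp add: field_simps)
          then show ?thesis using y by (simp add: h_def)
        qed
        then show ?thesis by (intro tendsto_eventually) (auto simp: eventually_sequentially)
      qed
      have [measurable]: "A \<in> sets borel" "h m \<in> borel_measurable borel" for m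
        using A hc by (auto intro: borel_measurable_continuous_onI)
      have "(\<lambda>m. \<integral>x. h m (T x) \<partial>P) \<longlonglongrightarrow> (\<integral>x. indicator A (T x) \<partial>P)"
        by (rule integral_dominated_convergence[where w="\<lambda>_. 1"]) (use lim hb in auto)
      moreover have "(\<lambda>m. \<integral>y. h m y \<partial>Q) \<longlonglongrightarrow> (\<integral>y. indicator A y \<partial>Q)"
        by (rule integral_dominated_convergence[where w="\<lambda>_. 1"]) (use lim hb in auto)
      ultimately have "(\<integral>x. indicator A (T x) \<partial>P) = (\<integral>y. indicator A y \<partial>Q :: real)"
        using eq[OF hc hb] by (auto intro: LIMSEQ_unique)
      moreover have "(\<integral>x. indicator A (T x) \<partial>P) = (measure (distr P borel T) A :: real)"
        by (subst integral_distr[symmetric, of T P borel]) auto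
      ultimately have m: "measure (distr P borel T) A = measure Q A" by (simp add: spaceQ)
      interpret D: prob_space "distr P borel T" by (rule P.prob_space_distr) simp
      show ?thesis using m by (simp add: D.emeasure_eq_measure Q.emeasure_eq_measure)
    qed simp
  qed (use fin sb sQ in \<open>auto simp: Int_stable_def\<close>)
qed

end

section \<open>The duality gap of the sample\<close>

lemma square_sum_le:
  fixes f :: "'i \<Rightarrow> real"
  shows "(\<Sum>i\<in>I. f i)\<^sup>2 \<le> card I * (\<Sum>i\<in>I. (f i)\<^sup>2)"
  using Cauchy_Schwarz_ineq_sum[of f "\<lambda>_. 1" I] by (simp add: mult.commute)

text \<open>Cauchy-Schwarz on four terms, used twice, which gives
  \<open>4\<^sup>2 * 4 = 64\<close>.\<close>

lemma power4_sum_le: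
  fixes a b c d :: real
  shows "(a + b + c + d)^4 \<le> 64 * (a^4 + b^4 + c^4 + d^4)"
proof -
  have "(a + b + c + d)\<^sup>2 \<le> 4 * (a\<^sup>2 + b\<^sup>2 + c\<^sup>2 + d\<^sup>2)"
    using square_sum_le[of "\<lambda>i. [a, b, c, d] ! i" "{..<4}"] by (simp add: eval_nat_numeral)
  then have "((a + b + c + d)\<^sup>2)\<^sup>2 \<le> (4 * (a\<^sup>2 + b\<^sup>2 + c\<^sup>2 + d\<^sup>2))\<^sup>2" by (intro power_mono) auto
  also have "\<dots> = 16 * (a\<^sup>2 + b\<^sup>2 + c\<^sup>2 + d\<^sup>2)\<^sup>2" by (simp only: power_mult_distrib) simp
  also have "(a\<^sup>2 + b\<^sup>2 + c\<^sup>2 + d\<^sup>2)\<^sup>2 \<le> 4 * ((a\<^sup>2)\<^sup>2 + (b\<^sup>2)\<^sup>2 + (c\<^sup>2)\<^sup>2 + (d\<^sup>2)\<^sup>2)"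
    using square_sum_le[of "\<lambda>i. [a\<^sup>2, b\<^sup>2, c\<^sup>2, d\<^sup>2] ! i" "{..<4}"]
    by (simp add: eval_nat_numeral)
  finally show ?thesis by (simp flip: power_mult)
qed

lemma (in prob_space) integrable_power_of_powr:
  fixes f :: "'a \<Rightarrow> real"
  assumes [measurable]: "f \<in> borel_measurable M" and f0: "\<And>x. 0 \<le> f x"
    and i: "integrable M (\<lambda>x. f x powr q)" and k: "real k \<le> q"
  shows "integrable M (\<lambda>x. f x ^ k)"
proof (rule Bochner_Integration.integrable_bound)
  show "integrable M (\<lambda>x. 1 + f x powr q)" using i by simp
  show "AE x in M. norm (f x ^ k) \<le> norm (1 + f x powr q)"
  proof (rule AE_I2)
    fix x
    have "f x ^ k \<le> 1 + f x powr q"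
    proof (cases "f x \<le> 1")
      case True
      then show ?thesis using f0[of x] power_le_one[of "f x" k] by (simp add: add_increasing2)
    next
      case False
      then have "f x ^ k \<le> f x powr q" using k powr_mono[of "real k" q "f x"] by (simp add: powr_realpow)
      then show ?thesis by simp
    qed
    then show "norm (f x ^ k) \<le> norm (1 + f x powr q)" using f0[of x] by (simp add: abs_of_nonneg add_nonneg_nonneg)
  qed
qed measurable

locale sampling = dual_optimal +
  fixes q :: real
  assumes q: "4 < q" and iPq: "integrable P (\<lambda>x. norm x powr q)" and iQq: "integrable Q (\<lambda>y. norm y powr q)"
begin

lemma P_moment: "k \<le> 4 \<Longrightarrow> integrable P (\<lambda>x. norm x ^ k)"
  using q by (intro P.integrable_power_of_powr[OF _ _ iPq]) auto

lemma Q_moment: "k \<le> 4 \<Longrightarrow> integrable Q (\<lambda>x. norm x ^ k)"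
  using q by (intro Q.integrable_power_of_powr[OF _ _ iQq]) auto

lemma nQ: "integrable Q (\<lambda>y. norm y)" using Q_moment[of 1] by simp

lemma
  assumes [measurable]: "f \<in> borel_measurable borel"
  shows integrable_T: "integrable P (\<lambda>x. f (T x)) \<longleftrightarrow> integrable Q f"
    and integral_T: "(\<integral>x. f (T x) \<partial>P) = (\<integral>y. (f y :: real) \<partial>Q)"
    and nn_integral_T: "\<And>h. h \<in> borel_measurable borel \<Longrightarrow> (\<integral>\<^sup>+x. h (T x) \<partial>P) = (\<integral>\<^sup>+y. h y \<partial>Q)"
  using integrable_distr_eq[of T P borel f] integral_distr[of T P borel f] nn_integral_distr[of T P borel]
  by (simp_all add: distr_T)

lemma T_powr: "integrable P (\<lambda>x. norm (T x) powr q)"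
  using integrable_T[of "\<lambda>y. norm y powr q"] iQq by simp

lemma T_moment: "k \<le> 4 \<Longrightarrow> integrable P (\<lambda>x. norm (T x) ^ k)"
  using integrable_T[of "\<lambda>y. norm y ^ k"] Q_moment by simp

lemma good_U: "good x \<Longrightarrow> x \<in> U" by (simp add: good_def)

lemma contact_T_eq: assumes "good x" shows "T x \<in> D" "\<phi> x + \<psi> (T x) = x \<bullet> T x"
  using contact_T[OF assms] young_real[OF good_U[OF assms], of "T x"] by (auto simp: contact_def)

lemma subgradient_T:
  assumes "good x" "z \<in> U"
  shows "\<phi> x - \<phi> z \<le> T x \<bullet> (x - z)"
  using contact_T_eq[OF assms(1)] young_real[OF assms(2), of "T x"]
  by (simp add: inner_diff_right inner_commute[of "T x"])

lemma \<psi>_meas: "\<psi> \<in> borel_measurable borel"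
  using borel_measurable_integrable[OF \<psi>_int] by (simp cong: measurable_cong_sets add: sQ)

text \<open>Equality in Young's inequality at the pair \<open>(x, T x)\<close> is integrated;
  \<open>T\<close> carries \<open>P\<close> to \<open>Q\<close>.\<close>

lemma duality: "integrable P (\<lambda>x. x \<bullet> T x)" "(\<integral>x. x \<bullet> T x \<partial>P) = (\<integral>x. \<phi> x \<partial>P) + (\<integral>y. \<psi> y \<partial>Q)"
proof -
  note [measurable] = \<psi>_meas
  have i: "integrable P (\<lambda>x. \<psi> (T x))" "(\<integral>x. \<psi> (T x) \<partial>P) = (\<integral>y. \<psi> y \<partial>Q)"
    using integrable_T[of \<psi>] integral_T[of \<psi>] \<psi>_int by auto
  have e: "AE x in P. \<phi> x + \<psi> (T x) = x \<bullet> T x" using AE_good by eventually_elim (rule contact_T_eq)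
  show "integrable P (\<lambda>x. x \<bullet> T x)"
    by (rule integrable_cong_AE_imp[OF _ _ e]) (use i \<phi>_int in auto)
  have "(\<integral>x. x \<bullet> T x \<partial>P) = (\<integral>x. \<phi> x + \<psi> (T x) \<partial>P)"
    by (rule integral_cong_AE) (use e in \<open>auto elim: eventually_mono\<close>)
  then show "(\<integral>x. x \<bullet> T x \<partial>P) = (\<integral>x. \<phi> x \<partial>P) + (\<integral>y. \<psi> y \<partial>Q)" using i \<phi>_int by simp
qed

text \<open>Subgradient inequalities at \<open>x\<close> and at a fixed good \<open>x0\<close>
  confine \<open>\<phi> x\<close> by the square of a sum of norms. Squaring gives a fourth power,
  integrable in \<open>x\<close> by assumption and in \<open>T x\<close> because \<open>T\<close>
  carries \<open>P\<close> to \<open>Q\<close>.\<close>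

lemma \<phi>_square: "integrable P (\<lambda>x. (\<phi> x)\<^sup>2)"
proof -
  have "\<exists>x. good x"
  proof (rule ccontr)
    assume "\<not> ?thesis"
    then have "AE x in P. False" using AE_good by simp
    then show False using P.AE_False by blast
  qed
  then obtain x0 where x0: "good x0" by blast
  define S where "S x = norm (T x) + norm (T x0) + norm x + norm x0" for x
  show ?thesis
  proof (rule Bochner_Integration.integrable_bound)
    show "integrable P (\<lambda>x. 2 * (\<phi> x0)\<^sup>2 + 2 * (64 * (norm (T x)^4 + norm (T x0)^4 + norm x^4 + norm x0^4)))"
      using P_moment[of 4] T_moment[of 4] by (intro Bochner_Integration.integrable_add integrable_mult_right) auto
    show "AE x in P. norm ((\<phi> x)\<^sup>2) \<le> norm (2 * (\<phi> x0)\<^sup>2 + 2 * (64 * (norm (T x)^4 + norm (T x0)^4 + norm x^4 + norm x0^4)))"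
      using AE_good
    proof eventually_elim
      case (elim x)
      have S0: "0 \<le> S x" by (simp add: S_def)
      have t: "norm (T w) * norm (x - x0) \<le> (S x)\<^sup>2" if "w = x \<or> w = x0" for w
      proof -
        have "norm (T w) \<le> S x" using that by (auto simp: S_def)
        moreover have "norm (x - x0) \<le> S x" using norm_triangle_ineq4[of x x0] norm_ge_zero[of "T x"] norm_ge_zero[of "T x0"] unfolding S_def by linarith
        ultimately show ?thesis unfolding power2_eq_square by (intro mult_mono S0) auto
      qed
      have "\<phi> x - \<phi> x0 \<le> (S x)\<^sup>2"
        using subgradient_T[OF elim good_U[OF x0]] norm_cauchy_schwarz[of "T x" "x - x0"] t[of x, OF disjI1[OF refl]] by linarith
      moreover have "\<phi> x0 - \<phi> x \<le> (S x)\<^sup>2"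
        using subgradient_T[OF x0 good_U[OF elim]] norm_cauchy_schwarz[of "T x0" "x0 - x"] t[of x0, OF disjI2[OF refl]]
        by (simp add: norm_minus_commute)
      ultimately have "\<bar>\<phi> x\<bar> \<le> \<bar>\<phi> x0\<bar> + (S x)\<^sup>2" by linarith
      then have "\<bar>\<phi> x\<bar>\<^sup>2 \<le> (\<bar>\<phi> x0\<bar> + (S x)\<^sup>2)\<^sup>2" by (intro power_mono) auto
      also have "\<dots> \<le> 2 * (\<phi> x0)\<^sup>2 + 2 * ((S x)\<^sup>2)\<^sup>2"
        using zero_le_power2[of "\<bar>\<phi> x0\<bar> - (S x)\<^sup>2"] by (simp add: power2_sum power2_diff)
      also have "((S x)\<^sup>2)\<^sup>2 = S x ^ 4" by (simp flip: power_mult)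
      also have "S x ^ 4 \<le> 64 * (norm (T x)^4 + norm (T x0)^4 + norm x^4 + norm x0^4)"
        unfolding S_def by (rule power4_sum_le)
      finally have "(\<phi> x)\<^sup>2 \<le> 2 * (\<phi> x0)\<^sup>2 + 2 * (64 * (norm (T x)^4 + norm (T x0)^4 + norm x^4 + norm x0^4))" by simp
      then show ?case by (simp add: abs_of_nonneg)
    qed
  qed measurable
qed

section \<open>Functionals of the sample\<close>

abbreviation sample :: "nat \<Rightarrow> (nat \<Rightarrow> 'a) measure" where "sample n \<equiv> PiM {1..n} (\<lambda>_. P)"

definition V :: "nat \<Rightarrow> (nat \<Rightarrow> 'a) \<Rightarrow> real" where
  "V n x = max_correlation n Q x - (\<Sum>j=1..n. \<phi> (x j))"

text \<open>The duality gap, per sample point, of the population potentials in the problem between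
  the empirical measure and \<open>Q\<close>.\<close>

definition excess :: "nat \<Rightarrow> (nat \<Rightarrow> 'a) \<Rightarrow> real" where
  "excess n x = (\<integral>y. \<psi> y \<partial>Q) - V n x / n"

lemma prob_sample: "prob_space (sample n)"
  by (intro prob_space_PiM P)

lemma sets_sample[measurable_cong]: "sets (sample n) = sets (PiM {1..n} (\<lambda>_. borel))"
  by (intro sets_PiM_cong) (auto simp: sP)

lemma component_meas:
  assumes "h \<in> borel_measurable borel" "j \<in> {1..n}"
  shows "(\<lambda>x. h (x j)) \<in> borel_measurable (sample n)"
proof -
  have c: "(\<lambda>x. x j) \<in> sample n \<rightarrow>\<^sub>M P" using assms(2) by simp
  have "h \<in> borel_measurable P" using assms(1) by (simp cong: measurable_cong_sets add: sP)
  then show ?thesis by (rule measurable_compose[OF c])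
qed

lemma V_meas[measurable]: "V n \<in> borel_measurable (sample n)"
proof -
  have [measurable]: "max_correlation n Q \<in> borel_measurable (sample n)"
    using borel_measurable_max_correlation[OF Q sQ nQ] by (subst measurable_cong_sets[OF sets_sample refl])
  have [measurable]: "(\<lambda>x. \<Sum>j=1..n. \<phi> (x j)) \<in> borel_measurable (sample n)"
    by (intro borel_measurable_sum component_meas \<phi>_meas)
  show ?thesis unfolding V_def by measurable
qed

lemma excess_meas[measurable]: "excess n \<in> borel_measurable (sample n)"
  unfolding excess_def by measurable

lemma V_square: "integrable (sample n) (\<lambda>x. (V n x)\<^sup>2)"
proof -
  define C where "C = n * (\<integral>y. norm y \<partial>Q)"
  have C0: "0 \<le> C" by (auto simp: C_def intro!: mult_nonneg_nonneg integral_nonneg_AE)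
  define B where "B x = 2 * C\<^sup>2 * (n * (\<Sum>j=1..n. (norm (x j))\<^sup>2)) + 2 * (n * (\<Sum>j=1..n. (\<phi> (x j))\<^sup>2))" for x
  have "integrable (sample n) B"
    unfolding B_def
    by (intro Bochner_Integration.integrable_add integrable_mult_right Bochner_Integration.integrable_sum
        P.integrable_PiM_component \<phi>_square P_moment) auto
  moreover have "(V n x)\<^sup>2 \<le> B x" for x
  proof -
    have s: "(u + v)\<^sup>2 \<le> 2 * u\<^sup>2 + 2 * v\<^sup>2" for u v :: real
      using zero_le_power2[of "u - v"] by (simp add: power2_sum power2_diff)
    have "(V n x)\<^sup>2 \<le> 2 * (max_correlation n Q x)\<^sup>2 + 2 * (\<Sum>j=1..n. \<phi> (x j))\<^sup>2"
      using s[of "max_correlation n Q x" "- (\<Sum>j=1..n. \<phi> (x j))"] by (simp add: V_def)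
    also have "(max_correlation n Q x)\<^sup>2 \<le> ((\<Sum>j=1..n. norm (x j)) * C)\<^sup>2"
      using power_mono[OF abs_max_correlation_le[OF Q sQ nQ, of n x], of 2] by (simp add: C_def)
    also have "\<dots> = C\<^sup>2 * (\<Sum>j=1..n. norm (x j))\<^sup>2" by (simp add: power_mult_distrib)
    also have "\<dots> \<le> C\<^sup>2 * (n * (\<Sum>j=1..n. (norm (x j))\<^sup>2))"
      using square_sum_le[of "\<lambda>j. norm (x j)" "{1..n}"] by (intro mult_left_mono) auto
    also have "(\<Sum>j=1..n. \<phi> (x j))\<^sup>2 \<le> n * (\<Sum>j=1..n. (\<phi> (x j))\<^sup>2)"
      using square_sum_le[of "\<lambda>j. \<phi> (x j)" "{1..n}"] by simp
    finally show ?thesis by (simp add: B_def)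
  qed
  ultimately show ?thesis
  proof (elim Bochner_Integration.integrable_bound, goal_cases)
    case 2
    then show ?case by (intro AE_I2) (metis abs_ge_self abs_of_nonneg order_trans real_norm_def zero_le_power2)
  qed measurable
qed

definition frequency :: "'a set \<Rightarrow> nat \<Rightarrow> (nat \<Rightarrow> 'a) \<Rightarrow> real" where
  "frequency A n x = (\<Sum>j=1..n. indicator A (x j)) / real n"

definition deviates :: "('a \<Rightarrow> real) \<Rightarrow> real \<Rightarrow> nat \<Rightarrow> (nat \<Rightarrow> 'a) set" where
  "deviates h g n = {x \<in> space (sample n). g \<le> \<bar>(\<Sum>j\<in>{1..n}. h (x j)) / real n - (\<integral>x. h x \<partial>P)\<bar>}"

lemma deviates_sets[measurable]:
  assumes [measurable]: "h \<in> borel_measurable borel"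
  shows "deviates h g n \<in> sets (sample n)"
proof -
  have [measurable]: "(\<lambda>x. \<Sum>j\<in>{1..n}. h (x j)) \<in> borel_measurable (sample n)"
    by (intro borel_measurable_sum component_meas) measurable
  show ?thesis unfolding deviates_def by measurable
qed

lemma deviates_tendsto:
  assumes "h \<in> borel_measurable borel" "integrable P (\<lambda>x. (h x)\<^sup>2)" "0 < g"
  shows "(\<lambda>n. measure (sample n) (deviates h g n)) \<longlonglongrightarrow> 0"
  unfolding deviates_def
  by (rule P.weak_law_of_large_numbers) (use assms in auto)

lemma deviates_indicator_tendsto:
  assumes "A \<in> sets borel" "0 < g"
  shows "(\<lambda>n. measure (sample n) (deviates (indicator A) g n)) \<longlonglongrightarrow> 0"
proof (rule deviates_tendsto)
  show "integrable P (\<lambda>x. (indicator A x)\<^sup>2 :: real)"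
    by (rule P.integrable_const_bound[of _ 1]) (use assms(1) in \<open>auto simp: indicator_def\<close>)
qed (use assms in auto)

lemma not_deviates:
  "x \<in> space (sample n) \<Longrightarrow> x \<notin> deviates h g n \<Longrightarrow> \<bar>(\<Sum>j=1..n. h (x j)) / real n - (\<integral>x. h x \<partial>P)\<bar> < g"
  by (simp add: deviates_def)

end

section \<open>Coupling the sample to the population through a finite partition\<close>

lemma norm_diff_square_le: "(norm (x - y))\<^sup>2 \<le> 2 * (norm x)\<^sup>2 + 2 * (norm (y :: 'a::real_inner))\<^sup>2"
  using zero_le_power2[of "norm (x + y)"]
  by (simp add: power2_norm_eq_inner inner_diff inner_add inner_commute algebra_simps)

context sampling
begin

text \<open>The density with respect to \<open>P\<close> of the mass given to position
  \<open>j\<close>. The second summand stays nonnegative only if \<open>\<theta>\<close> times each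
  cell frequency is at most the cell mass, which random frequencies satisfy with some
  \<open>\<theta>\<close> slightly below 1.\<close>

definition reweighting :: "real \<Rightarrow> ('a \<Rightarrow> 'a) \<Rightarrow> nat \<Rightarrow> (nat \<Rightarrow> 'a) \<Rightarrow> nat \<Rightarrow> 'a \<Rightarrow> real" where
  "reweighting \<theta> s n x j z = \<theta> * of_bool (s z = s (x j)) / measure P {w. s w = s (x j)}
    + (1 - \<theta> * frequency {w. s w = s z} n x / measure P {w. s w = s z})"

text \<open>The sample is coupled to \<open>P\<close> by spreading the fraction \<open>\<theta>\<close> of each atom over its cell of the
  partition \<open>s\<close> and the remainder over a common residual density.\<close>

lemma plan_reweighting:
  assumes s[measurable]: "s \<in> borel_measurable borel" and fin: "finite (range s)"
    and n: "1 \<le> n" and \<theta>: "0 \<le> \<theta>"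
    and pos: "\<forall>j\<in>{1..n}. 0 < measure P {w. s w = s (x j)}"
    and le: "\<And>z. \<theta> * frequency {w. s w = s z} n x \<le> measure P {w. s w = s z}"
  defines "f \<equiv> reweighting \<theta> s n x"
  shows "f j \<in> borel_measurable borel"
    and "\<And>j z. 0 \<le> f j z"
    and "\<And>z. (\<Sum>j=1..n. f j z) = n"
    and "plan n Q (\<lambda>j. distr (density P (\<lambda>z. ennreal (f j z))) borel T)"
proof -
  have cellm: "(\<lambda>z. g (s z)) \<in> borel_measurable borel" for g :: "'a \<Rightarrow> real"
  proof -
    have "simple_function borel s"
      using fin by (auto simp: simple_function_borel_measurable)
    then have "s \<in> borel \<rightarrow>\<^sub>M count_space UNIV" by (rule measurable_simple_function)
    then show ?thesis by (rule measurable_compose) auto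
  qed
  show fm: "f j \<in> borel_measurable borel" for j
    unfolding f_def reweighting_def
    using cellm[of "\<lambda>v. \<theta> * of_bool (v = s (x j)) / measure P {w. s w = s (x j)}
    + (1 - \<theta> * frequency {w. s w = v} n x / measure P {w. s w = v})"] by simp
  have fr0: "0 \<le> frequency A n x" for A by (simp add: frequency_def sum_nonneg)
  show f0: "0 \<le> f j z" for j z
  proof -
    have "\<theta> * frequency {w. s w = s z} n x / measure P {w. s w = s z} \<le> 1"
      using le[of z] by (cases "measure P {w. s w = s z} = 0") (simp_all add: divide_le_eq_1 zero_less_measure_iff)
    then show ?thesis unfolding f_def reweighting_def using \<theta> by simp
  qed
  show fs: "(\<Sum>j=1..n. f j z) = n" for z
  proof -
    let ?p = "measure P {w. s w = s z}"
    have "(\<Sum>j=1..n. \<theta> * of_bool (s z = s (x j)) / measure P {w. s w = s (x j)})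
      = (\<Sum>j=1..n. \<theta> * indicator {w. s w = s z} (x j) / ?p)"
      by (intro sum.cong refl) (auto simp: indicator_def)
    also have "\<dots> = n * (\<theta> * frequency {w. s w = s z} n x / ?p)"
      using n by (simp add: frequency_def sum_distrib_left[symmetric] sum_divide_distrib[symmetric])
    finally show ?thesis unfolding f_def reweighting_def
      by (simp add: sum.distrib right_diff_distrib)
  qed
  have fb: "f j z \<le> n" if "j \<in> {1..n}" for j z
    using member_le_sum[of j "{1..n}" "\<lambda>j. f j z"] that f0 fs[of z] by simp
  have fi: "integrable P (f j)" if "j \<in> {1..n}" for j
    by (rule P.integrable_const_bound[of _ n]) (use fb[OF that] f0 fm in auto)
  define r where "r z = 1 - \<theta> * frequency {w. s w = s z} n x / measure P {w. s w = s z}" for z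
  have I: "(\<integral>z. f j z \<partial>P) = \<theta> + (\<integral>z. r z \<partial>P)" if j: "j \<in> {1..n}" for j
  proof -
    have cell: "{w. s w = s (x j)} \<in> sets borel" using s by (simp add: pred_def[symmetric])
    have e: "f j z = \<theta> * indicator {w. s w = s (x j)} z / measure P {w. s w = s (x j)} + r z" for z
      by (simp add: f_def reweighting_def r_def indicator_def)
    have i1: "integrable P (\<lambda>z. indicator {w. s w = s (x j)} z :: real)"
      by (rule P.integrable_const_bound[of _ 1]) (use cell in \<open>auto simp: indicator_def\<close>)
    then have i2: "integrable P (\<lambda>z. \<theta> * indicator {w. s w = s (x j)} z / measure P {w. s w = s (x j)})" by simp
    have ir: "integrable P r" using Bochner_Integration.integrable_diff[OF fi[OF j] i2] by (simp add: e)
    show ?thesis unfolding e using i1 ir bspec[OF pos j] cell by (simp add: spaceP sP)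
  qed
  \<comment> \<open>The integral of \<open>f j\<close> is the same for all \<open>j\<close>; as the
    \<open>n\<close> integrals add up to \<open>n\<close>, each of them is 1.\<close>
  have one: "(\<integral>z. f j z \<partial>P) = 1" if j: "j \<in> {1..n}" for j
  proof -
    have "real n * (\<theta> + (\<integral>z. r z \<partial>P)) = (\<Sum>j=1..n. \<integral>z. f j z \<partial>P)" by (simp add: I)
    also have "\<dots> = (\<integral>z. (\<Sum>j=1..n. f j z) \<partial>P)" using fi by (simp add: Bochner_Integration.integral_sum)
    also have "\<dots> = (\<integral>z. real n \<partial>P)" by (simp only: fs)
    also have "\<dots> = n" by (simp add: P.prob_space)
    finally show ?thesis using n I[OF j] by simp
  qed
  have Tm: "T \<in> density P (\<lambda>z. ennreal (f j z)) \<rightarrow>\<^sub>M borel" for j by simp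
  show "plan n Q (\<lambda>j. distr (density P (\<lambda>z. ennreal (f j z))) borel T)"
    unfolding plan_def
  proof (intro conjI ballI)
    fix j assume j: "j \<in> {1..n}"
    have "prob_space (density P (\<lambda>z. ennreal (f j z)))"
    proof (rule prob_spaceI)
      have "emeasure (density P (\<lambda>z. ennreal (f j z))) (space P) = (\<integral>\<^sup>+z. ennreal (f j z) * indicator (space P) z \<partial>P)"
        by (rule emeasure_density) (use fm[of j] in auto)
      also have "\<dots> = (\<integral>\<^sup>+z. ennreal (f j z) \<partial>P)" by (intro nn_integral_cong) auto
      also have "\<dots> = ennreal (\<integral>z. f j z \<partial>P)" using fi[OF j] f0 by (intro nn_integral_eq_integral) auto
      finally show "emeasure (density P (\<lambda>z. ennreal (f j z))) (space (density P (\<lambda>z. ennreal (f j z)))) = 1"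
        by (simp add: one[OF j])
    qed
    then show "prob_space (distr (density P (\<lambda>z. ennreal (f j z))) borel T)"
      by (rule prob_space.prob_space_distr[OF _ Tm])
  next
    fix h :: "'a \<Rightarrow> ennreal" assume h: "h \<in> borel_measurable borel"
    note [measurable] = h fm
    have "(\<Sum>j=1..n. \<integral>\<^sup>+y. h y \<partial>distr (density P (\<lambda>z. ennreal (f j z))) borel T)
      = (\<Sum>j=1..n. \<integral>\<^sup>+z. ennreal (f j z) * h (T z) \<partial>P)"
      by (simp add: nn_integral_distr nn_integral_density)
    also have "\<dots> = (\<integral>\<^sup>+z. (\<Sum>j=1..n. ennreal (f j z) * h (T z)) \<partial>P)"
      by (rule nn_integral_sum[symmetric]) measurable
    also have "\<dots> = (\<integral>\<^sup>+z. of_nat n * h (T z) \<partial>P)"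
      by (intro nn_integral_cong)
        (simp only: sum_distrib_right[symmetric] sum_ennreal[OF f0] fs ennreal_of_nat_eq_real_of_nat)
    also have "\<dots> = of_nat n * (\<integral>\<^sup>+y. h y \<partial>Q)"
      by (subst nn_integral_cmult) (use nn_integral_T[OF _ h, of "\<lambda>_. 0"] in auto)
    finally show "(\<Sum>j=1..n. \<integral>\<^sup>+y. h y \<partial>distr (density P (\<lambda>z. ennreal (f j z))) borel T) = of_nat n * (\<integral>\<^sup>+y. h y \<partial>Q)" .
  qed simp
qed

lemma AE_cell_pos:
  fixes s :: "'a \<Rightarrow> 'a"
  assumes s: "s \<in> borel_measurable borel" and fin: "finite (range s)"
  shows "AE z in P. 0 < measure P {w. s w = s z}"
proof -
  have cell: "{w. s w = v} \<in> sets borel" for v using s by (simp add: pred_def[symmetric])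
  have "AE z in P. \<forall>v\<in>range s. measure P {w. s w = v} = 0 \<longrightarrow> s z \<noteq> v"
  proof (intro AE_finite_allI fin)
    fix v
    show "AE z in P. measure P {w. s w = v} = 0 \<longrightarrow> s z \<noteq> v"
    proof (cases "measure P {w. s w = v} = 0")
      case True
      then have "{w. s w = v} \<in> null_sets P" using cell[of v] by (intro null_setsI) (auto simp: P.emeasure_eq_measure sP)
      then show ?thesis by (auto dest: AE_not_in)
    qed auto
  qed
  then show ?thesis by eventually_elim (auto simp: zero_less_measure_iff)
qed

text \<open>The reweighted splitting, pushed forward by \<open>T\<close>, is a competitor whose loss
  is the average of the integrals of \<open>f j z * ((z - x j) \<bullet> T z)\<close>. Within a cell
  \<open>z\<close> and \<open>x j\<close> share the representative \<open>s z\<close>, and the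
  residual weight is at most \<open>2 * \<eta>\<close>; the parameter \<open>a\<close> balances
  displacement against the second moment of \<open>T\<close>.\<close>

lemma transport_gap_le:
  assumes s[measurable]: "s \<in> borel_measurable borel" and fin: "finite (range s)" and n: "1 \<le> n"
    and pos: "\<And>j. j \<in> {1..n} \<Longrightarrow> 0 < measure P {w. s w = s (x j)}"
    and fr: "\<And>z. \<bar>frequency {w. s w = s z} n x - measure P {w. s w = s z}\<bar> \<le> \<eta> * measure P {w. s w = s z}"
    and \<eta>: "0 < \<eta>" "\<eta> \<le> 1" and a: "0 < a"
    and s2: "integrable P (\<lambda>z. (norm (z - s z))\<^sup>2)"
  shows "(\<integral>z. z \<bullet> T z \<partial>P) - max_correlation n Q x / n \<le>
    (2 * (\<integral>z. (norm (z - s z))\<^sup>2 \<partial>P) + 2 * ((\<Sum>j=1..n. (norm (x j - s (x j)))\<^sup>2) / n)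
      + 4 * \<eta> * ((\<integral>z. (norm z)\<^sup>2 \<partial>P) + (\<Sum>j=1..n. (norm (x j))\<^sup>2) / n)) / (2 * a)
    + a / 2 * (\<integral>z. (norm (T z))\<^sup>2 \<partial>P)"
proof -
  \<comment> \<open>The frequencies exceed the cell masses by at most the factor
    \<open>1 + \<eta>\<close>.\<close>
  define \<theta> where "\<theta> = 1 / (1 + \<eta>)"
  have \<theta>: "0 \<le> \<theta>" "\<theta> \<le> 1" "\<theta> * (1 + \<eta>) = 1" using \<eta> by (auto simp: \<theta>_def)
  let ?p = "\<lambda>z. measure P {w. s w = s z}"
  let ?q = "\<lambda>z. frequency {w. s w = s z} n x"
  have le: "\<theta> * ?q z \<le> ?p z" for z
  proof -
    have "?q z \<le> (1 + \<eta>) * ?p z" using fr[of z] by (simp add: algebra_simps abs_le_iff)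
    from mult_left_mono[OF this \<theta>(1)] show ?thesis using \<theta>(3) by (simp add: mult.assoc[symmetric])
  qed
  define f where "f = reweighting \<theta> s n x"
  note pl = plan_reweighting[OF s fin n \<theta>(1) ballI[OF pos] le, folded f_def]
  note fm[measurable] = pl(1) and f0 = pl(2) and fs = pl(3)
  define \<nu> where "\<nu> j = distr (density P (\<lambda>z. ennreal (f j z))) borel T" for j
  have \<nu>: "plan n Q \<nu>" unfolding \<nu>_def by (rule pl(4))
  have fb: "f j z \<le> n" if "j \<in> {1..n}" for j z
    using member_le_sum[of j "{1..n}" "\<lambda>j. f j z"] that f0 fs[of z] by simp
  have bdi: "integrable P (\<lambda>z. g z * F z)" if "integrable P F" "g \<in> borel_measurable borel"
    "\<And>z. 0 \<le> g z" "\<And>z. g z \<le> c" for g F :: "'a \<Rightarrow> real" and c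
  proof (rule Bochner_Integration.integrable_bound[OF integrable_mult_right[OF that(1), of c]])
    show "AE z in P. norm (g z * F z) \<le> norm (c * F z)"
      using that(3,4) by (intro AE_I2) (auto simp: abs_mult intro!: mult_mono order_trans[OF that(4) abs_ge_self])
    show "(\<lambda>z. g z * F z) \<in> borel_measurable P"
      using that(2) borel_measurable_integrable[OF that(1)] by measurable
  qed
  have fsm: "(\<Sum>j=1..n. f j z * c) = n * c" for z and c :: real
    using fs[of z] by (simp only: sum_distrib_right[symmetric])
  have iT: "integrable P (\<lambda>z. T z)"
    using T_moment[of 1] by (simp add: integrable_norm_iff)
  have bary: "x j \<bullet> barycenter \<nu> j = (\<integral>z. f j z * (x j \<bullet> T z) \<partial>P)" if j: "j \<in> {1..n}" for j
  proof -
    have "barycenter \<nu> j = (\<integral>z. f j z *\<^sub>R T z \<partial>P)"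
      unfolding barycenter_def \<nu>_def using f0 by (simp add: integral_distr integral_density)
    moreover have "integrable P (\<lambda>z. f j z *\<^sub>R T z)"
    proof (rule Bochner_Integration.integrable_bound[OF integrable_scaleR_right[OF iT, of n]])
      show "AE z in P. norm (f j z *\<^sub>R T z) \<le> norm (real n *\<^sub>R T z)"
        using fb[OF j] f0 by (intro AE_I2) (auto intro!: mult_right_mono)
    qed measurable
    ultimately show ?thesis by (simp add: integral_inner_right[symmetric] inner_commute[of _ "x j"])
  qed
  have ixT: "integrable P (\<lambda>z. x j \<bullet> T z)" for j using iT by simp
  have cor: "correlation n x \<nu> = (\<Sum>j=1..n. \<integral>z. f j z * (x j \<bullet> T z) \<partial>P)"
    unfolding correlation_def by (intro sum.cong refl bary)
  have tot: "n * (\<integral>z. z \<bullet> T z \<partial>P) = (\<Sum>j=1..n. \<integral>z. f j z * (z \<bullet> T z) \<partial>P)"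
  proof -
    have "(\<Sum>j=1..n. \<integral>z. f j z * (z \<bullet> T z) \<partial>P) = (\<integral>z. (\<Sum>j=1..n. f j z * (z \<bullet> T z)) \<partial>P)"
      by (rule Bochner_Integration.integral_sum[symmetric]) (rule bdi[OF duality(1) fm f0 fb])
    then show ?thesis unfolding fsm by simp
  qed
  define h where "h j z = \<theta> * of_bool (s z = s (x j)) / ?p (x j)" for j z
  \<comment> \<open>Two majorants of the squared displacement: inside a cell through the common
    value of \<open>s\<close>, and for the residual, of weight at most \<open>2 * \<eta>\<close>,
    through the full norms.\<close>
  define H where "H j z = h j z * (2 * (norm (z - s z))\<^sup>2) + h j z * (2 * (norm (x j - s (x j)))\<^sup>2)
    + 2 * \<eta> * (2 * (norm z)\<^sup>2 + 2 * (norm (x j))\<^sup>2)" for j z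
  have h0: "0 \<le> h j z" for j z using \<theta> by (simp add: h_def)
  have hs: "(\<Sum>j=1..n. h j z) \<le> n" for z
  proof -
    have "(\<Sum>j=1..n. h j z) = (\<Sum>j=1..n. \<theta> * indicator {w. s w = s z} (x j) / ?p z)"
      unfolding h_def by (intro sum.cong refl) (auto simp: indicator_def)
    also have "\<dots> = n * (\<theta> * ?q z / ?p z)"
      using n by (simp add: frequency_def sum_distrib_left[symmetric] sum_divide_distrib[symmetric])
    also have "\<dots> \<le> real n * 1" using le[of z]
      by (intro mult_left_mono; cases "?p z = 0") (simp_all add: divide_le_eq_1 zero_less_measure_iff)
    finally show ?thesis by simp
  qed
  have hb: "h j z \<le> n" if "j \<in> {1..n}" for j z
    using member_le_sum[of j "{1..n}" "\<lambda>j. h j z"] that h0 hs[of z] by force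
  have cell: "{w. s w = v} \<in> sets borel" for v using s by (simp add: pred_def[symmetric])
  have hI: "h j z = \<theta> / ?p (x j) * indicator {w. s w = s (x j)} z" for j z
    by (simp add: h_def indicator_def)
  have hm: "h j \<in> borel_measurable borel" for j unfolding hI[abs_def] using cell by simp
  have hint: "integrable P (h j)" "(\<integral>z. h j z \<partial>P) \<le> 1" if j: "j \<in> {1..n}" for j
  proof -
    show "integrable P (h j)" by (rule P.integrable_const_bound[of _ n]) (use hb[OF j] h0 hm in auto)
    have "(\<integral>z. h j z \<partial>P) = \<theta>" unfolding hI using pos[OF j] cell by (simp add: spaceP)
    then show "(\<integral>z. h j z \<partial>P) \<le> 1" using \<theta> by simp
  qed
  have r: "1 - \<theta> * ?q z / ?p z \<le> 2 * \<eta>" if "0 < ?p z" for z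
  proof -
    have "(1 - \<eta>) * ?p z \<le> ?q z" using fr[of z] by (simp add: algebra_simps abs_le_iff)
    then have "1 - \<eta> \<le> ?q z / ?p z" using that by (simp add: pos_le_divide_eq)
    then have "\<theta> * (1 - \<eta>) \<le> \<theta> * (?q z / ?p z)" using \<theta>(1) by (rule mult_left_mono)
    moreover have "1 - \<theta> * (1 - \<eta>) \<le> 2 * \<eta>"
    proof -
      have "1 - \<theta> * (1 - \<eta>) = 2 * (\<theta> * \<eta>)" using \<theta>(3) by (simp add: algebra_simps)
      also have "\<dots> \<le> 2 * \<eta>" using mult_right_mono[OF \<theta>(2), of \<eta>] \<eta> by simp
      finally show ?thesis .
    qed
    ultimately show ?thesis by simp
  qed
  have AEp: "AE z in P. 0 < ?p z" by (rule AE_cell_pos[OF s fin])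
  have fH: "AE z in P. f j z * (norm (z - x j))\<^sup>2 \<le> H j z" for j
    using AEp
  proof eventually_elim
    case (elim z)
    define \<rho> where "\<rho> = 1 - \<theta> * ?q z / ?p z"
    have \<rho>: "0 \<le> \<rho>" "\<rho> \<le> 2 * \<eta>" using r[OF elim] le[of z] elim by (auto simp: \<rho>_def divide_le_eq_1)
    have e: "f j z = h j z + \<rho>" by (simp add: f_def reweighting_def h_def \<rho>_def)
    have "h j z * (norm (z - x j))\<^sup>2 \<le> h j z * (2 * (norm (z - s z))\<^sup>2 + 2 * (norm (x j - s (x j)))\<^sup>2)"
    proof (cases "s z = s (x j)")
      case True
      then show ?thesis using norm_diff_square_le[of "z - s z" "x j - s (x j)"] h0[of j z]
        by (intro mult_left_mono) auto
    qed (simp add: h_def)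
    moreover have "\<rho> * (norm (z - x j))\<^sup>2 \<le> 2 * \<eta> * (2 * (norm z)\<^sup>2 + 2 * (norm (x j))\<^sup>2)"
      using \<rho> norm_diff_square_le[of z "x j"] \<eta> by (intro mult_mono) auto
    ultimately show ?case unfolding e H_def by (simp add: algebra_simps)
  qed
  have i2: "integrable P (\<lambda>z. (norm z)\<^sup>2)" using P_moment[of 2] by simp
  have iT2: "integrable P (\<lambda>z. (norm (T z))\<^sup>2)" using T_moment[of 2] by simp
  have ih: "integrable P (\<lambda>z. h j z * (2 * (norm (z - s z))\<^sup>2))" if "j \<in> {1..n}" for j
    by (rule bdi[OF integrable_mult_right[OF s2] hm h0 hb[OF that]])
  have iH: "integrable P (H j)" if j: "j \<in> {1..n}" for j
    unfolding H_def[abs_def] using ih[OF j] hint(1)[OF j] i2 by simp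
  have ifT: "integrable P (\<lambda>z. f j z * (norm (T z))\<^sup>2)" if j: "j \<in> {1..n}" for j
    by (rule bdi[OF iT2 fm f0 fb[OF j]])
  have main: "(\<integral>z. f j z * (z \<bullet> T z) \<partial>P) - (\<integral>z. f j z * (x j \<bullet> T z) \<partial>P)
    \<le> (\<integral>z. H j z \<partial>P) / (2 * a) + a / 2 * (\<integral>z. f j z * (norm (T z))\<^sup>2 \<partial>P)" if j: "j \<in> {1..n}" for j
  proof -
    have "(\<integral>z. f j z * (z \<bullet> T z) \<partial>P) - (\<integral>z. f j z * (x j \<bullet> T z) \<partial>P)
      = (\<integral>z. f j z * (z \<bullet> T z) - f j z * (x j \<bullet> T z) \<partial>P)"
      using bdi[OF duality(1) fm f0 fb[OF j]] bdi[OF ixT[of j] fm f0 fb[OF j]] by simp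
    also have "\<dots> \<le> (\<integral>z. H j z / (2 * a) + a / 2 * (f j z * (norm (T z))\<^sup>2) \<partial>P)"
    proof (rule integral_mono_AE)
      show "integrable P (\<lambda>z. f j z * (z \<bullet> T z) - f j z * (x j \<bullet> T z))"
        using bdi[OF duality(1) fm f0 fb[OF j]] bdi[OF ixT[of j] fm f0 fb[OF j]] by simp
      show "integrable P (\<lambda>z. H j z / (2 * a) + a / 2 * (f j z * (norm (T z))\<^sup>2))"
        using iH[OF j] ifT[OF j] by simp
      show "AE z in P. f j z * (z \<bullet> T z) - f j z * (x j \<bullet> T z) \<le> H j z / (2 * a) + a / 2 * (f j z * (norm (T z))\<^sup>2)"
        using fH[of j]
      proof eventually_elim
        case (elim z)
        let ?u = "norm (z - x j)" and ?v = "norm (T z)"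
        \<comment> \<open>Young's inequality for products with weight \<open>a\<close>, which
          separates the displacement from \<open>T z\<close>.\<close>
        have "0 \<le> (?u - a * ?v)\<^sup>2" by simp
        then have "2 * a * (?u * ?v) \<le> ?u\<^sup>2 + a\<^sup>2 * ?v\<^sup>2" by (simp add: power2_diff power_mult_distrib algebra_simps)
        then have "?u * ?v \<le> (?u\<^sup>2 + a\<^sup>2 * ?v\<^sup>2) / (2 * a)"
          using a by (simp add: pos_le_divide_eq mult.commute)
        also have "\<dots> = ?u\<^sup>2 / (2 * a) + a / 2 * ?v\<^sup>2" using a by (simp add: field_simps power2_eq_square)
        finally have "(z - x j) \<bullet> T z \<le> ?u\<^sup>2 / (2 * a) + a / 2 * ?v\<^sup>2"
          using norm_cauchy_schwarz[of "z - x j" "T z"] by linarith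
        then have "f j z * ((z - x j) \<bullet> T z) \<le> f j z * (?u\<^sup>2 / (2 * a) + a / 2 * ?v\<^sup>2)"
          using f0 by (intro mult_left_mono) auto
        also have "\<dots> = (f j z * ?u\<^sup>2) / (2 * a) + a / 2 * (f j z * ?v\<^sup>2)" by (simp add: algebra_simps)
        also have "\<dots> \<le> H j z / (2 * a) + a / 2 * (f j z * ?v\<^sup>2)"
          using elim a by (intro add_right_mono divide_right_mono) auto
        finally show ?case by (simp add: inner_diff_left right_diff_distrib)
      qed
    qed
    also have "\<dots> = (\<integral>z. H j z \<partial>P) / (2 * a) + a / 2 * (\<integral>z. f j z * (norm (T z))\<^sup>2 \<partial>P)"
      using iH[OF j] ifT[OF j] by simp
    finally show ?thesis .
  qed
  let ?S = "\<integral>z. (norm (z - s z))\<^sup>2 \<partial>P" and ?X = "\<Sum>j=1..n. (norm (x j - s (x j)))\<^sup>2"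
  let ?m = "\<integral>z. (norm z)\<^sup>2 \<partial>P" and ?Y = "\<Sum>j=1..n. (norm (x j))\<^sup>2"
  have sH: "(\<Sum>j=1..n. \<integral>z. H j z \<partial>P) \<le> n * (2 * ?S) + 2 * ?X + 4 * \<eta> * (n * ?m + ?Y)"
  proof -
    have "(\<integral>z. H j z \<partial>P) = (\<integral>z. h j z * (2 * (norm (z - s z))\<^sup>2) \<partial>P) + (\<integral>z. h j z \<partial>P) * (2 * (norm (x j - s (x j)))\<^sup>2)
        + 4 * \<eta> * (?m + (norm (x j))\<^sup>2)" if j: "j \<in> {1..n}" for j
      unfolding H_def using ih[OF j] hint(1)[OF j] i2 by (simp add: P.prob_space algebra_simps)
    then have "(\<Sum>j=1..n. \<integral>z. H j z \<partial>P) = (\<Sum>j=1..n. \<integral>z. h j z * (2 * (norm (z - s z))\<^sup>2) \<partial>P)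
      + (\<Sum>j=1..n. (\<integral>z. h j z \<partial>P) * (2 * (norm (x j - s (x j)))\<^sup>2)) + (\<Sum>j=1..n. 4 * \<eta> * (?m + (norm (x j))\<^sup>2))"
      by (simp add: sum.distrib)
    also have "(\<Sum>j=1..n. \<integral>z. h j z * (2 * (norm (z - s z))\<^sup>2) \<partial>P) = (\<integral>z. (\<Sum>j=1..n. h j z * (2 * (norm (z - s z))\<^sup>2)) \<partial>P)"
      by (rule Bochner_Integration.integral_sum[symmetric]) (rule ih)
    also have "\<dots> \<le> (\<integral>z. n * (2 * (norm (z - s z))\<^sup>2) \<partial>P)"
    proof (rule integral_mono)
      show "integrable P (\<lambda>z. \<Sum>j=1..n. h j z * (2 * (norm (z - s z))\<^sup>2))"
        by (intro Bochner_Integration.integrable_sum ih)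
      show "(\<Sum>j=1..n. h j z * (2 * (norm (z - s z))\<^sup>2)) \<le> n * (2 * (norm (z - s z))\<^sup>2)" for z
        unfolding sum_distrib_right[symmetric] by (rule mult_right_mono[OF hs]) simp
    qed (use s2 in simp)
    also have "\<dots> = n * (2 * ?S)" by simp
    also have "(\<Sum>j=1..n. (\<integral>z. h j z \<partial>P) * (2 * (norm (x j - s (x j)))\<^sup>2)) \<le> (\<Sum>j=1..n. 1 * (2 * (norm (x j - s (x j)))\<^sup>2))"
      by (intro sum_mono mult_right_mono hint(2)) auto
    also have "\<dots> = 2 * ?X" by (simp add: sum_distrib_left)
    also have "(\<Sum>j=1..n. 4 * \<eta> * (?m + (norm (x j))\<^sup>2)) = 4 * \<eta> * (n * ?m + ?Y)"
      by (simp add: sum.distrib sum_distrib_left[symmetric])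
    finally show ?thesis by simp
  qed
  have sT: "(\<Sum>j=1..n. \<integral>z. f j z * (norm (T z))\<^sup>2 \<partial>P) = n * (\<integral>z. (norm (T z))\<^sup>2 \<partial>P)"
  proof -
    have "(\<Sum>j=1..n. \<integral>z. f j z * (norm (T z))\<^sup>2 \<partial>P) = (\<integral>z. (\<Sum>j=1..n. f j z * (norm (T z))\<^sup>2) \<partial>P)"
      by (rule Bochner_Integration.integral_sum[symmetric]) (rule ifT)
    then show ?thesis unfolding fsm by simp
  qed
  have "n * (\<integral>z. z \<bullet> T z \<partial>P) - max_correlation n Q x \<le> n * (\<integral>z. z \<bullet> T z \<partial>P) - correlation n x \<nu>"
    using correlation_le_max[OF sQ nQ \<nu>] by simp
  also have "\<dots> = (\<Sum>j=1..n. (\<integral>z. f j z * (z \<bullet> T z) \<partial>P) - (\<integral>z. f j z * (x j \<bullet> T z) \<partial>P))"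
    unfolding tot cor by (simp add: sum_subtractf)
  also have "\<dots> \<le> (\<Sum>j=1..n. (\<integral>z. H j z \<partial>P) / (2 * a) + a / 2 * (\<integral>z. f j z * (norm (T z))\<^sup>2 \<partial>P))"
    by (rule sum_mono[OF main])
  also have "\<dots> = (\<Sum>j=1..n. \<integral>z. H j z \<partial>P) / (2 * a) + a / 2 * (\<Sum>j=1..n. \<integral>z. f j z * (norm (T z))\<^sup>2 \<partial>P)"
    by (simp add: sum.distrib sum_divide_distrib sum_distrib_left)
  also have "\<dots> \<le> (n * (2 * ?S) + 2 * ?X + 4 * \<eta> * (n * ?m + ?Y)) / (2 * a) + a / 2 * (n * (\<integral>z. (norm (T z))\<^sup>2 \<partial>P))"
    unfolding sT using sH a by (intro add_right_mono divide_right_mono) auto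
  finally have "(n * (\<integral>z. z \<bullet> T z \<partial>P) - max_correlation n Q x) / n
    \<le> ((n * (2 * ?S) + 2 * ?X + 4 * \<eta> * (n * ?m + ?Y)) / (2 * a) + a / 2 * (n * (\<integral>z. (norm (T z))\<^sup>2 \<partial>P))) / n"
    by (rule divide_right_mono) simp
  also have "\<dots> = (2 * ?S + 2 * (?X / n) + 4 * \<eta> * (?m + ?Y / n)) / (2 * a) + a / 2 * (\<integral>z. (norm (T z))\<^sup>2 \<partial>P)"
    using n a by (simp add: field_simps)
  finally show ?thesis using n by (simp add: diff_divide_distrib)
qed

text \<open>Simple functions dominated by \<open>2 * norm x\<close> approximate the identity, and
  dominated convergence applies. The fourth moment is recorded so that the law of large numbers
  covers the squared error.\<close>

lemma simple_approximation:
  assumes "0 < l"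
  obtains s :: "'a \<Rightarrow> 'a" where "s \<in> borel_measurable borel" "finite (range s)"
    "integrable P (\<lambda>z. (norm (z - s z))^2)" "integrable P (\<lambda>z. (norm (z - s z))^4)"
    "(\<integral>z. (norm (z - s z))^2 \<partial>P) < l"
proof -
  have "(\<lambda>x::'a. x) \<in> borel_measurable borel" by simp
  from borel_measurable_implies_sequence_metric[OF this, of 0]
  obtain F :: "nat \<Rightarrow> 'a \<Rightarrow> 'a" where F: "\<And>i. simple_function borel (F i)" "\<And>x. (\<lambda>i. F i x) \<longlonglongrightarrow> x"
    "\<And>i x. norm (F i x) \<le> 2 * norm x" by auto
  have m[measurable]: "F i \<in> borel_measurable borel" and f: "finite (range (F i))" for i
    using F(1)[of i] by (auto simp: simple_function_borel_measurable borel_measurable_simple_function simple_function_def)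
  have b: "norm (z - F i z) \<le> 3 * norm z" for i z
    using norm_triangle_ineq4[of z "F i z"] F(3)[of i z] by linarith
  have bk: "norm (z - F i z) ^ k \<le> 3 ^ k * norm z ^ k" for i z k
    using power_mono[OF b, of z i k] by (simp add: power_mult_distrib)
  have ik: "integrable P (\<lambda>z. norm (z - F i z) ^ k)" if "k \<le> 4" for i k
    by (rule Bochner_Integration.integrable_bound[OF integrable_mult_right[OF P_moment[OF that], of "3^k"]])
      (use bk in \<open>auto intro!: AE_I2\<close>)
  have "(\<lambda>i. \<integral>z. norm (z - F i z) ^ 2 \<partial>P) \<longlonglongrightarrow> (\<integral>z. 0 \<partial>P)"
  proof (rule integral_dominated_convergence[where w="\<lambda>z. 3^2 * norm z ^ 2"])
    show "integrable P (\<lambda>z. 3^2 * norm z ^ 2)" by (intro integrable_mult_right P_moment) simp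
    show "AE z in P. (\<lambda>i. norm (z - F i z) ^ 2) \<longlonglongrightarrow> 0"
    proof (rule AE_I2)
      fix z
      have "(\<lambda>i. norm (z - F i z) ^ 2) \<longlonglongrightarrow> norm (z - z) ^ 2" by (intro tendsto_intros F(2))
      then show "(\<lambda>i. norm (z - F i z) ^ 2) \<longlonglongrightarrow> 0" by simp
    qed
    show "AE z in P. norm (norm (z - F i z) ^ 2) \<le> 3^2 * norm z ^ 2" for i
    proof (rule AE_I2)
      fix z show "norm (norm (z - F i z) ^ 2) \<le> 3^2 * norm z ^ 2" using bk[of z i 2] by simp
    qed
  qed auto
  then have "\<forall>\<^sub>F i in sequentially. (\<integral>z. norm (z - F i z) ^ 2 \<partial>P) < l"
    using assms by (intro order_tendstoD) auto
  then obtain i where "(\<integral>z. norm (z - F i z) ^ 2 \<partial>P) < l" by (auto simp: eventually_sequentially)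
  then show ?thesis using that[of "F i"] m f ik[of 2 i] ik[of 4 i] by simp
qed

text \<open>By \<open>duality\<close> the excess is the deviation of the sample mean of
  \<open>\<phi>\<close> plus the transport gap. The former and the right side of
  \<open>transport_gap_le\<close> depend on finitely many sample averages, each controlled by the
  law of large numbers.\<close>

lemma excess_tendsto:
  assumes g: "0 < g"
  shows "(\<lambda>n. measure (sample n) {x \<in> space (sample n). g < excess n x}) \<longlonglongrightarrow> 0"
proof -
  define mT where "mT = (\<integral>z. (norm (T z))\<^sup>2 \<partial>P)"
  define m where "m = (\<integral>z. (norm z)\<^sup>2 \<partial>P)"
  have mT: "0 \<le> mT" and m: "0 \<le> m" by (auto simp: mT_def m_def intro!: integral_nonneg_AE)
  \<comment> \<open>Error budget: \<open>a\<close> limits the term with the second moment of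
    \<open>T\<close> to \<open>g / 4\<close>; \<open>l\<close> and \<open>\<eta>\<close> give
    \<open>g * a / 4\<close> each to the numerator, hence another \<open>g / 4\<close> after
    division by \<open>2 * a\<close>; the sample mean of \<open>\<phi>\<close> takes a further
    \<open>g / 4\<close>.\<close>
  define a where "a = g / (2 * (mT + 1))"
  have a: "0 < a" "a / 2 * mT \<le> g / 4"
    using g mT by (auto simp: a_def field_simps)
  define l where "l = g * a / 24"
  have l: "0 < l" using g a by (simp add: l_def)
  define \<eta> where "\<eta> = min 1 (g * a / (16 * (2 * m + 1)))"
  have \<eta>: "0 < \<eta>" "\<eta> \<le> 1" using g a m by (auto simp: \<eta>_def)
  have \<eta>2: "4 * \<eta> * (2 * m + 1) \<le> g * a / 4"
  proof -
    have "\<eta> \<le> g * a / (16 * (2 * m + 1))" by (simp add: \<eta>_def)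
    then have "4 * \<eta> * (2 * m + 1) \<le> 4 * (g * a / (16 * (2 * m + 1))) * (2 * m + 1)"
      using m by (intro mult_right_mono) auto
    also have "\<dots> = g * a / 4" using m by (simp add: field_simps)
    finally show ?thesis .
  qed
  obtain s where s[measurable]: "s \<in> borel_measurable borel" and fin: "finite (range s)"
    and s2: "integrable P (\<lambda>z. (norm (z - s z))\<^sup>2)" and s4: "integrable P (\<lambda>z. (norm (z - s z))^4)"
    and sl: "(\<integral>z. (norm (z - s z))\<^sup>2 \<partial>P) < l"
    using simple_approximation[OF l] by blast
  define p where "p v = measure P {w. s w = v}" for v
  define Vp where "Vp = {v \<in> range s. 0 < p v}"
  have finVp: "finite Vp" using fin by (simp add: Vp_def)
  have cell[measurable]: "{w. s w = v} \<in> sets borel" for v using s by (simp add: pred_def[symmetric])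
  define B where "B n = (\<Union>v\<in>Vp. deviates (indicator {w. s w = v}) (\<eta> * p v) n)
    \<union> (deviates \<phi> (g / 4) n \<union> (deviates (\<lambda>z. (norm (z - s z))\<^sup>2) l n \<union> deviates (\<lambda>z. (norm z)\<^sup>2) 1 n))" for n
  have Bs: "B n \<in> sets (sample n)" for n unfolding B_def
    by (intro sets.Un sets.finite_UN finVp deviates_sets) measurable
  have Bm: "measure (sample n) (B n) \<le> (\<Sum>v\<in>Vp. measure (sample n) (deviates (indicator {w. s w = v}) (\<eta> * p v) n))
    + (measure (sample n) (deviates \<phi> (g / 4) n) + (measure (sample n) (deviates (\<lambda>z. (norm (z - s z))\<^sup>2) l n)
      + measure (sample n) (deviates (\<lambda>z. (norm z)\<^sup>2) 1 n)))" for n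
    unfolding B_def
    by (intro order_trans[OF measure_Un_le] add_mono measure_UNION_le finVp deviates_sets sets.Un sets.finite_UN order_refl) measurable
  have "(\<lambda>n. (\<Sum>v\<in>Vp. measure (sample n) (deviates (indicator {w. s w = v}) (\<eta> * p v) n))
    + (measure (sample n) (deviates \<phi> (g / 4) n) + (measure (sample n) (deviates (\<lambda>z. (norm (z - s z))\<^sup>2) l n)
      + measure (sample n) (deviates (\<lambda>z. (norm z)\<^sup>2) 1 n)))) \<longlonglongrightarrow> (\<Sum>v\<in>Vp. 0) + (0 + (0 + 0))"
  proof (intro tendsto_add tendsto_sum)
    show "(\<lambda>n. measure (sample n) (deviates (indicator {w. s w = v}) (\<eta> * p v) n)) \<longlonglongrightarrow> 0" if "v \<in> Vp" for v
      using that \<eta> by (intro deviates_indicator_tendsto cell) (auto simp: Vp_def)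
    show "(\<lambda>n. measure (sample n) (deviates \<phi> (g / 4) n)) \<longlonglongrightarrow> 0"
      using g by (intro deviates_tendsto \<phi>_meas \<phi>_square) auto
    show "(\<lambda>n. measure (sample n) (deviates (\<lambda>z. (norm (z - s z))\<^sup>2) l n)) \<longlonglongrightarrow> 0"
      using s4 l by (intro deviates_tendsto) (auto simp flip: power_mult)
    show "(\<lambda>n. measure (sample n) (deviates (\<lambda>z. (norm z)\<^sup>2) 1 n)) \<longlonglongrightarrow> 0"
      using P_moment[of 4] by (intro deviates_tendsto) (auto simp flip: power_mult)
  qed
  then have lim: "(\<lambda>n. (\<Sum>v\<in>Vp. measure (sample n) (deviates (indicator {w. s w = v}) (\<eta> * p v) n))
    + (measure (sample n) (deviates \<phi> (g / 4) n) + (measure (sample n) (deviates (\<lambda>z. (norm (z - s z))\<^sup>2) l n)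
      + measure (sample n) (deviates (\<lambda>z. (norm z)\<^sup>2) 1 n)))) \<longlonglongrightarrow> 0" by simp
  have AEp: "AE z in P. 0 < p (s z)" unfolding p_def by (rule AE_cell_pos[OF s fin])
  have le: "measure (sample n) {x \<in> space (sample n). g < excess n x} \<le> measure (sample n) (B n)" if n: "1 \<le> n" for n
  proof -
    interpret S: prob_space "sample n" by (rule prob_sample)
    have "AE x in sample n. \<forall>j\<in>{1..n}. 0 < p (s (x j))"
      by (intro AE_finite_allI P.AE_PiM_component AEp) auto
    then have "AE x in sample n. x \<in> {x \<in> space (sample n). g < excess n x} \<longrightarrow> x \<in> B n"
      using AE_space
    proof eventually_elim
      case (elim x)
      have "excess n x \<le> g" if nB: "x \<notin> B n"
      proof -
        have d1: "\<bar>frequency {w. s w = v} n x - p v\<bar> < \<eta> * p v" if "v \<in> Vp" for v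
          using not_deviates[OF elim(2), of "indicator {w. s w = v}" "\<eta> * p v"] nB that cell[of v]
          by (auto simp: B_def frequency_def p_def spaceP sP)
        have nB': "x \<notin> deviates \<phi> (g / 4) n" "x \<notin> deviates (\<lambda>z. (norm (z - s z))\<^sup>2) l n"
          "x \<notin> deviates (\<lambda>z. (norm z)\<^sup>2) 1 n" using nB by (auto simp: B_def)
        have d2: "(\<Sum>j=1..n. \<phi> (x j)) / n - (\<integral>z. \<phi> z \<partial>P) < g / 4"
          using not_deviates[OF elim(2) nB'(1)] by linarith
        have d3: "(\<Sum>j=1..n. (norm (x j - s (x j)))\<^sup>2) / n < 2 * l"
          using not_deviates[OF elim(2) nB'(2)] sl by linarith
        have d4: "(\<Sum>j=1..n. (norm (x j))\<^sup>2) / n < m + 1"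
          using not_deviates[OF elim(2) nB'(3)] unfolding m_def by linarith
        have fr: "\<bar>frequency {w. s w = s z} n x - p (s z)\<bar> \<le> \<eta> * p (s z)" for z
        proof (cases "0 < p (s z)")
          case True
          then show ?thesis using d1[of "s z"] by (simp add: Vp_def)
        next
          \<comment> \<open>Relative closeness is impossible to test on a null cell by a deviation
            event, but almost surely no sample point falls into one, so its frequency is 0 as
            well.\<close>
          case False
          then have z: "p (s z) = 0" by (simp add: p_def zero_less_measure_iff)
          have "indicator {w. s w = s z} (x j) = (0::real)" if "j \<in> {1..n}" for j
            using bspec[OF elim(1) that] False by (auto simp: indicator_def)
          then have "frequency {w. s w = s z} n x = (\<Sum>j=1..n. 0) / real n"
            unfolding frequency_def by (intro arg_cong2[where f="(/)"] sum.cong refl)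
          then show ?thesis using z by simp
        qed
        have "(\<integral>z. z \<bullet> T z \<partial>P) - max_correlation n Q x / n \<le>
          (2 * (\<integral>z. (norm (z - s z))\<^sup>2 \<partial>P) + 2 * ((\<Sum>j=1..n. (norm (x j - s (x j)))\<^sup>2) / n)
            + 4 * \<eta> * (m + (\<Sum>j=1..n. (norm (x j))\<^sup>2) / n)) / (2 * a) + a / 2 * mT"
          unfolding m_def mT_def
          by (rule transport_gap_le[OF s fin n _ _ \<eta> a(1) s2]) (use elim(1) fr in \<open>auto simp: p_def\<close>)
        also have "\<dots> \<le> (2 * l + 2 * (2 * l) + 4 * \<eta> * (m + (m + 1))) / (2 * a) + g / 4"
          using sl d3 d4 \<eta> a by (intro add_mono divide_right_mono mult_left_mono) auto
        also have "\<dots> \<le> (g * a / 2) / (2 * a) + g / 4"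
        proof (intro add_right_mono divide_right_mono)
          have "6 * l = g * a / 4" by (simp add: l_def)
          moreover have "4 * \<eta> * (m + (m + 1)) = 4 * \<eta> * (2 * m + 1)" by simp
          ultimately show "2 * l + 2 * (2 * l) + 4 * \<eta> * (m + (m + 1)) \<le> g * a / 2" using \<eta>2 by linarith
        qed (use a in simp)
        also have "\<dots> = g / 2" using a by (simp add: field_simps)
        finally have gap: "(\<integral>z. z \<bullet> T z \<partial>P) - max_correlation n Q x / n \<le> g / 2" .
        have "excess n x = ((\<Sum>j=1..n. \<phi> (x j)) / n - (\<integral>z. \<phi> z \<partial>P))
          + ((\<integral>z. z \<bullet> T z \<partial>P) - max_correlation n Q x / n)"
          unfolding excess_def V_def duality(2) by (simp add: diff_divide_distrib)
        then show ?thesis using d2 gap g by linarith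
      qed
      then show ?case by force
    qed
    then show ?thesis by (rule S.finite_measure_mono_AE) (rule Bs)
  qed
  show ?thesis
  proof (rule tendsto_sandwich[OF _ _ tendsto_const lim])
    show "\<forall>\<^sub>F n in sequentially. measure (sample n) {x \<in> space (sample n). g < excess n x}
      \<le> (\<Sum>v\<in>Vp. measure (sample n) (deviates (indicator {w. s w = v}) (\<eta> * p v) n))
      + (measure (sample n) (deviates \<phi> (g / 4) n) + (measure (sample n) (deviates (\<lambda>z. (norm (z - s z))\<^sup>2) l n)
        + measure (sample n) (deviates (\<lambda>z. (norm z)\<^sup>2) 1 n)))"
      using eventually_ge_at_top[of 1] by eventually_elim (use le Bm order_trans in blast)
  qed auto
qed

text \<open>Young's inequality integrated against \<open>\<nu> j\<close>; its linear side sees only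
  the barycenter.\<close>

lemma plan_young:
  assumes \<nu>: "plan n Q \<nu>" and j: "j \<in> {1..n}" and z: "z \<in> U"
  shows "z \<bullet> barycenter \<nu> j \<le> \<phi> z + (\<integral>y. \<psi> y \<partial>\<nu> j)"
proof -
  interpret N: prob_space "\<nu> j" by (rule planD(1)[OF \<nu> j])
  have "integrable Q (\<lambda>y. y)" using nQ by (subst (asm) integrable_norm_iff) auto
  from plan_integrable[OF \<nu> j sQ this] have i: "integrable (\<nu> j) (\<lambda>y. y)" .
  have i\<psi>: "integrable (\<nu> j) \<psi>" by (rule plan_integrable[OF \<nu> j sQ \<psi>_int])
  have "z \<bullet> barycenter \<nu> j = (\<integral>y. z \<bullet> y \<partial>\<nu> j)" unfolding barycenter_def using i by simp
  also have "\<dots> \<le> (\<integral>y. \<phi> z + \<psi> y \<partial>\<nu> j)"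
  proof (rule integral_mono_AE)
    show "AE y in \<nu> j. z \<bullet> y \<le> \<phi> z + \<psi> y"
      using plan_AE[OF \<nu> j sQ AE_D] by eventually_elim (rule young_real[OF z])
  qed (use i i\<psi> in auto)
  also have "\<dots> = \<phi> z + (\<integral>y. \<psi> y \<partial>\<nu> j)" using i\<psi> by (simp add: N.prob_space)
  finally show ?thesis .
qed

text \<open>The share of position \<open>j\<close> in the duality gap. Averaging
  \<open>\<psi>\<close> over \<open>\<nu> j\<close>, rather than evaluating it at the barycenter,
  makes the shares add up exactly.\<close>

definition slack :: "(nat \<Rightarrow> 'a) \<Rightarrow> (nat \<Rightarrow> 'a measure) \<Rightarrow> nat \<Rightarrow> real" where
  "slack x \<nu> j = \<phi> (x j) + (\<integral>y. \<psi> y \<partial>\<nu> j) - x j \<bullet> barycenter \<nu> j"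

lemma slack_nonneg: "plan n Q \<nu> \<Longrightarrow> j \<in> {1..n} \<Longrightarrow> x j \<in> U \<Longrightarrow> 0 \<le> slack x \<nu> j"
  using plan_young[of n \<nu> j "x j"] by (simp add: slack_def)

lemma slack_subgradient:
  assumes "plan n Q \<nu>" "j \<in> {1..n}" "z \<in> U"
  shows "barycenter \<nu> j \<bullet> (z - x j) \<le> \<phi> z - \<phi> (x j) + slack x \<nu> j"
  using plan_young[OF assms] by (simp add: slack_def inner_diff_right inner_commute)

text \<open>Since slacks are nonnegative on \<open>U\<close>, a small excess leaves only a small
  fraction of positions with a large slack.\<close>

lemma sum_slack:
  assumes \<nu>: "plan n Q \<nu>" and n: "1 \<le> n" and opt: "max_correlation n Q x - e \<le> correlation n x \<nu>"
  shows "(\<Sum>j=1..n. slack x \<nu> j) \<le> n * excess n x + e"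
proof -
  have "(\<Sum>j=1..n. slack x \<nu> j) = (\<Sum>j=1..n. \<phi> (x j)) + n * (\<integral>y. \<psi> y \<partial>Q) - correlation n x \<nu>"
    unfolding slack_def correlation_def using plan_sum_integral[OF \<nu> sQ \<psi>_int] by (simp add: sum.distrib sum_subtractf)
  also have "\<dots> \<le> n * excess n x + e"
  proof -
    have "n * excess n x = n * (\<integral>y. \<psi> y \<partial>Q) - V n x" using n by (simp add: excess_def right_diff_distrib)
    then show ?thesis using opt unfolding V_def by linarith
  qed
  finally show ?thesis .
qed

text \<open>The splitting rotated along \<open>js\<close> competes for the resampled sample and so
  bounds its maximal correlation from below.\<close>

lemma V_resample:
  assumes \<nu>: "plan n Q \<nu>" and opt: "max_correlation n Q x - e \<le> correlation n x \<nu>"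
    and i: "i \<in> {1..n}" and js: "set js \<subseteq> {1..n}" "distinct js" "i \<notin> set js"
  shows "V n x - V n (x(i := y)) \<le> e + \<phi> y - \<phi> (x i) - walk x (barycenter \<nu>) (barycenter \<nu> i) (x i) js y"
proof -
  obtain \<nu>' where \<nu>': "plan n Q \<nu>'" "correlation n (x(i := y)) \<nu>'
    = correlation n (x(i := x i)) \<nu> + walk x (barycenter \<nu>) (barycenter \<nu> i) (x i) js y"
    using plan_rotate[OF \<nu> i js, of x y "x i"] by blast
  have "correlation n (x(i := y)) \<nu>' \<le> max_correlation n Q (x(i := y))"
    by (rule correlation_le_max[OF sQ nQ \<nu>'(1)])
  moreover have "(\<Sum>j=1..n. \<phi> ((x(i := y)) j)) = (\<Sum>j=1..n. \<phi> (x j)) - \<phi> (x i) + \<phi> y"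
  proof -
    have "(\<Sum>j\<in>{1..n} - {i}. \<phi> ((x(i := y)) j)) = (\<Sum>j\<in>{1..n} - {i}. \<phi> (x j))" by (intro sum.cong) auto
    then show ?thesis
      unfolding sum.remove[OF finite_atLeastAtMost i] by simp
  qed
  ultimately show ?thesis using \<nu>'(2) opt unfolding V_def fun_upd_triv by linarith
qed

text \<open>The empty chain. This bound holds at every position and is affordable wherever the slack
  is large or the points leave the compact set, provided that such positions are few.\<close>

lemma V_resample_direct:
  assumes \<nu>: "plan n Q \<nu>" and opt: "max_correlation n Q x - e \<le> correlation n x \<nu>"
    and i: "i \<in> {1..n}" and y: "good y" and xi: "x i \<in> U"
  shows "V n x - V n (x(i := y)) \<le> e + (norm (T y) + norm (barycenter \<nu> i) + norm y + norm (x i))\<^sup>2"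
proof -
  let ?b = "barycenter \<nu> i"
  have "V n x - V n (x(i := y)) \<le> e + \<phi> y - \<phi> (x i) - ?b \<bullet> (y - x i)"
    using V_resample[OF \<nu> opt i, of "[]" y] by simp
  moreover have "\<phi> y - \<phi> (x i) \<le> T y \<bullet> (y - x i)" by (rule subgradient_T[OF y xi])
  moreover have "T y \<bullet> (y - x i) \<le> norm (T y) * norm (y - x i)" by (rule norm_cauchy_schwarz)
  moreover have "- (?b \<bullet> (y - x i)) \<le> norm ?b * norm (y - x i)"
    using Cauchy_Schwarz_ineq2[of ?b "y - x i"] by linarith
  moreover have "(norm (T y) + norm ?b) * norm (y - x i)
    \<le> (norm (T y) + norm ?b + norm y + norm (x i)) * (norm (T y) + norm ?b + norm y + norm (x i))"
    using norm_triangle_ineq4[of y "x i"] norm_ge_zero[of "T y"] norm_ge_zero[of ?b] norm_ge_zero[of y] norm_ge_zero[of "x i"]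
      norm_ge_zero[of "y - x i"]
    by (intro mult_mono) linarith+
  ultimately show ?thesis by (simp add: power2_eq_square distrib_right[of "norm (T y)" "norm ?b" "norm (y - x i)"])
qed

end

section \<open>Chains of approximate subgradients\<close>

lemma walk_snoc: "walk x b c p (js @ [j]) z = walk x b c p js (x j) + b j \<bullet> (z - x j)"
  by (induction js arbitrary: c p) auto

lemma walk_eq_sum:
  fixes \<zeta> \<beta> :: "nat \<Rightarrow> 'a::euclidean_space"
  assumes "\<And>l. 1 \<le> l \<Longrightarrow> l \<le> k \<Longrightarrow> \<zeta> l = x (J l) \<and> \<beta> l = b (J l)"
  shows "walk x b (\<beta> 0) (\<zeta> 0) (map J [1..<Suc k]) z
    = (\<Sum>l<k. \<beta> l \<bullet> (\<zeta> (Suc l) - \<zeta> l)) + \<beta> k \<bullet> (z - \<zeta> k)"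
  using assms
proof (induction k arbitrary: z)
  case (Suc k)
  have "walk x b (\<beta> 0) (\<zeta> 0) (map J [1..<Suc (Suc k)]) z
    = walk x b (\<beta> 0) (\<zeta> 0) (map J [1..<Suc k]) (x (J (Suc k))) + b (J (Suc k)) \<bullet> (z - x (J (Suc k)))"
    by (simp add: walk_snoc)
  also have "walk x b (\<beta> 0) (\<zeta> 0) (map J [1..<Suc k]) (x (J (Suc k)))
    = (\<Sum>l<k. \<beta> l \<bullet> (\<zeta> (Suc l) - \<zeta> l)) + \<beta> k \<bullet> (x (J (Suc k)) - \<zeta> k)"
    by (rule Suc.IH) (use Suc.prems in auto)
  finally show ?case using Suc.prems[of "Suc k"] by simp
qed simp

text \<open>The increments of \<open>\<beta>\<close> telescope against the equal steps of the segment, so only the deviations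
  of the chain from the segment are multiplied by the number of steps.\<close>

lemma chain_increment_bound:
  fixes \<zeta> \<beta> :: "nat \<Rightarrow> 'a::real_inner"
  assumes L: "\<And>l. l \<le> m \<Longrightarrow> norm (\<beta> l) \<le> L" and m: "0 < m"
    and r: "\<And>l. l \<le> m \<Longrightarrow> norm (\<zeta> l - (x + (real l / real m) *\<^sub>R (y - x))) \<le> r"
  shows "(\<Sum>l<m. (\<beta> (Suc l) - \<beta> l) \<bullet> (\<zeta> (Suc l) - \<zeta> l)) \<le> 2 * L * norm (y - x) / m + m * (4 * L * r)"
proof -
  define \<epsilon> where "\<epsilon> l = \<zeta> l - (x + (real l / real m) *\<^sub>R (y - x))" for l
  have L0: "0 \<le> L" using L[of 0] norm_ge_zero[of "\<beta> 0"] by linarith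
  have st: "\<zeta> (Suc l) - \<zeta> l = (1 / m) *\<^sub>R (y - x) + (\<epsilon> (Suc l) - \<epsilon> l)" for l
    using m by (simp add: \<epsilon>_def algebra_simps add_divide_distrib)
  have "(\<Sum>l<m. (\<beta> (Suc l) - \<beta> l) \<bullet> (\<zeta> (Suc l) - \<zeta> l))
    = (\<Sum>l<m. (\<beta> (Suc l) - \<beta> l) \<bullet> ((1 / m) *\<^sub>R (y - x))) + (\<Sum>l<m. (\<beta> (Suc l) - \<beta> l) \<bullet> (\<epsilon> (Suc l) - \<epsilon> l))"
    unfolding st inner_add_right sum.distrib ..
  also have "(\<Sum>l<m. (\<beta> (Suc l) - \<beta> l) \<bullet> ((1 / m) *\<^sub>R (y - x))) = (\<beta> m - \<beta> 0) \<bullet> ((1 / m) *\<^sub>R (y - x))"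
    unfolding inner_sum_left[symmetric] sum_lessThan_telescope ..
  also have "\<dots> \<le> norm (\<beta> m - \<beta> 0) * norm ((1 / m) *\<^sub>R (y - x))" by (rule norm_cauchy_schwarz)
  also have "\<dots> \<le> (2 * L) * (norm (y - x) / m)"
    using L[of m] L[of 0] norm_triangle_ineq4[of "\<beta> m" "\<beta> 0"] m L0 by (intro mult_mono) auto
  also have "(\<Sum>l<m. (\<beta> (Suc l) - \<beta> l) \<bullet> (\<epsilon> (Suc l) - \<epsilon> l)) \<le> (\<Sum>l<m. (2 * L) * (2 * r))"
  proof (rule sum_mono)
    fix l assume "l \<in> {..<m}"
    then have l: "Suc l \<le> m" "l \<le> m" by auto
    have "(\<beta> (Suc l) - \<beta> l) \<bullet> (\<epsilon> (Suc l) - \<epsilon> l) \<le> norm (\<beta> (Suc l) - \<beta> l) * norm (\<epsilon> (Suc l) - \<epsilon> l)"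
      by (rule norm_cauchy_schwarz)
    also have "\<dots> \<le> (2 * L) * (2 * r)"
      using L[OF l(1)] L[OF l(2)] r[OF l(1)] r[OF l(2)] L0 norm_triangle_ineq4[of "\<beta> (Suc l)" "\<beta> l"]
        norm_triangle_ineq4[of "\<epsilon> (Suc l)" "\<epsilon> l"]
      by (intro mult_mono) (auto simp: \<epsilon>_def)
    finally show "(\<beta> (Suc l) - \<beta> l) \<bullet> (\<epsilon> (Suc l) - \<epsilon> l) \<le> (2 * L) * (2 * r)" .
  qed
  finally show ?thesis by simp
qed

text \<open>Greedy choice: fewer than \<open>k\<close> elements are taken before each choice, so
  sets of size \<open>k\<close> always offer a fresh one. Distinctness is what
  \<open>plan_rotate\<close> demands of a chain.\<close>

lemma distinct_choice:
  assumes "\<And>l. l \<in> {1..k} \<Longrightarrow> finite (S l) \<and> k \<le> card (S l)"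
  shows "\<exists>J. inj_on J {1..k} \<and> (\<forall>l\<in>{1..k::nat}. J l \<in> S l)"
proof -
  have "m \<le> k \<Longrightarrow> \<exists>J. inj_on J {1..m} \<and> (\<forall>l\<in>{1..m}. J l \<in> S l)" for m
  proof (induction m)
    case (Suc m)
    then obtain J where J': "inj_on J {1..m} \<and> (\<forall>l\<in>{1..m}. J l \<in> S l)" using Suc_leD by (elim meta_impE exE)
    then have J: "inj_on J {1..m}" "\<forall>l\<in>{1..m}. J l \<in> S l" by simp_all
    have S: "finite (S (Suc m))" "k \<le> card (S (Suc m))" using assms[of "Suc m"] Suc.prems by auto
    have "card (J ` {1..m}) \<le> m" using card_image_le[of "{1..m}" J] by simp
    then have "card (J ` {1..m}) < card (S (Suc m))" using S(2) Suc.prems by linarith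
    then have "\<not> S (Suc m) \<subseteq> J ` {1..m}" using card_mono[of "J ` {1..m}" "S (Suc m)"] by auto
    then obtain j where j: "j \<in> S (Suc m)" "j \<notin> J ` {1..m}" by auto
    have e: "{1..Suc m} = insert (Suc m) {1..m}" by (rule atLeastAtMostSuc_conv) simp
    have agree: "(J(Suc m := j)) l = J l" if "l \<in> {1..m}" for l using that by simp
    have "inj_on (J(Suc m := j)) {1..m}" using J(1) by (subst inj_on_cong[OF agree])
    moreover have "(J(Suc m := j)) ` {1..m} = J ` {1..m}" by (rule image_cong[OF refl agree])
    ultimately have "inj_on (J(Suc m := j)) {1..Suc m}"
      unfolding e inj_on_insert using j(2) by simp
    moreover have "\<forall>l\<in>{1..Suc m}. (J(Suc m := j)) l \<in> S l"
      unfolding e ball_simps(7) using J(2) j(1) by simp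
    ultimately show ?case by (intro exI conjI)
  qed auto
  then show ?thesis by simp
qed

text \<open>The subgradient inequality is tested at distance \<open>s\<close> from \<open>x\<close>
  in the direction of \<open>b\<close> itself.\<close>

lemma norm_le_of_approximate_subgradient:
  fixes b :: "'a::real_inner"
  assumes s: "0 < s" and M: "\<And>z. z \<in> cball x s \<Longrightarrow> \<bar>f z\<bar> \<le> M"
    and b: "\<And>z. z \<in> cball x s \<Longrightarrow> b \<bullet> (z - x) \<le> f z - f x + c" and c: "0 \<le> c"
  shows "norm b \<le> (2 * M + c) / s"
proof (cases "b = 0")
  case True
  then show ?thesis using s c M[of x] by simp
next
  case False
  define z where "z = x + (s / norm b) *\<^sub>R b"
  have z: "z \<in> cball x s" using False s by (simp add: z_def dist_norm)
  have "s * norm b = b \<bullet> (z - x)" using False by (simp add: z_def dot_square_norm power2_eq_square)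
  also have "\<dots> \<le> 2 * M + c" using b[OF z] M[OF z] M[of x] s by simp
  finally show ?thesis using s by (simp add: pos_le_divide_eq mult.commute)
qed

context sampling
begin

text \<open>A segment in \<open>K\<close> from \<open>x i\<close> to \<open>y\<close> is shadowed by
  sample points of small slack. The net \<open>A\<close>, the radius, the slack level and the number
  of links depend only on \<open>K\<close> and \<open>\<epsilon>\<close>, so they serve all
  \<open>n\<close> at once.\<close>

lemma resample_good:
  assumes K: "compact K" "convex K" "K \<subseteq> U" and \<epsilon>: "0 < \<epsilon>"
  obtains k A \<rho> \<gamma> where "finite A" "A \<subseteq> K" "0 < \<rho>" "0 < \<gamma>"
    "\<And>n x \<nu> i y e. \<lbrakk>plan n Q \<nu>; max_correlation n Q x - e \<le> correlation n x \<nu>; i \<in> {1..n};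
       \<forall>j\<in>{1..n}. x j \<in> U; x i \<in> K; y \<in> K; good y; slack x \<nu> i \<le> \<gamma>;
       \<forall>a\<in>A. k < card {j\<in>{1..n}. x j \<in> ball a \<rho> \<and> slack x \<nu> j \<le> \<gamma>}\<rbrakk>
     \<Longrightarrow> V n x - V n (x(i := y)) \<le> e + \<epsilon>"
proof -
  \<comment> \<open>A margin around \<open>K\<close> inside \<open>U\<close>: a chain point within
    \<open>r / 2\<close> of the segment still has a ball of radius \<open>r / 2\<close> on which
    \<open>\<phi>\<close> is bounded, and this bounds its approximate subgradients by
    \<open>L\<close>.\<close>
  obtain r where r: "0 < r" "(\<Union>z\<in>K. cball z r) \<subseteq> U"
  proof -
    obtain r where "0 < r" "(\<Union>z\<in>K. ball z r) \<subseteq> U"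
      using compact_subset_open_imp_ball_epsilon_subset[OF K(1) open_U K(3)] by blast
    moreover have "(\<Union>z\<in>K. cball z (r / 2)) \<subseteq> (\<Union>z\<in>K. ball z r)" using \<open>0 < r\<close> by (intro UN_mono order_refl) auto
    ultimately show ?thesis using that[of "r / 2"] by auto
  qed
  define K' where "K' = {u + v | u v. u \<in> K \<and> v \<in> cball 0 r}"
  have "compact K'" unfolding K'_def by (rule compact_sums[OF K(1) compact_cball])
  have K'U: "K' \<subseteq> U" using r(2) by (force simp: K'_def dist_norm)
  have inK': "z \<in> K'" if "w \<in> K" "dist w z \<le> r" for w z
    unfolding K'_def using that
    by (intro CollectI exI[of _ w] exI[of _ "z - w"]) (auto simp: dist_norm norm_minus_commute)
  obtain M where M: "\<And>z. z \<in> K' \<Longrightarrow> \<bar>\<phi> z\<bar> \<le> M"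
    using compact_imp_bounded[OF compact_continuous_image[OF continuous_on_subset[OF continuous_on_\<phi> K'U] \<open>compact K'\<close>]]
    unfolding bounded_iff by (metis imageI real_norm_def)
  obtain d where d: "\<And>u v. u \<in> K \<Longrightarrow> v \<in> K \<Longrightarrow> norm (u - v) \<le> d"
    using compact_imp_bounded[OF K(1)] diameter_bounded_bound[of K] by (metis dist_norm)
  define L where "L = \<bar>2 * M + 1\<bar> / (r / 2)"
  have L0: "0 \<le> L" using r(1) by (simp add: L_def)
  \<comment> \<open>The chain has \<open>k\<close> interior points and \<open>m = Suc k\<close>
    steps. The telescoped steps, the detours of size \<open>2 * \<rho>\<close> and the slacks
    receive \<open>\<epsilon> / 4\<close> each.\<close>
  obtain k :: nat where k: "2 * L * \<bar>d\<bar> / (\<epsilon> / 4) \<le> real k" using real_arch_simple by blast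
  define m where "m = Suc k"
  have m: "0 < m" by (simp add: m_def)
  have kd: "2 * L * \<bar>d\<bar> / m \<le> \<epsilon> / 4"
  proof -
    have "2 * L * \<bar>d\<bar> \<le> k * (\<epsilon> / 4)" using k \<epsilon> by (simp add: pos_divide_le_eq)
    also have "\<dots> \<le> m * (\<epsilon> / 4)" using \<epsilon> by (simp add: m_def)
    finally show ?thesis using m by (simp add: pos_divide_le_eq mult.commute)
  qed
  define \<rho> where "\<rho> = min (r / 4) (\<epsilon> / (4 * (m * (8 * L + 1))))"
  have \<rho>: "0 < \<rho>" "2 * \<rho> \<le> r / 2" using r(1) \<epsilon> L0 m by (auto simp: \<rho>_def)
  have \<rho>m: "m * (4 * L * (2 * \<rho>)) \<le> \<epsilon> / 4"
  proof -
    have "m * (4 * L * (2 * \<rho>)) = (m * (8 * L)) * \<rho>" by simp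
    also have "\<dots> \<le> (m * (8 * L + 1)) * (\<epsilon> / (4 * (m * (8 * L + 1))))"
      using L0 m \<rho>(1) by (intro mult_mono) (auto simp: \<rho>_def)
    also have "\<dots> = \<epsilon> / 4" using L0 m by (simp add: field_simps add_nonneg_eq_0_iff)
    finally show ?thesis .
  qed
  define \<gamma> where "\<gamma> = min 1 (\<epsilon> / (4 * m))"
  have \<gamma>: "0 < \<gamma>" "\<gamma> \<le> 1" "m * \<gamma> \<le> \<epsilon> / 4"
  proof -
    show "0 < \<gamma>" "\<gamma> \<le> 1" using \<epsilon> m by (auto simp: \<gamma>_def)
    have "m * \<gamma> \<le> m * (\<epsilon> / (4 * m))" by (intro mult_left_mono) (auto simp: \<gamma>_def)
    then show "m * \<gamma> \<le> \<epsilon> / 4" using m by simp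
  qed
  obtain A where A: "finite A" "A \<subseteq> K" "K \<subseteq> (\<Union>a\<in>A. ball a \<rho>)"
    using seq_compact_imp_totally_bounded[OF compact_imp_seq_compact[OF K(1)], rule_format, OF \<rho>(1)] by (elim exE conjE)
  have nb: "norm b \<le> L" if w: "w \<in> K" "dist w v \<le> r / 2"
    and b: "\<And>z. z \<in> U \<Longrightarrow> b \<bullet> (z - v) \<le> \<phi> z - \<phi> v + c" and c: "0 \<le> c" "c \<le> 1" for b v w c
  proof -
    have sub: "z \<in> K'" if "z \<in> cball v (r / 2)" for z
      using inK'[OF w(1), of z] w(2) that dist_triangle[of w z v] by simp
    have "norm b \<le> (2 * M + c) / (r / 2)"
      by (rule norm_le_of_approximate_subgradient[where f=\<phi> and x=v]) (use r(1) sub M K'U b c in auto)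
    also have "\<dots> \<le> L" unfolding L_def using r(1) c by (intro divide_right_mono) auto
    finally show ?thesis .
  qed
  show ?thesis
  proof (rule that[of A \<rho> \<gamma> k])
    fix n x \<nu> i y e
    assume \<nu>: "plan n Q \<nu>" and opt: "max_correlation n Q x - e \<le> correlation n x \<nu>" and i: "i \<in> {1..n}"
      and xU: "\<forall>j\<in>{1..n}. x j \<in> U" and xi: "x i \<in> K" and y: "y \<in> K" "good y" and si: "slack x \<nu> i \<le> \<gamma>"
      and cnt: "\<forall>a\<in>A. k < card {j\<in>{1..n}. x j \<in> ball a \<rho> \<and> slack x \<nu> j \<le> \<gamma>}"
    define w where "w l = x i + (real l / real m) *\<^sub>R (y - x i)" for l :: nat
    have wK: "w l \<in> K" if "l \<le> m" for l
    proof -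
      have "w l = (1 - real l / m) *\<^sub>R x i + (real l / m) *\<^sub>R y" by (simp add: w_def algebra_simps)
      also have "\<dots> \<in> K" using that m by (intro convexD[OF K(2) xi y(1)]) auto
      finally show ?thesis .
    qed
    have "\<exists>a. a \<in> A \<and> w l \<in> ball a \<rho>" if "l \<in> {1..k}" for l
    proof -
      have "w l \<in> (\<Union>a\<in>A. ball a \<rho>)" using wK[of l] that by (intro subsetD[OF A(3)]) (simp add: m_def)
      then show ?thesis by (elim UN_E) (intro exI conjI)
    qed
    then have "\<forall>l\<in>{1..k}. \<exists>a. a \<in> A \<and> w l \<in> ball a \<rho>" by (rule ballI)
    from bchoice[OF this] obtain c where c: "\<And>l. l \<in> {1..k} \<Longrightarrow> c l \<in> A \<and> w l \<in> ball (c l) \<rho>"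
      by (elim exE) (rule that, drule bspec)
    define S0 where "S0 l = {j\<in>{1..n}. x j \<in> ball (c l) \<rho> \<and> slack x \<nu> j \<le> \<gamma>}" for l
    \<comment> \<open>Discarding \<open>i\<close> costs at most one candidate, which is why strictly
      more than \<open>k\<close> are assumed.\<close>
    define S where "S l = S0 l - {i}" for l
    have "finite (S l) \<and> k \<le> card (S l)" if "l \<in> {1..k}" for l
    proof
      show "finite (S l)" by (simp add: S_def S0_def)
      have "k < card (S0 l)" using bspec[OF cnt, of "c l"] c[OF that] by (simp add: S0_def)
      moreover have "card (S0 l) - card {i} \<le> card (S l)" unfolding S_def by (rule diff_card_le_card_Diff) simp
      ultimately show "k \<le> card (S l)" by simp
    qed
    from distinct_choice[OF this] obtain J where J': "inj_on J {1..k} \<and> (\<forall>l\<in>{1..k}. J l \<in> S l)" by (rule exE)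
    have J: "inj_on J {1..k}" "\<And>l. l \<in> {1..k} \<Longrightarrow> J l \<in> S l" using J' by simp_all
    have Jl: "J l \<in> {1..n}" "x (J l) \<in> ball (c l) \<rho>" "slack x \<nu> (J l) \<le> \<gamma>" "J l \<noteq> i" if "l \<in> {1..k}" for l
      using J(2)[OF that] by (auto simp: S_def S0_def)
    define js where "js = map J [1..<Suc k]"
    have setjs: "set js = J ` {1..k}" by (auto simp: js_def)
    have js: "set js \<subseteq> {1..n}" "distinct js" "i \<notin> set js"
    proof -
      show "set js \<subseteq> {1..n}" "i \<notin> set js" unfolding setjs using Jl by blast+
      have "set [1..<Suc k] = {1..k}" by auto
      then show "distinct js" unfolding js_def distinct_map using J(1) by simp
    qed
    define \<zeta> where "\<zeta> l = (if l = 0 then x i else if l \<le> k then x (J l) else y)" for l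
    \<comment> \<open>The far end \<open>y\<close> carries no mass of the splitting; its exact
      subgradient \<open>T y\<close> takes the place of a barycenter there.\<close>
    define \<beta> where "\<beta> l = (if l = 0 then barycenter \<nu> i else if l \<le> k then barycenter \<nu> (J l) else T y)" for l
    have walk: "walk x (barycenter \<nu>) (barycenter \<nu> i) (x i) js y = (\<Sum>l<m. \<beta> l \<bullet> (\<zeta> (Suc l) - \<zeta> l))"
    proof -
      have "walk x (barycenter \<nu>) (\<beta> 0) (\<zeta> 0) js y = (\<Sum>l<k. \<beta> l \<bullet> (\<zeta> (Suc l) - \<zeta> l)) + \<beta> k \<bullet> (y - \<zeta> k)"
        unfolding js_def by (rule walk_eq_sum) (auto simp: \<zeta>_def \<beta>_def)
      then show ?thesis by (simp add: m_def \<zeta>_def \<beta>_def)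
    qed
    have sub: "\<beta> l \<bullet> (z - \<zeta> l) \<le> \<phi> z - \<phi> (\<zeta> l) + \<gamma>" if l: "l \<le> m" and z: "z \<in> U" for l z
    proof -
      have "l = 0 \<or> l \<in> {1..k} \<or> l = m" using l unfolding m_def atLeastAtMost_iff by linarith
      then consider "l = 0" | "l \<in> {1..k}" | "l = m" by blast
      then show ?thesis
      proof cases
        case 1
        then show ?thesis using slack_subgradient[OF \<nu> i z, of x] si by (simp add: \<beta>_def \<zeta>_def)
      next
        case 2
        then show ?thesis using slack_subgradient[OF \<nu> Jl(1)[OF 2] z, of x] Jl(3)[OF 2] by (simp add: \<beta>_def \<zeta>_def)
      next
        case 3
        then show ?thesis using subgradient_T[OF y(2) z] \<gamma>(1)
          by (simp add: \<beta>_def \<zeta>_def m_def inner_diff_right)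
      qed
    qed
    have dist: "norm (\<zeta> l - w l) \<le> 2 * \<rho>" if l: "l \<le> m" for l
    proof -
      have "l = 0 \<or> l \<in> {1..k} \<or> l = m" using l unfolding m_def atLeastAtMost_iff by linarith
      then consider "l = 0" | "l \<in> {1..k}" | "l = m" by blast
      then show ?thesis
      proof cases
        case 1
        then show ?thesis using \<rho> by (simp add: \<zeta>_def w_def)
      next
        case 2
        have "dist (x (J l)) (w l) \<le> \<rho> + \<rho>"
          using Jl(2)[OF 2] c[OF 2] dist_triangle3[of "x (J l)" "w l" "c l"] by simp
        then show ?thesis using 2 by (simp add: \<zeta>_def dist_norm)
      next
        case 3
        then show ?thesis using \<rho> m by (simp add: \<zeta>_def w_def m_def)
      qed
    qed
    have \<beta>L: "norm (\<beta> l) \<le> L" if l: "l \<le> m" for l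
    proof (rule nb[OF wK[OF l]])
      show "dist (w l) (\<zeta> l) \<le> r / 2" using dist[OF l] \<rho>(2) by (simp add: dist_norm norm_minus_commute)
    qed (use sub[OF l] \<gamma> in auto)
    have \<zeta>U: "\<zeta> l \<in> U" if l: "l \<le> m" for l
      using xU i Jl(1)[of l] K(3) y(1) l by (auto simp: \<zeta>_def)
    \<comment> \<open>Each increment of \<open>\<phi>\<close> is bounded by the subgradient at the
      right end of its step, whereas \<open>walk\<close> pairs the step with the left one; the
      difference is what \<open>chain_increment_bound\<close> controls.\<close>
    have "\<phi> y - \<phi> (x i) = (\<Sum>l<m. \<phi> (\<zeta> (Suc l)) - \<phi> (\<zeta> l))"
      by (subst sum_lessThan_telescope) (simp add: \<zeta>_def m_def)
    also have "\<dots> \<le> (\<Sum>l<m. \<beta> (Suc l) \<bullet> (\<zeta> (Suc l) - \<zeta> l) + \<gamma>)"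
    proof (rule sum_mono)
      fix l assume "l \<in> {..<m}"
      then have "Suc l \<le> m" "l \<le> m" by auto
      from sub[OF this(1) \<zeta>U[OF this(2)]] show "\<phi> (\<zeta> (Suc l)) - \<phi> (\<zeta> l) \<le> \<beta> (Suc l) \<bullet> (\<zeta> (Suc l) - \<zeta> l) + \<gamma>"
        by (simp add: inner_diff_right)
    qed
    finally have "\<phi> y - \<phi> (x i) - walk x (barycenter \<nu>) (barycenter \<nu> i) (x i) js y
      \<le> (\<Sum>l<m. (\<beta> (Suc l) - \<beta> l) \<bullet> (\<zeta> (Suc l) - \<zeta> l)) + m * \<gamma>"
      unfolding walk by (simp add: sum.distrib sum_subtractf inner_diff_left)
    also have "(\<Sum>l<m. (\<beta> (Suc l) - \<beta> l) \<bullet> (\<zeta> (Suc l) - \<zeta> l)) \<le> 2 * L * norm (y - x i) / m + m * (4 * L * (2 * \<rho>))"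
      by (rule chain_increment_bound[OF \<beta>L m]) (use dist in \<open>auto simp: w_def\<close>)
    also have "2 * L * norm (y - x i) / m \<le> 2 * L * \<bar>d\<bar> / m"
      using d[OF y(1) xi] L0 by (intro divide_right_mono mult_left_mono) auto
    finally have "\<phi> y - \<phi> (x i) - walk x (barycenter \<nu>) (barycenter \<nu> i) (x i) js y \<le> \<epsilon>"
      using kd \<rho>m \<gamma>(3) \<epsilon> by linarith
    then show "V n x - V n (x(i := y)) \<le> e + \<epsilon>"
      using V_resample[OF \<nu> opt i js, of y] by linarith
  qed (use A \<rho> \<gamma> in auto)
qed

end

section \<open>The resampling bound\<close>

lemma powr_sum4_le:
  fixes a b c d :: real
  assumes "0 \<le> a" "0 \<le> b" "0 \<le> c" "0 \<le> d" "0 \<le> q"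
  shows "(a + b + c + d) powr q \<le> 4 powr q * (a powr q + b powr q + c powr q + d powr q)"
proof -
  define m where "m = max (max a b) (max c d)"
  have m: "0 \<le> m" using assms by (simp add: m_def le_max_iff_disj)
  have "(a + b + c + d) powr q \<le> (4 * m) powr q" using assms by (intro powr_mono2) (auto simp: m_def)
  also have "\<dots> = 4 powr q * m powr q" using m by (simp add: powr_mult)
  also have "m = a \<or> m = b \<or> m = c \<or> m = d" by (auto simp: m_def max_def)
  then have "m powr q \<le> a powr q + b powr q + c powr q + d powr q"
    using powr_ge_zero[of a q] powr_ge_zero[of b q] powr_ge_zero[of c q] powr_ge_zero[of d q] by auto
  finally show ?thesis by (simp add: mult_left_mono)
qed

text \<open>Truncation at level \<open>\<kappa>\<close>: above it the fourth power is traded for the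
  \<open>q\<close>-th, with a factor that vanishes as \<open>\<kappa>\<close> grows when
  \<open>q > 4\<close>.\<close>

lemma power4_le_powr:
  fixes u \<kappa> :: real
  assumes "0 \<le> u" "1 \<le> \<kappa>" "4 \<le> q"
  shows "u ^ 4 \<le> \<kappa> ^ 4 + \<kappa> powr (4 - q) * u powr q"
proof (cases "u \<le> \<kappa>")
  case True
  then show ?thesis using assms power_mono[of u \<kappa> 4] by (simp add: add_increasing2)
next
  case False
  then have u: "\<kappa> < u" "0 < u" using assms by auto
  have "u ^ 4 = u powr (4 - q) * u powr q" using u by (simp add: powr_add[symmetric])
  also have "\<dots> \<le> \<kappa> powr (4 - q) * u powr q"
    using u assms by (intro mult_right_mono powr_mono2') auto
  finally show ?thesis using assms by (simp add: add_increasing)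
qed

context sampling
begin

definition mP :: real where "mP = (\<integral>x. norm x powr q \<partial>P)"

definition mQ :: real where "mQ = (\<integral>y. norm y powr q \<partial>Q)"

text \<open>Dominates the average over positions of the \<open>q\<close>-th powers of the norm sums
  in \<open>V_resample_direct\<close>; the unknown barycenters enter only through the moment of
  \<open>Q\<close>.\<close>

definition moment_bound :: "nat \<Rightarrow> (nat \<Rightarrow> 'a) \<Rightarrow> 'a \<Rightarrow> real" where
  "moment_bound n x y = 4 powr q * (norm (T y) powr q + norm y powr q
     + (\<Sum>i=1..n. norm (x i) powr q) / n + 2 powr q * mQ)"

text \<open>Positions outside \<open>Bd\<close> use the chain bound \<open>ok\<close>; those in
  \<open>Bd\<close> use the direct bound, whose fourth power is truncated at
  \<open>\<kappa>\<close>.\<close>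

lemma resample_sum_le:
  fixes \<kappa> \<epsilon> e :: real
  assumes n: "1 \<le> n" and \<nu>: "plan n Q \<nu>" and opt: "max_correlation n Q x - e \<le> correlation n x \<nu>"
    and e: "0 \<le> e" "e \<le> \<epsilon>" and \<kappa>: "1 \<le> \<kappa>"
    and xU: "\<forall>j\<in>{1..n}. x j \<in> U" and y: "good y" and Bd: "Bd \<subseteq> {1..n}"
    and ok: "\<And>i. i \<in> {1..n} - Bd \<Longrightarrow> V n x - V n (x(i := y)) \<le> e + \<epsilon>"
  shows "(\<Sum>i=1..n. (max 0 (V n x - V n (x(i := y))))\<^sup>2)
    \<le> n * (6 * \<epsilon>\<^sup>2) + card Bd * (2 * \<kappa>^4) + 2 * \<kappa> powr (4 - q) * (n * moment_bound n x y)"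
proof -
  define R where "R i = max 0 (V n x - V n (x(i := y)))" for i
  define a where "a i = norm (T y) + norm (barycenter \<nu> i) + norm y + norm (x i)" for i
  have a0: "0 \<le> a i" for i by (simp add: a_def)
  \<comment> \<open>A regular position contributes \<open>(2 * \<epsilon>)\<^sup>2\<close>, an
    exceptional one \<open>2 * \<epsilon>\<^sup>2\<close> besides its fourth power;
    \<open>6 * \<epsilon>\<^sup>2\<close> covers both.\<close>
  have "(R i)\<^sup>2 \<le> 6 * \<epsilon>\<^sup>2 + indicator Bd i * (2 * \<kappa>^4) + 2 * (\<kappa> powr (4 - q) * a i powr q)"
    if i: "i \<in> {1..n}" for i
  proof (cases "i \<in> Bd")
    case True
    have "V n x - V n (x(i := y)) \<le> e + (a i)\<^sup>2"
      unfolding a_def by (rule V_resample_direct[OF \<nu> opt i y]) (use xU i in blast)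
    then have "R i \<le> \<epsilon> + (a i)\<^sup>2" unfolding R_def using e zero_le_power2[of "a i"] by linarith
    then have "(R i)\<^sup>2 \<le> (\<epsilon> + (a i)\<^sup>2)\<^sup>2"
      by (intro power_mono) (auto simp: R_def)
    also have "\<dots> \<le> 2 * \<epsilon>\<^sup>2 + 2 * ((a i)\<^sup>2)\<^sup>2"
      using zero_le_power2[of "\<epsilon> - (a i)\<^sup>2"] by (simp add: power2_sum power2_diff)
    also have "((a i)\<^sup>2)\<^sup>2 = a i ^ 4" by (simp flip: power_mult)
    also have "a i ^ 4 \<le> \<kappa> ^ 4 + \<kappa> powr (4 - q) * a i powr q"
      using q by (intro power4_le_powr a0 \<kappa>) auto
    finally have "(R i)\<^sup>2 \<le> 2 * \<epsilon>\<^sup>2 + 2 * (\<kappa> ^ 4 + \<kappa> powr (4 - q) * a i powr q)" by simp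
    then have "(R i)\<^sup>2 \<le> 6 * \<epsilon>\<^sup>2 + 1 * (2 * \<kappa>^4) + 2 * (\<kappa> powr (4 - q) * a i powr q)"
      by (rule order_trans) (simp add: distrib_left)
    then show ?thesis using True by simp
  next
    case False
    then have "V n x - V n (x(i := y)) \<le> e + \<epsilon>" using ok i by blast
    then have "R i \<le> 2 * \<epsilon>" unfolding R_def using e by linarith
    then have "(R i)\<^sup>2 \<le> (2 * \<epsilon>)\<^sup>2" by (intro power_mono) (auto simp: R_def)
    also have "\<dots> \<le> 6 * \<epsilon>\<^sup>2" by (simp add: power_mult_distrib)
    finally show ?thesis using False by (simp add: add_increasing2)
  qed
  then have "(\<Sum>i=1..n. (R i)\<^sup>2)
    \<le> (\<Sum>i=1..n. 6 * \<epsilon>\<^sup>2 + indicator Bd i * (2 * \<kappa>^4) + 2 * (\<kappa> powr (4 - q) * a i powr q))"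
    by (rule sum_mono)
  also have "\<dots> = n * (6 * \<epsilon>\<^sup>2) + card Bd * (2 * \<kappa>^4) + 2 * \<kappa> powr (4 - q) * (\<Sum>i=1..n. a i powr q)"
  proof -
    have "(\<Sum>i=1..n. indicator Bd i :: real) = card Bd"
    proof -
      have "Bd \<inter> {Suc 0..n} = Bd" using Bd by auto
      then show ?thesis by (simp add: indicator_def sum.If_cases Int_commute)
    qed
    then have "(\<Sum>i=1..n. indicator Bd i * (2 * \<kappa>^4)) = card Bd * (2 * \<kappa>^4)"
      by (simp only: sum_distrib_right[symmetric])
    then show ?thesis by (simp add: sum.distrib sum_distrib_left mult.assoc)
  qed
  also have "(\<Sum>i=1..n. a i powr q) \<le> n * moment_bound n x y"
  proof -
    have "(\<Sum>i=1..n. a i powr q) \<le> (\<Sum>i=1..n. 4 powr q * (norm (T y) powr q + norm (barycenter \<nu> i) powr q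
      + norm y powr q + norm (x i) powr q))"
      unfolding a_def using q by (intro sum_mono powr_sum4_le) auto
    also have "\<dots> = 4 powr q * (n * norm (T y) powr q + (\<Sum>i=1..n. norm (barycenter \<nu> i) powr q)
      + n * norm y powr q + (\<Sum>i=1..n. norm (x i) powr q))"
      by (simp add: sum_distrib_left[symmetric] sum.distrib)
    also have "\<dots> \<le> 4 powr q * (n * norm (T y) powr q + 2 powr q * (n * mQ)
      + n * norm y powr q + (\<Sum>i=1..n. norm (x i) powr q))"
      using plan_sum_barycenter_powr_le[OF \<nu> sQ nQ iQq] q by (intro mult_left_mono add_mono) (auto simp: mQ_def)
    also have "\<dots> = n * moment_bound n x y"
      using n by (simp add: moment_bound_def field_simps)
    finally show ?thesis .
  qed
  finally show ?thesis unfolding R_def by (simp add: mult_left_mono)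
qed

lemma card_sample: "real (card {j \<in> {1..n}. x j \<in> A}) = n * frequency A n x"
proof -
  have "(\<Sum>j=1..n. indicator A (x j) :: real) = card {j \<in> {1..n}. x j \<in> A}"
    by (simp add: indicator_def sum.If_cases Int_def)
  then show ?thesis by (cases "n = 0") (simp_all add: frequency_def)
qed

text \<open>Inner regularity supplies a compact set. In finite dimension its convex hull is compact,
  and it stays in the convex set \<open>U\<close>; convexity keeps the segments of the chains inside
  \<open>K\<close>.\<close>

lemma compact_convex_approximation:
  assumes "0 < \<eta>"
  obtains K where "compact K" "convex K" "K \<subseteq> U" "measure P (- K) \<le> \<eta>"
proof -
  have Us: "U \<in> sets borel" using open_U by simp
  have U1: "emeasure P U = 1" using P.emeasure_eq_1_AE[OF _ AE_U] Us sP by simp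
  have "emeasure P U = (SUP K\<in>{K. K \<subseteq> U \<and> compact K}. emeasure P K)"
    by (rule inner_regular) (use sP Us in \<open>auto simp: P.emeasure_eq_measure\<close>)
  then have "ennreal (1 - \<eta>) < (SUP K\<in>{K. K \<subseteq> U \<and> compact K}. emeasure P K)"
    unfolding U1[symmetric] using U1 assms by (simp add: ennreal_less_one_iff)
  then obtain K0 where K0: "K0 \<subseteq> U" "compact K0" "ennreal (1 - \<eta>) < emeasure P K0"
    by (auto simp: less_SUP_iff)
  define K where "K = convex hull K0"
  have K: "compact K" "convex K" "K \<subseteq> U"
  proof -
    show "compact K" "convex K" unfolding K_def by (rule compact_convex_hull[OF K0(2)] convex_convex_hull)+
    show "K \<subseteq> U" unfolding K_def using K0(1) convex_U by (rule hull_minimal)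
  qed
  have Ks: "K \<in> sets P" using K(1) sP by (simp add: compact_imp_closed)
  have "emeasure P K0 \<le> emeasure P K"
    using Ks by (intro emeasure_mono) (auto simp: K_def hull_subset)
  with K0(3) have "ennreal (1 - \<eta>) < emeasure P K" by (rule less_le_trans)
  then have "ennreal (1 - \<eta>) < ennreal (measure P K)" by (simp add: P.emeasure_eq_measure)
  then have "1 - \<eta> < measure P K" by (meson ennreal_leI not_le) 
  then have "measure P (- K) \<le> \<eta>" using P.prob_compl[OF Ks] by (simp add: spaceP Compl_eq_Diff_UNIV)
  then show ?thesis using K that by blast
qed

text \<open>\<open>B n\<close> gathers the samples whose frequencies or duality gap misbehave. For
  those, and for \<open>y\<close> outside \<open>K\<close>, every position is declared exceptional,
  which costs the two indicators.\<close>

lemma resample_sum_eventually: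
  fixes \<kappa> \<epsilon> \<eta> :: real
  assumes \<epsilon>: "0 < \<epsilon>" and \<eta>: "0 < \<eta>" and \<kappa>: "1 \<le> \<kappa>"
  obtains B K where "\<And>n. B n \<in> sets (sample n)" "(\<lambda>n. measure (sample n) (B n)) \<longlonglongrightarrow> 0"
    "K \<in> sets borel" "measure P (- K) \<le> \<eta>"
    "\<forall>\<^sub>F n in sequentially. \<forall>x\<in>space (sample n). \<forall>y. (\<forall>j\<in>{1..n}. x j \<in> U) \<longrightarrow> good y \<longrightarrow>
      (\<Sum>i=1..n. (max 0 (V n x - V n (x(i := y))))\<^sup>2)
      \<le> n * (6 * \<epsilon>\<^sup>2 + 2 * \<kappa>^4 * (3 * \<eta> + indicator (B n) x + indicator (- K) y) + 2 * \<kappa> powr (4 - q) * moment_bound n x y)"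
proof -
  obtain K where K: "compact K" "convex K" "K \<subseteq> U" "measure P (- K) \<le> \<eta>"
    using compact_convex_approximation[OF \<eta>] by blast
  obtain k A \<rho> \<gamma> where A: "finite A" "A \<subseteq> K" and \<rho>: "0 < \<rho>" and \<gamma>: "0 < \<gamma>"
    and step: "\<And>n x \<nu> i y e. \<lbrakk>plan n Q \<nu>; max_correlation n Q x - e \<le> correlation n x \<nu>; i \<in> {1..n};
       \<forall>j\<in>{1..n}. x j \<in> U; x i \<in> K; y \<in> K; good y; slack x \<nu> i \<le> \<gamma>;
       \<forall>a\<in>A. k < card {j\<in>{1..n}. x j \<in> ball a \<rho> \<and> slack x \<nu> j \<le> \<gamma>}\<rbrakk>
     \<Longrightarrow> V n x - V n (x(i := y)) \<le> e + \<epsilon>"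
    by (rule resample_good[OF K(1-3) \<epsilon>]) (rule that; assumption)
  \<comment> \<open>The least mass of a ball of the net; the inserted 1 covers an empty net.\<close>
  define p where "p = Min (insert 1 ((\<lambda>a. measure P (ball a \<rho>)) ` A))"
  have p: "0 < p" "\<And>a. a \<in> A \<Longrightarrow> p \<le> measure P (ball a \<rho>)"
  proof -
    have "0 < measure P (ball a \<rho>)" if "a \<in> A" for a
      using that A(2) K(3) \<rho> by (intro measure_ball_pos P sP dens) (auto simp: U_def)
    then show "0 < p" using A(1) by (simp add: p_def)
    show "p \<le> measure P (ball a \<rho>)" if "a \<in> A" for a using that A(1) by (simp add: p_def)
  qed
  \<comment> \<open>The bound by \<open>\<eta>\<close> limits the additional exceptional positions;
    the bound by \<open>p / 4\<close> leaves at least \<open>n * (p / 4)\<close> of the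
    \<open>n * (p / 2)\<close> sample points in each ball with small slack.\<close>
  define \<tau> where "\<tau> = min \<eta> (p / 4)"
  have \<tau>: "0 < \<tau>" "\<tau> \<le> \<eta>" "\<tau> \<le> p / 4" using \<eta> p(1) by (auto simp: \<tau>_def)
  \<comment> \<open>The gap and the optimisation error take half each, so the slacks sum to at most
    \<open>n * (\<gamma> * \<tau>)\<close> and at most \<open>n * \<tau>\<close> positions have a
    slack above \<open>\<gamma>\<close>.\<close>
  define g where "g = \<gamma> * \<tau> / 2"
  have g: "0 < g" using \<gamma> \<tau> by (simp add: g_def)
  have Ks: "K \<in> sets borel" "- K \<in> sets borel" using K(1) by (auto simp: compact_imp_closed)
  define B where "B n = deviates (indicator (- K)) \<eta> n \<union> ((\<Union>a\<in>A. deviates (indicator (ball a \<rho>)) (p / 2) n)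
    \<union> {x \<in> space (sample n). g < excess n x})" for n
  have es: "{x \<in> space (sample n). g < excess n x} \<in> sets (sample n)" for n by measurable
  have Bs: "B n \<in> sets (sample n)" for n
    unfolding B_def by (intro sets.Un sets.finite_UN A(1) deviates_sets es borel_measurable_indicator Ks) auto
  have Bm: "measure (sample n) (B n) \<le> measure (sample n) (deviates (indicator (- K)) \<eta> n)
    + ((\<Sum>a\<in>A. measure (sample n) (deviates (indicator (ball a \<rho>)) (p / 2) n))
      + measure (sample n) {x \<in> space (sample n). g < excess n x})" for n
    unfolding B_def
    by (intro order_trans[OF measure_Un_le] add_mono measure_UNION_le A(1) deviates_sets sets.Un sets.finite_UN
        order_refl es borel_measurable_indicator Ks) auto
  have "(\<lambda>n. measure (sample n) (deviates (indicator (- K)) \<eta> n)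
    + ((\<Sum>a\<in>A. measure (sample n) (deviates (indicator (ball a \<rho>)) (p / 2) n))
      + measure (sample n) {x \<in> space (sample n). g < excess n x})) \<longlonglongrightarrow> 0 + ((\<Sum>a\<in>A. 0) + 0)"
    using p(1) by (intro tendsto_add tendsto_sum deviates_indicator_tendsto Ks \<eta> excess_tendsto g) auto
  then have lim0: "(\<lambda>n. measure (sample n) (deviates (indicator (- K)) \<eta> n)
    + ((\<Sum>a\<in>A. measure (sample n) (deviates (indicator (ball a \<rho>)) (p / 2) n))
      + measure (sample n) {x \<in> space (sample n). g < excess n x})) \<longlonglongrightarrow> 0" by simp
  have lim: "(\<lambda>n. measure (sample n) (B n)) \<longlonglongrightarrow> 0"
    by (rule tendsto_sandwich[OF _ _ tendsto_const lim0]; intro always_eventually allI Bm measure_nonneg)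
  obtain n0 :: nat where n0: "real (k + 1) / (p / 4) \<le> real n0" using real_arch_simple by blast
  show ?thesis
  proof (rule that[OF Bs lim Ks(1) K(4)])
    show "\<forall>\<^sub>F n in sequentially. \<forall>x\<in>space (sample n). \<forall>y. (\<forall>j\<in>{1..n}. x j \<in> U) \<longrightarrow> good y \<longrightarrow>
      (\<Sum>i=1..n. (max 0 (V n x - V n (x(i := y))))\<^sup>2)
      \<le> n * (6 * \<epsilon>\<^sup>2 + 2 * \<kappa>^4 * (3 * \<eta> + indicator (B n) x + indicator (- K) y) + 2 * \<kappa> powr (4 - q) * moment_bound n x y)"
      using eventually_ge_at_top[of "max 1 n0"]
    proof (eventually_elim, intro ballI allI impI)
      fix n x y
      assume nn: "max 1 n0 \<le> n" and x: "x \<in> space (sample n)" and xU: "\<forall>j\<in>{1..n}. x j \<in> U" and y: "good y"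
      have n: "1 \<le> n" using nn by simp
      have nk: "real k + 1 \<le> n * (p / 4)"
      proof -
        have "real (k + 1) / (p / 4) \<le> real n" using n0 nn by linarith
        then show ?thesis using p(1) by (simp add: pos_divide_le_eq)
      qed
      define e where "e = min \<epsilon> g"
      have e: "0 < e" "e \<le> \<epsilon>" "e \<le> g" using \<epsilon> g by (auto simp: e_def)
      obtain \<nu> where \<nu>: "plan n Q \<nu>" and "max_correlation n Q x - e < correlation n x \<nu>"
        using max_correlation_approx[OF Q sQ nQ e(1)] by blast
      then have opt: "max_correlation n Q x - e \<le> correlation n x \<nu>" by simp
      define Bd where "Bd = (if x \<in> B n \<or> y \<notin> K then {1..n} else {i\<in>{1..n}. x i \<in> - K} \<union> {i\<in>{1..n}. \<gamma> < slack x \<nu> i})"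
      have Bd: "Bd \<subseteq> {1..n}" by (auto simp: Bd_def)
      have nB: "card {i\<in>{1..n}. x i \<in> - K} \<le> n * (2 * \<eta>)" "card {i\<in>{1..n}. \<gamma> < slack x \<nu> i} \<le> n * \<tau>"
        "\<forall>a\<in>A. k < card {j\<in>{1..n}. x j \<in> ball a \<rho> \<and> slack x \<nu> j \<le> \<gamma>}" if xB: "x \<notin> B n"
      proof -
        have "\<bar>frequency (- K) n x - measure P (- K)\<bar> < \<eta>"
          using not_deviates[OF x, of "indicator (- K)" \<eta>] xB Ks by (auto simp: B_def frequency_def spaceP sP)
        then have "frequency (- K) n x \<le> 2 * \<eta>" using K(4) by linarith
        then show "card {i\<in>{1..n}. x i \<in> - K} \<le> n * (2 * \<eta>)"
          unfolding card_sample by (intro mult_left_mono) auto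
        have "excess n x \<le> g" using xB x by (auto simp: B_def)
        have sl0: "0 \<le> slack x \<nu> j" if "j \<in> {1..n}" for j using slack_nonneg[OF \<nu> that] xU that by blast
        have "\<gamma> * card {i\<in>{1..n}. \<gamma> < slack x \<nu> i} = (\<Sum>i\<in>{i\<in>{1..n}. \<gamma> < slack x \<nu> i}. \<gamma>)" by simp
        also have "\<dots> \<le> (\<Sum>i\<in>{i\<in>{1..n}. \<gamma> < slack x \<nu> i}. slack x \<nu> i)" by (rule sum_mono) auto
        also have "\<dots> \<le> (\<Sum>i=1..n. slack x \<nu> i)" using sl0 by (intro sum_mono2) auto
        also have "\<dots> \<le> n * excess n x + e" by (rule sum_slack[OF \<nu> n opt])
        also have "\<dots> \<le> n * g + n * g"
        proof (rule add_mono)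
          show "n * excess n x \<le> n * g" using \<open>excess n x \<le> g\<close> by (intro mult_left_mono) auto
          have "1 * g \<le> n * g" using n g by (intro mult_right_mono) auto
          then show "e \<le> n * g" using e(3) by simp
        qed
        also have "\<dots> = \<gamma> * (n * \<tau>)" by (simp add: g_def)
        finally show c: "card {i\<in>{1..n}. \<gamma> < slack x \<nu> i} \<le> n * \<tau>" using \<gamma> by simp
        show "\<forall>a\<in>A. k < card {j\<in>{1..n}. x j \<in> ball a \<rho> \<and> slack x \<nu> j \<le> \<gamma>}"
        proof
          fix a assume a: "a \<in> A"
          have "\<bar>frequency (ball a \<rho>) n x - measure P (ball a \<rho>)\<bar> < p / 2"
            using not_deviates[OF x, of "indicator (ball a \<rho>)" "p / 2"] xB a by (auto simp: B_def frequency_def spaceP sP)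
          then have "p / 2 \<le> frequency (ball a \<rho>) n x" using p(2)[OF a] by linarith
          then have "n * (p / 2) \<le> card {j\<in>{1..n}. x j \<in> ball a \<rho>}"
            unfolding card_sample by (intro mult_left_mono) auto
          moreover have "card {j\<in>{1..n}. x j \<in> ball a \<rho>} \<le> card {j\<in>{1..n}. x j \<in> ball a \<rho> \<and> slack x \<nu> j \<le> \<gamma>}
            + card {i\<in>{1..n}. \<gamma> < slack x \<nu> i}"
            by (rule order_trans[OF card_mono card_Un_le]) auto
          moreover have "n * \<tau> \<le> n * (p / 4)" using \<tau>(3) by (intro mult_left_mono) auto
          moreover have "n * (p / 2) = n * (p / 4) + n * (p / 4)" by simp
          ultimately have "real k < card {j\<in>{1..n}. x j \<in> ball a \<rho> \<and> slack x \<nu> j \<le> \<gamma>}" using nk c by linarith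
          then show "k < card {j\<in>{1..n}. x j \<in> ball a \<rho> \<and> slack x \<nu> j \<le> \<gamma>}" by simp
        qed
      qed
      have ok: "V n x - V n (x(i := y)) \<le> e + \<epsilon>" if i: "i \<in> {1..n} - Bd" for i
      proof -
        have "x \<notin> B n" "y \<in> K" using i by (auto simp: Bd_def split: if_splits)
        moreover from this have "x i \<in> K" "slack x \<nu> i \<le> \<gamma>" "i \<in> {1..n}" using i by (auto simp: Bd_def)
        ultimately show ?thesis using step[OF \<nu> opt _ xU _ _ y] nB(3) by blast
      qed
      \<comment> \<open>For a regular sample and \<open>y\<close> in \<open>K\<close>, points
        outside \<open>K\<close> contribute \<open>2 * \<eta>\<close> and large slacks
        \<open>\<tau> \<le> \<eta>\<close>, which makes \<open>3 * \<eta>\<close>.\<close>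
      have cB: "card Bd \<le> n * (3 * \<eta> + indicator (B n) x + indicator (- K) y)"
      proof (cases "x \<in> B n \<or> y \<notin> K")
        case True
        then have "real n * 1 \<le> n * (3 * \<eta> + indicator (B n) x + indicator (- K) y)"
          using \<eta> by (intro mult_left_mono) (auto simp: indicator_def)
        then show ?thesis using True by (simp add: Bd_def)
      next
        case False
        then have "card Bd \<le> card {i\<in>{1..n}. x i \<in> - K} + card {i\<in>{1..n}. \<gamma> < slack x \<nu> i}"
          by (simp add: Bd_def card_Un_le)
        then have "real (card Bd) \<le> n * (2 * \<eta>) + n * \<tau>" using nB(1,2) False by linarith
        also have "\<dots> \<le> n * (2 * \<eta>) + n * \<eta>" using \<tau>(2) by (intro add_left_mono mult_left_mono) auto
        also have "\<dots> = n * (3 * \<eta> + indicator (B n) x + indicator (- K) y)" using False by simp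
        finally show ?thesis .
      qed
      have "(\<Sum>i=1..n. (max 0 (V n x - V n (x(i := y))))\<^sup>2)
        \<le> n * (6 * \<epsilon>\<^sup>2) + card Bd * (2 * \<kappa>^4) + 2 * \<kappa> powr (4 - q) * (n * moment_bound n x y)"
        using e(1) by (intro resample_sum_le[OF n \<nu> opt _ e(2) \<kappa> xU y Bd ok]) auto
      also have "\<dots> \<le> n * (6 * \<epsilon>\<^sup>2) + (n * (3 * \<eta> + indicator (B n) x + indicator (- K) y)) * (2 * \<kappa>^4)
        + 2 * \<kappa> powr (4 - q) * (n * moment_bound n x y)"
        using \<kappa> by (intro add_mono order_refl mult_right_mono cB) auto
      also have "\<dots> = n * (6 * \<epsilon>\<^sup>2 + 2 * \<kappa>^4 * (3 * \<eta> + indicator (B n) x + indicator (- K) y) + 2 * \<kappa> powr (4 - q) * moment_bound n x y)"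
        by (simp add: algebra_simps)
      finally show "(\<Sum>i=1..n. (max 0 (V n x - V n (x(i := y))))\<^sup>2)
        \<le> n * (6 * \<epsilon>\<^sup>2 + 2 * \<kappa>^4 * (3 * \<eta> + indicator (B n) x + indicator (- K) y) + 2 * \<kappa> powr (4 - q) * moment_bound n x y)" .
    qed
  qed
qed

end

section \<open>Integrating the resampling bound\<close>

lemma (in prob_space) expectation_affine_combination:
  fixes f g :: "'a \<Rightarrow> real"
  assumes "integrable M f" "integrable M g"
  shows "(\<integral>x. n * (c0 + c1 * (f x + k) + c2 * (d * (e + g x + h))) \<partial>M)
    = n * (c0 + c1 * ((\<integral>x. f x \<partial>M) + k) + c2 * (d * (e + (\<integral>x. g x \<partial>M) + h)))"
  using assms by (simp add: prob_space)

context sampling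
begin

lemma resample_measurable:
  assumes "i \<in> {1..n}"
  shows "(\<lambda>(x, y). ennreal ((max 0 (V n x - V n (x(i := y))))\<^sup>2)) \<in> borel_measurable (sample n \<Otimes>\<^sub>M P)"
proof -
  have "(\<lambda>p. (fst p)(i := snd p)) \<in> sample n \<Otimes>\<^sub>M P \<rightarrow>\<^sub>M sample n"
    by (rule measurable_fun_upd[of _ "{1..n}"]) (use assms in auto)
  from measurable_compose[OF this V_meas]
  have [measurable]: "(\<lambda>p. V n ((fst p)(i := snd p))) \<in> borel_measurable (sample n \<Otimes>\<^sub>M P)" .
  show ?thesis unfolding case_prod_beta' by measurable
qed

lemma integral_moment_bound:
  assumes n: "1 \<le> n"
  shows "integrable P (moment_bound n x)"
    and "(\<integral>y. moment_bound n x y \<partial>P) = 4 powr q * (mQ + mP + (\<Sum>i=1..n. norm (x i) powr q) / n + 2 powr q * mQ)"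
    and "integrable (sample n) (\<lambda>x. (\<Sum>i=1..n. norm (x i) powr q) / n)"
    and "(\<integral>x. (\<Sum>i=1..n. norm (x i) powr q) / n \<partial>sample n) = mP"
proof -
  have T: "(\<integral>y. norm (T y) powr q \<partial>P) = mQ"
    using integral_T[of "\<lambda>y. norm y powr q"] by (simp add: mQ_def)
  show "integrable P (moment_bound n x)"
    unfolding moment_bound_def[abs_def] using T_powr iPq by simp
  show "(\<integral>y. moment_bound n x y \<partial>P) = 4 powr q * (mQ + mP + (\<Sum>i=1..n. norm (x i) powr q) / n + 2 powr q * mQ)"
    unfolding moment_bound_def using T_powr iPq by (simp add: T mP_def P.prob_space)
  have i: "integrable (sample n) (\<lambda>x. norm (x i) powr q)" "(\<integral>x. norm (x i) powr q \<partial>sample n) = mP" if "i \<in> {1..n}" for i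
    using P.integrable_PiM_component[OF that iPq] P.integral_PiM_component[OF that iPq] by (simp_all add: mP_def)
  show "integrable (sample n) (\<lambda>x. (\<Sum>i=1..n. norm (x i) powr q) / n)"
    by (intro integrable_divide Bochner_Integration.integrable_sum i)
  have "(\<integral>x. (\<Sum>i=1..n. norm (x i) powr q) / n \<partial>sample n) = (\<Sum>i=1..n. (\<integral>x. norm (x i) powr q \<partial>sample n)) / n"
    by (subst integral_divide_zero, subst Bochner_Integration.integral_sum) (use i in auto)
  also have "\<dots> = (\<Sum>i=1..n. mP) / n" using i(2) by (intro arg_cong2[where f="(/)"] sum.cong) auto
  also have "\<dots> = mP" using n by simp
  finally show "(\<integral>x. (\<Sum>i=1..n. norm (x i) powr q) / n \<partial>sample n) = mP" .
qed

text \<open>The pointwise hypothesis controls only the sum over positions, so the sum is moved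
  inside both integrals before it is applied.\<close>

lemma resample_integral_le:
  assumes n: "1 \<le> n" and B: "B \<in> sets (sample n)" and K: "K \<in> sets borel"
    and c: "0 \<le> c0" "0 \<le> c1" "0 \<le> c2"
    and le: "\<forall>x\<in>space (sample n). \<forall>y. (\<forall>j\<in>{1..n}. x j \<in> U) \<longrightarrow> good y \<longrightarrow>
      (\<Sum>i=1..n. (max 0 (V n x - V n (x(i := y))))\<^sup>2)
      \<le> n * (c0 + c1 * (indicator B x + indicator (- K) y) + c2 * moment_bound n x y)"
  shows "(\<Sum>i=1..n. \<integral>\<^sup>+x. \<integral>\<^sup>+y. ennreal ((max 0 (V n x - V n (x(i := y))))\<^sup>2) \<partial>P \<partial>sample n)
    \<le> ennreal (n * (c0 + c1 * (measure (sample n) B + measure P (- K)) + c2 * (4 powr q * (mQ + 2 * mP + 2 powr q * mQ))))"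
proof -
  interpret S: prob_space "sample n" by (rule prob_sample)
  let ?r = "\<lambda>i x y. (max 0 (V n x - V n (x(i := y))))\<^sup>2"
  let ?a = "\<lambda>x. (\<Sum>i=1..n. norm (x i) powr q) / n"
  define b where "b x y = n * (c0 + c1 * (indicator B x + indicator (- K) y) + c2 * moment_bound n x y)" for x y
  define b' where "b' x = n * (c0 + c1 * (indicator B x + measure P (- K))
    + c2 * (4 powr q * (mQ + mP + ?a x + 2 powr q * mQ)))" for x
  have m0: "0 \<le> mP" "0 \<le> mQ" by (auto simp: mP_def mQ_def intro!: integral_nonneg_AE)
  have mb0: "0 \<le> moment_bound n x y" for x y
    unfolding moment_bound_def using m0 by (intro mult_nonneg_nonneg add_nonneg_nonneg divide_nonneg_nonneg sum_nonneg) auto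
  have b0: "0 \<le> b x y" for x y
    unfolding b_def using c mb0 by (intro mult_nonneg_nonneg add_nonneg_nonneg) auto
  have b'0: "0 \<le> b' x" for x
    unfolding b'_def using c m0 by (intro mult_nonneg_nonneg add_nonneg_nonneg divide_nonneg_nonneg sum_nonneg) auto
  have Km: "- K \<in> sets P" using K sP by auto
  have iK: "integrable P (\<lambda>y. indicator (- K) y :: real)" "(\<integral>y. indicator (- K) y \<partial>P) = measure P (- K)"
    using Km by (auto simp: spaceP intro!: integrable_real_indicator P.emeasure_finite[THEN less_top[THEN iffD1]])
  have iB: "integrable (sample n) (\<lambda>x. indicator B x :: real)" "(\<integral>x. indicator B x \<partial>sample n) = measure (sample n) B"
  proof -
    show "integrable (sample n) (\<lambda>x. indicator B x :: real)"
      by (rule S.integrable_const_bound[of _ 1]) (use B in auto)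
    have "(\<integral>x. indicator B x \<partial>sample n) = measure (sample n) (B \<inter> space (sample n))"
      by (rule Bochner_Integration.integral_indicator)
    then show "(\<integral>x. indicator B x \<partial>sample n) = measure (sample n) B"
      by (simp only: Int_absorb2[OF sets.sets_into_space[OF B]])
  qed
  note M = integral_moment_bound[OF n]
  have ib: "integrable P (b x)" for x
    unfolding b_def[abs_def]
    by (intro integrable_mult_right Bochner_Integration.integrable_add iK M P.integrable_const)
  have Ib: "(\<integral>y. b x y \<partial>P) = b' x" for x
    unfolding b_def b'_def using iK M by (simp add: P.prob_space)
  have ib': "integrable (sample n) b'"
    unfolding b'_def[abs_def]
    by (intro integrable_mult_right Bochner_Integration.integrable_add iB M S.integrable_const)
  have Ib': "(\<integral>x. b' x \<partial>sample n) = n * (c0 + c1 * (measure (sample n) B + measure P (- K)) + c2 * (4 powr q * (mQ + 2 * mP + 2 powr q * mQ)))"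
  proof -
    have "(\<integral>x. b' x \<partial>sample n) = n * (c0 + c1 * (measure (sample n) B + measure P (- K)) + c2 * (4 powr q * (mQ + mP + mP + 2 powr q * mQ)))"
      unfolding b'_def by (subst S.expectation_affine_combination[OF iB(1) M(3)]) (simp only: iB(2) M(4))
    then show ?thesis by simp
  qed
  have rm: "(\<lambda>x. \<integral>\<^sup>+y. ennreal (?r i x y) \<partial>P) \<in> borel_measurable (sample n)" if "i \<in> {1..n}" for i
    by (rule P.borel_measurable_nn_integral[OF resample_measurable[OF that]])
  have rm': "(\<lambda>y. ennreal (?r i x y)) \<in> borel_measurable P" if "i \<in> {1..n}" "x \<in> space (sample n)" for i x
    using measurable_compose[OF measurable_Pair1'[OF that(2)] resample_measurable[OF that(1)]] by simp
  have "(\<Sum>i=1..n. \<integral>\<^sup>+x. \<integral>\<^sup>+y. ennreal (?r i x y) \<partial>P \<partial>sample n)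
    = (\<integral>\<^sup>+x. (\<Sum>i=1..n. \<integral>\<^sup>+y. ennreal (?r i x y) \<partial>P) \<partial>sample n)"
    by (rule nn_integral_sum[symmetric]) (rule rm)
  also have "\<dots> = (\<integral>\<^sup>+x. \<integral>\<^sup>+y. (\<Sum>i=1..n. ennreal (?r i x y)) \<partial>P \<partial>sample n)"
    by (intro nn_integral_cong nn_integral_sum[symmetric] rm')
  also have "\<dots> \<le> (\<integral>\<^sup>+x. ennreal (b' x) \<partial>sample n)"
  proof (rule nn_integral_mono_AE)
    have "AE x in sample n. \<forall>j\<in>{1..n}. x j \<in> U"
      by (intro AE_finite_allI P.AE_PiM_component AE_U) auto
    then show "AE x in sample n. (\<integral>\<^sup>+y. (\<Sum>i=1..n. ennreal (?r i x y)) \<partial>P) \<le> ennreal (b' x)"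
      using AE_space
    proof eventually_elim
      case (elim x)
      have "(\<integral>\<^sup>+y. (\<Sum>i=1..n. ennreal (?r i x y)) \<partial>P) \<le> (\<integral>\<^sup>+y. ennreal (b x y) \<partial>P)"
      proof (rule nn_integral_mono_AE)
        show "AE y in P. (\<Sum>i=1..n. ennreal (?r i x y)) \<le> ennreal (b x y)"
          using AE_good
        proof eventually_elim
          case y: (elim y)
          have "(\<Sum>i=1..n. ?r i x y) \<le> b x y" unfolding b_def using le elim y by blast
          then show ?case by (subst sum_ennreal) (auto intro: ennreal_leI)
        qed
      qed
      also have "\<dots> = ennreal (\<integral>y. b x y \<partial>P)" by (rule nn_integral_eq_integral[OF ib]) (simp add: b0)
      finally show ?case by (simp only: Ib)
    qed
  qed
  also have "\<dots> = ennreal (\<integral>x. b' x \<partial>sample n)" by (rule nn_integral_eq_integral[OF ib']) (simp add: b'0)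
  finally show ?thesis by (simp only: Ib')
qed

section \<open>The variance of the maximal correlation\<close>

definition variance_V :: "nat \<Rightarrow> real" where
  "variance_V n = (\<integral>x. (V n x)\<^sup>2 \<partial>sample n) - (\<integral>x. V n x \<partial>sample n)\<^sup>2"

lemma variance_V_nonneg: "0 \<le> variance_V n"
proof -
  interpret S: prob_space "sample n" by (rule prob_sample)
  have i: "integrable (sample n) (V n)" by (rule S.square_integrable_imp_integrable[OF V_meas V_square])
  show ?thesis
    using S.variance_positive[of "V n"] unfolding variance_V_def S.variance_eq[OF i V_square] .
qed

lemma variance_V_eventually:
  fixes \<zeta> :: real
  assumes \<zeta>: "0 < \<zeta>"
  shows "\<forall>\<^sub>F n in sequentially. variance_V n \<le> n * \<zeta>"
proof -
  define C where "C = 4 powr q * (mQ + 2 * mP + 2 powr q * mQ)"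
  have m0: "0 \<le> mP" "0 \<le> mQ" by (auto simp: mP_def mQ_def intro!: integral_nonneg_AE)
  then have C0: "0 \<le> C" by (simp add: C_def)
  \<comment> \<open>The level \<open>\<kappa>\<close> comes before \<open>\<eta>\<close>, which must
    be small against \<open>\<kappa>^4\<close>. Truncated moments, \<open>\<epsilon>\<close>, the
    exceptional mass (\<open>3 * \<eta>\<close> from positions and \<open>\<eta>\<close> from
    \<open>y\<close>) and the bad samples each receive \<open>\<zeta> / 4\<close>.\<close>
  obtain \<kappa> :: real where \<kappa>: "1 \<le> \<kappa>" "2 * \<kappa> powr (4 - q) * C \<le> \<zeta> / 4"
  proof -
    have "((\<lambda>u :: real. u powr (4 - q)) \<longlongrightarrow> 0) at_top"
      using q by (intro tendsto_neg_powr filterlim_ident) auto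
    then have "\<forall>\<^sub>F u :: real in at_top. u powr (4 - q) < \<zeta> / (8 * (C + 1))"
      using \<zeta> C0 by (intro order_tendstoD) auto
    then have "\<forall>\<^sub>F u :: real in at_top. u powr (4 - q) < \<zeta> / (8 * (C + 1)) \<and> 1 \<le> u"
      using eventually_ge_at_top by (rule eventually_conj)
    then obtain u :: real where u: "u powr (4 - q) < \<zeta> / (8 * (C + 1))" "1 \<le> u"
      by (auto simp: eventually_at_top_linorder)
    have "2 * u powr (4 - q) * C \<le> 2 * (\<zeta> / (8 * (C + 1))) * (C + 1)"
      using u C0 \<zeta> by (intro mult_mono) auto
    also have "\<dots> = \<zeta> / 4" using C0 by (simp add: field_simps)
    finally show ?thesis using that u(2) by blast
  qed
  define \<epsilon> where "\<epsilon> = sqrt (\<zeta> / 24)"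
  have \<epsilon>: "0 < \<epsilon>" "6 * \<epsilon>\<^sup>2 = \<zeta> / 4" using \<zeta> by (auto simp: \<epsilon>_def)
  define \<eta> where "\<eta> = \<zeta> / (32 * \<kappa>^4)"
  have \<eta>: "0 < \<eta>" "2 * \<kappa>^4 * (4 * \<eta>) = \<zeta> / 4" using \<zeta> \<kappa>(1) by (auto simp: \<eta>_def)
  obtain B K where B: "\<And>n. B n \<in> sets (sample n)" "(\<lambda>n. measure (sample n) (B n)) \<longlonglongrightarrow> 0"
    and K: "K \<in> sets borel" "measure P (- K) \<le> \<eta>"
    and ev: "\<forall>\<^sub>F n in sequentially. \<forall>x\<in>space (sample n). \<forall>y. (\<forall>j\<in>{1..n}. x j \<in> U) \<longrightarrow> good y \<longrightarrow>
      (\<Sum>i=1..n. (max 0 (V n x - V n (x(i := y))))\<^sup>2)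
      \<le> n * (6 * \<epsilon>\<^sup>2 + 2 * \<kappa>^4 * (3 * \<eta> + indicator (B n) x + indicator (- K) y) + 2 * \<kappa> powr (4 - q) * moment_bound n x y)"
    by (rule resample_sum_eventually[OF \<epsilon>(1) \<eta>(1) \<kappa>(1)]) (rule that; assumption)
  have "(\<lambda>n. 2 * \<kappa>^4 * measure (sample n) (B n)) \<longlonglongrightarrow> 2 * \<kappa>^4 * 0" by (intro tendsto_intros B(2))
  then have evB: "\<forall>\<^sub>F n in sequentially. 2 * \<kappa>^4 * measure (sample n) (B n) < \<zeta> / 4"
    using \<zeta> by (intro order_tendstoD) auto
  show ?thesis
    using ev evB eventually_ge_at_top[of 1]
  proof eventually_elim
    case (elim n)
    let ?c0 = "6 * \<epsilon>\<^sup>2 + 2 * \<kappa>^4 * (3 * \<eta>)" and ?c1 = "2 * \<kappa>^4" and ?c2 = "2 * \<kappa> powr (4 - q)"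
    have le: "\<forall>x\<in>space (sample n). \<forall>y. (\<forall>j\<in>{1..n}. x j \<in> U) \<longrightarrow> good y \<longrightarrow>
      (\<Sum>i=1..n. (max 0 (V n x - V n (x(i := y))))\<^sup>2)
      \<le> n * (?c0 + ?c1 * (indicator (B n) x + indicator (- K) y) + ?c2 * moment_bound n x y)"
    proof (intro ballI allI impI)
      fix x y assume "x \<in> space (sample n)" "\<forall>j\<in>{1..n}. x j \<in> U" "good y"
      with elim(1) have "(\<Sum>i=1..n. (max 0 (V n x - V n (x(i := y))))\<^sup>2)
        \<le> n * (6 * \<epsilon>\<^sup>2 + 2 * \<kappa>^4 * (3 * \<eta> + indicator (B n) x + indicator (- K) y) + 2 * \<kappa> powr (4 - q) * moment_bound n x y)"
        by blast
      also have "\<dots> = n * (?c0 + ?c1 * (indicator (B n) x + indicator (- K) y) + ?c2 * moment_bound n x y)"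
        by (simp only: distrib_left add.assoc)
      finally show "(\<Sum>i=1..n. (max 0 (V n x - V n (x(i := y))))\<^sup>2)
        \<le> n * (?c0 + ?c1 * (indicator (B n) x + indicator (- K) y) + ?c2 * moment_bound n x y)" .
    qed
    have c: "0 \<le> ?c0" "0 \<le> ?c1" "0 \<le> ?c2" using \<eta>(1) \<kappa>(1) by auto
    have "ennreal (variance_V n) \<le> (\<Sum>i\<in>{1..n}. \<integral>\<^sup>+x. \<integral>\<^sup>+y. ennreal ((max 0 (V n x - V n (x(i := y))))\<^sup>2) \<partial>P \<partial>sample n)"
      unfolding variance_V_def by (rule P.efron_stein[OF _ V_meas V_square]) simp
    also have "\<dots> \<le> ennreal (n * (?c0 + ?c1 * (measure (sample n) (B n) + measure P (- K)) + ?c2 * C))"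
      unfolding C_def by (rule resample_integral_le[OF elim(3) B(1) K(1) c le])
    also have "\<dots> \<le> ennreal (n * \<zeta>)"
    proof (intro ennreal_leI mult_left_mono)
      have "?c1 * measure P (- K) \<le> ?c1 * \<eta>" using K(2) by (intro mult_left_mono) auto
      moreover have "?c1 * (measure (sample n) (B n) + measure P (- K)) = ?c1 * measure (sample n) (B n) + ?c1 * measure P (- K)"
        by (rule distrib_left)
      moreover have "2 * \<kappa>^4 * (3 * \<eta>) + ?c1 * \<eta> = \<zeta> / 4" using \<eta>(2) by (simp add: algebra_simps)
      ultimately show "?c0 + ?c1 * (measure (sample n) (B n) + measure P (- K)) + ?c2 * C \<le> \<zeta>"
        using \<epsilon>(2) elim(2) \<kappa>(2) by linarith
    qed simp
    finally show ?case using \<zeta> by (subst (asm) ennreal_le_iff) auto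
  qed
qed

lemma variance_V_tendsto: "(\<lambda>n. variance_V n / n) \<longlonglongrightarrow> 0"
proof (rule LIMSEQ_I)
  fix \<zeta> :: real assume \<zeta>: "0 < \<zeta>"
  then have "\<forall>\<^sub>F n in sequentially. variance_V n \<le> n * (\<zeta> / 2)" by (intro variance_V_eventually) simp
  then have "\<forall>\<^sub>F n in sequentially. norm (variance_V n / n - 0) < \<zeta>"
    using eventually_ge_at_top[of 1]
  proof eventually_elim
    case (elim n)
    then have "variance_V n / n \<le> \<zeta> / 2" by (simp add: divide_le_eq mult.commute)
    moreover have "0 \<le> variance_V n / n" using variance_V_nonneg[of n] by simp
    ultimately show ?case unfolding real_norm_def using \<zeta> by linarith
  qed
  then show "\<exists>no. \<forall>n\<ge>no. norm (variance_V n / n - 0) < \<zeta>" by (simp add: eventually_sequentially)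
qed

text \<open>The squared norms of the sample points appear in both terms of the remainder and
  cancel.\<close>

lemma remainder_eq:
  assumes n: "1 \<le> n"
  shows "remainder Q \<phi>0 n x = (\<integral>y. (norm y)\<^sup>2 \<partial>Q) - 2 / n * V n x"
proof -
  have w: "wasserstein2_sq (empirical_measure n x) Q
    = (\<Sum>j=1..n. (norm (x j))\<^sup>2) / n + (\<integral>y. (norm y)\<^sup>2 \<partial>Q) - 2 / n * max_correlation n Q x"
    using Q_moment[of 2] by (intro wasserstein2_sq_empirical n Q sQ nQ) simp
  have xm: "x \<in> uniform_count_measure {1..n} \<rightarrow>\<^sub>M borel"
    by (rule measurableI) (auto simp: space_uniform_count_measure sets_uniform_count_measure)
  have "(\<integral>y. ((norm y)\<^sup>2 - 2 * \<phi> y) \<partial>empirical_measure n x)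
    = (\<integral>j. ((norm (x j))\<^sup>2 - 2 * \<phi> (x j)) \<partial>uniform_count_measure {1..n})"
    unfolding empirical_measure_def by (rule integral_distr[OF xm]) measurable
  also have "\<dots> = (\<Sum>j=1..n. (norm (x j))\<^sup>2 - 2 * \<phi> (x j)) / n"
    by (subst integral_uniform_count_measure) auto
  finally show ?thesis
    unfolding remainder_def w \<phi>_def[symmetric] V_def
    by (simp add: sum_subtractf sum_distrib_left[symmetric] diff_divide_distrib right_diff_distrib)
qed

text \<open>Elements of the product space are extensional while sample paths are full sequences;
  this bridges the two.\<close>

lemma V_restrict: "V n (restrict x {1..n}) = V n x"
proof -
  have "correlation n (restrict x {1..n}) \<nu> = correlation n x \<nu>" for \<nu> :: "nat \<Rightarrow> 'a measure"
    unfolding correlation_def by (intro sum.cong) auto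
  moreover have "(\<Sum>j=1..n. \<phi> (restrict x {1..n} j)) = (\<Sum>j=1..n. \<phi> (x j))" by (intro sum.cong) auto
  ultimately show ?thesis by (simp only: V_def max_correlation_def)
qed

end

theorem theorem3p2:
  fixes P Q :: "'a::euclidean_space measure"
    and M :: "'w measure"
    and X :: "nat \<Rightarrow> 'w \<Rightarrow> 'a"
    and \<phi>0 :: "'a \<Rightarrow> ereal"
    and \<delta> :: real
    and R :: "nat \<Rightarrow> 'w \<Rightarrow> real"
  assumes "prob_space P" and "sets P = sets borel"
    and "prob_space Q" and "sets Q = sets borel"
    and "has_positive_density P" and "has_positive_density Q"
    and "0 < \<delta>"
    and "integrable P (\<lambda>x. norm x powr (4 + \<delta>))"
    and "integrable Q (\<lambda>y. norm y powr (4 + \<delta>))"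
    and "optimal_transport_potential P Q \<phi>0"
    and "prob_space M"
    and "prob_space.indep_vars M (\<lambda>_. borel) X {1..}"
    and "\<And>i. 1 \<le> i \<Longrightarrow> distr M borel (X i) = P"
  defines "R \<equiv> \<lambda>n \<omega>. remainder Q \<phi>0 n (\<lambda>i. X i \<omega>)"
  shows "(\<forall>n\<ge>1. R n \<in> borel_measurable M \<and> integrable M (\<lambda>\<omega>. (R n \<omega>)\<^sup>2)) \<and>
         (\<lambda>n. real n * prob_space.variance M (R n)) \<longlonglongrightarrow> 0"
proof -
  interpret M: prob_space M by fact
  have "integrable P (\<lambda>x. norm x ^ 1)"
    by (rule prob_space.integrable_power_of_powr[OF assms(1) _ _ assms(8)])
      (use assms(2,7) in \<open>auto cong: measurable_cong_sets\<close>)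
  then have nP: "integrable P (\<lambda>x. norm x)" by simp
  interpret sampling P Q \<phi>0 "4 + \<delta>"
    by (intro sampling.intro dual_optimal.intro sampling_axioms.intro assms(1-5,8-10) nP) (simp add: assms(7))
  define m where "m = (\<integral>y. (norm y)\<^sup>2 \<partial>Q)"
  have R: "R n \<in> borel_measurable M \<and> integrable M (\<lambda>\<omega>. (R n \<omega>)\<^sup>2) \<and> M.variance (R n) = (2 / n)\<^sup>2 * variance_V n"
    if n: "1 \<le> n" for n
  proof -
    interpret S: prob_space "sample n" by (rule prob_sample)
    define Z where "Z \<omega> = (\<lambda>i\<in>{1..n}. X i \<omega>)" for \<omega>
    define W where "W x = m - 2 / n * V n x" for x
    have rv: "X i \<in> borel_measurable M" if "i \<in> {1..n}" for i
      using assms(12) that unfolding M.indep_vars_def by auto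
    have ind: "M.indep_vars (\<lambda>_. borel) X {1..n}"
      using assms(12) by (rule M.indep_vars_subset) auto
    have "distr M (PiM {1..n} (\<lambda>_. borel)) Z = PiM {1..n} (\<lambda>i. distr M borel (X i))"
      using M.indep_vars_iff_distr_eq_PiM'[where I="{1..n}" and M'="\<lambda>_. borel" and X=X] rv ind n
      unfolding Z_def[abs_def] by auto
    also have "\<dots> = sample n" by (intro PiM_cong refl assms(13)) auto
    finally have dist: "distr M (PiM {1..n} (\<lambda>_. borel)) Z = sample n" .
    have Zm: "Z \<in> M \<rightarrow>\<^sub>M PiM {1..n} (\<lambda>_. borel)" unfolding Z_def[abs_def] by (intro measurable_restrict rv)
    have Wm: "W \<in> borel_measurable (PiM {1..n} (\<lambda>_. borel))"
    proof -
      have "W \<in> borel_measurable (sample n)" unfolding W_def by measurable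
      then show ?thesis by (subst measurable_cong_sets[OF sets_sample[symmetric] refl])
    qed
    have RW: "R n = (\<lambda>\<omega>. W (Z \<omega>))"
      unfolding R_def W_def Z_def m_def by (simp only: remainder_eq[OF n] V_restrict)
    have V1: "integrable (sample n) (V n)" by (rule S.square_integrable_imp_integrable[OF V_meas V_square])
    have W2e: "(W x)\<^sup>2 = m\<^sup>2 - 4 * m / n * V n x + (2 / n)\<^sup>2 * (V n x)\<^sup>2" for x
      by (simp add: W_def power2_diff power_mult_distrib power_divide)
    have W1: "integrable (sample n) W" unfolding W_def[abs_def]
      by (intro Bochner_Integration.integrable_diff S.integrable_const integrable_mult_right V1)
    have W2: "integrable (sample n) (\<lambda>x. (W x)\<^sup>2)" unfolding W2e
      by (intro Bochner_Integration.integrable_add Bochner_Integration.integrable_diff S.integrable_const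
          integrable_mult_right V1 V_square)
    have sq: "(\<lambda>x. (W x)\<^sup>2) \<in> borel_measurable (PiM {1..n} (\<lambda>_. borel))" using Wm by simp
    have iR: "integrable M (R n)" "(\<integral>\<omega>. R n \<omega> \<partial>M) = (\<integral>x. W x \<partial>sample n)"
      using integrable_distr_eq[OF Zm Wm] integral_distr[OF Zm Wm] W1 unfolding RW dist by auto
    have iR2: "integrable M (\<lambda>\<omega>. (R n \<omega>)\<^sup>2)" "(\<integral>\<omega>. (R n \<omega>)\<^sup>2 \<partial>M) = (\<integral>x. (W x)\<^sup>2 \<partial>sample n)"
      using integrable_distr_eq[OF Zm sq] integral_distr[OF Zm sq] W2 unfolding RW dist by auto
    have "R n \<in> borel_measurable M" unfolding RW by (rule measurable_compose[OF Zm Wm])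
    moreover have "M.variance (R n) = S.variance W"
    proof -
      have "M.variance (R n) = (\<integral>x. (W x)\<^sup>2 \<partial>sample n) - (\<integral>x. W x \<partial>sample n)\<^sup>2"
        using M.variance_eq[OF iR(1) iR2(1)] by (simp only: iR(2) iR2(2))
      then show ?thesis by (simp only: S.variance_eq[OF W1 W2])
    qed
    moreover have "S.variance W = (2 / n)\<^sup>2 * variance_V n"
    proof -
      have "(\<integral>x. W x \<partial>sample n) = m - 2 / n * (\<integral>x. V n x \<partial>sample n)"
        unfolding W_def Bochner_Integration.integral_diff[OF S.integrable_const integrable_mult_right[OF V1]]
        by (simp only: integral_mult_right_zero lebesgue_integral_const S.prob_space scaleR_one)
      then have "S.variance W = (\<integral>x. (2 / n)\<^sup>2 * (V n x - (\<integral>x. V n x \<partial>sample n))\<^sup>2 \<partial>sample n)"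
        unfolding W_def
        by (intro Bochner_Integration.integral_cong refl) (simp add: power_mult_distrib[symmetric] power2_commute right_diff_distrib)
      also have "\<dots> = (2 / n)\<^sup>2 * S.variance (V n)" by (rule integral_mult_right_zero)
      finally show ?thesis unfolding S.variance_eq[OF V1 V_square] variance_V_def .
    qed
    ultimately show ?thesis using iR2(1) by simp
  qed
  \<comment> \<open>The factor is \<open>n * (2 / n)\<^sup>2 = 4 / n\<close>.\<close>
  have "(\<lambda>n. 4 * (variance_V n / n)) \<longlonglongrightarrow> 4 * 0" by (intro tendsto_intros variance_V_tendsto)
  moreover have "\<forall>\<^sub>F n in sequentially. 4 * (variance_V n / n) = real n * M.variance (R n)"
    using eventually_ge_at_top[of 1]
  proof eventually_elim
    case (elim n)
    then show ?case using R[OF elim] by (simp add: power2_eq_square)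
  qed
  ultimately have "(\<lambda>n. real n * M.variance (R n)) \<longlonglongrightarrow> 0"
    using Lim_transform_eventually by fastforce
  then show ?thesis using R by blast
qed

end
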